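(* Let $Y(t)$, $t\ge 0$, be a critical Markov branching process with non-homogeneous Poisson immigration, with offspring p.g.f. $f(s)=s+(1-s)^{\gamma+1}L(1/(1-s))$, $s\in[0,1)$, $\gamma\in(0,1]$, immigrant p.g.f. $g(s)=1-(1-s)^{\alpha}l(1/(1-s))$, $\alpha\in(0,1]$, and Poisson intensity $r(t)=t^{-\theta}L_R(t)$, $\theta>0$, where $L,l,L_R$ are slowly varying at infinity. (i) If $\theta\ge 1$ and $0<\alpha/\gamma<1$, then $\mathbf{P}\{Y(t)>0\}\sim R(t)q(t)$ as $t\to\infty$. (ii) If $0<\theta<1$ and $\alpha/\gamma\ge 1$, then $\mathbf{P}\{Y(t)>0\}\sim r(t)Q(t)$ as $t\to\infty$.
   Context: Model. In a Markov branching process each particle, independently of all others, lives an exponentially distributed time with parameter $\mu>0$ and at its death produces a random number $\xi\ge 0$ of new particles of the same type; $f(s)=\mathbf{E}[s^{\xi}]$ is the offspring p.g.f. Let $Z(t)$ be the number of particles at time $t$ and $F(t;s)=\mathbf{E}[s^{Z(t)}\mid Z(0)=1]$, so $\partial F(t;s)/\partial t=\mu[f(F(t;s))-F(t;s)]$, $F(0;s)=s$. Let $\nu(t)$ be a non-homogeneous Poisson process with intensity $r(t)$, mean measure $R(t)=\int_0^t r(u)\,du$ (finite for each $t$), and jump points $0=S_0<S_1<S_2<\cdots$. At each $S_k$, $k\ge1$, $I_k$ new particles immigrate, where $I_1,I_2,\dots$ are i.i.d. non-negative integer-valued with p.g.f. $g(s)=\mathbf{E}[s^{I_k}]$. The Markov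 branching process with non-homogeneous Poisson immigration is $$Y(t)=\sum_{k=1}^{\nu(t)}\sum_{j=1}^{I_k}Z^{(k,j)}(t-S_k),\qquad t\ge 0,$$ where $Z^{(k,j)}$ are i.i.d. copies of $Z$ started from one particle; the processes $Z^{(k,j)}$, the variables $I_k$ and the Poisson process $\nu$ are independent. Notation. $q(t;s)=1-g(F(t;s))$, $q(t)=q(t;0)$, $Q(t)=\int_0^t q(u)\,du$. The symbol $a(t)\sim b(t)$ means $a(t)/b(t)\to1$. *)

theory Defs
  imports "HOL-Probability.Probability"
begin

section \<open>Slow variation and generating functions\<close>

definition slowly_varying :: "(real \<Rightarrow> real) \<Rightarrow> bool" where
  "slowly_varying L \<longleftrightarrow>
     (\<exists>X. L \<in> borel_measurable (restrict_space borel {X..}) \<and> (\<forall>x\<ge>X. L x > 0)) \<and>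
     (\<forall>c>0. ((\<lambda>x. L (c * x) / L x) \<longlongrightarrow> 1) at_top)"

definition pgf :: "nat pmf \<Rightarrow> real \<Rightarrow> real" where
  "pgf p s = measure_pmf.expectation p (\<lambda>n. s ^ n)"

text \<open>A Bochner integral is 0 when it does not exist, so the equation includes finiteness of the mean.\<close>

definition critical :: "nat pmf \<Rightarrow> bool" where
  "critical p \<longleftrightarrow> measure_pmf.expectation p real = 1"


section \<open>Markov branching processes\<close>

text \<open>
  Particles are addressed by the Ulam-Harris labelling: the root is \<open>[]\<close> and \<open>u @ [i]\<close> is the
  child number \<open>i\<close> (counted from 0) of \<open>u\<close>. The particle \<open>u\<close> has lifetime \<open>T u\<close> and
  leaves \<open>X u\<close> children at its death.
\<close>

definition is_born :: "(nat list \<Rightarrow> nat) \<Rightarrow> nat list \<Rightarrow> bool" where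
  "is_born X u \<longleftrightarrow> (\<forall>i<length u. u ! i < X (take i u))"

definition birth_time :: "(nat list \<Rightarrow> real) \<Rightarrow> nat list \<Rightarrow> real" where
  "birth_time T u = (\<Sum>i<length u. T (take i u))"

definition alive :: "(nat list \<Rightarrow> real) \<Rightarrow> (nat list \<Rightarrow> nat) \<Rightarrow> real \<Rightarrow> nat list set" where
  "alive T X t = {u. is_born X u \<and> birth_time T u \<le> t \<and> t < birth_time T u + T u}"

text \<open>
  The branching process with one initial particle, death rate \<open>\<mu>\<close> and offspring law \<open>p\<close>.
  All lifetimes and all offspring numbers are jointly independent; the offspring numbers are
  regarded as real numbers only in order to put both kinds of variables into one family.
  The cardinality of an infinite set is 0, but for critical \<open>p\<close> the set of particles alive is
  almost surely finite at all times.
\<close>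

definition markov_branching_process ::
  "'a measure \<Rightarrow> real \<Rightarrow> nat pmf \<Rightarrow> (real \<Rightarrow> 'a \<Rightarrow> nat) \<Rightarrow> bool" where
  "markov_branching_process M \<mu> p Z \<longleftrightarrow> prob_space M \<and>
     (\<exists>(T :: nat list \<Rightarrow> 'a \<Rightarrow> real) (X :: nat list \<Rightarrow> 'a \<Rightarrow> nat).
        prob_space.indep_vars M (\<lambda>_. borel) (case_sum T (\<lambda>u \<omega>. real (X u \<omega>))) UNIV \<and>
        (\<forall>u. distributed M lborel (T u) (exponential_density \<mu>)) \<and>
        (\<forall>u. distr M (count_space UNIV) (X u) = measure_pmf p) \<and>
        (\<forall>t\<ge>0. \<forall>\<omega>\<in>space M. Z t \<omega> = card (alive (\<lambda>u. T u \<omega>) (\<lambda>u. X u \<omega>) t)))"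


section \<open>Non-homogeneous Poisson processes\<close>

definition mean_measure :: "(real \<Rightarrow> real) \<Rightarrow> real \<Rightarrow> real" where
  "mean_measure r t = (LINT u:{0..t}|lborel. r u)"

text \<open>The \<open>k\<close>-th jump point; it is meaningful only if the counting path reaches the level \<open>k\<close>.\<close>

definition jump_time :: "(real \<Rightarrow> 'a \<Rightarrow> nat) \<Rightarrow> nat \<Rightarrow> 'a \<Rightarrow> real" where
  "jump_time \<nu> k \<omega> = Inf {t. 0 \<le> t \<and> k \<le> \<nu> t \<omega>}"

text \<open>
  The counting paths are right-continuous step functions with \<open>0 = S\<^sub>0 < S\<^sub>1 < S\<^sub>2 < \<dots>\<close>;
  there are finitely many jumps if the path is bounded. The Poisson probabilities are written out
  since the library's \<open>poisson_pmf\<close> does not cover the parameter 0.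
\<close>

definition poisson_process ::
  "'a measure \<Rightarrow> (real \<Rightarrow> real) \<Rightarrow> (real \<Rightarrow> 'a \<Rightarrow> nat) \<Rightarrow> bool" where
  "poisson_process M r \<nu> \<longleftrightarrow> prob_space M \<and>
     (\<forall>t>0. 0 \<le> r t) \<and>
     (\<forall>t\<ge>0. set_integrable lborel {0..t} r) \<and>
     (\<forall>t\<ge>0. \<nu> t \<in> measurable M (count_space UNIV)) \<and>
     (\<forall>\<omega>\<in>space M. \<nu> 0 \<omega> = 0 \<and> mono_on {0..} (\<lambda>t. \<nu> t \<omega>) \<and>
        (\<forall>t\<ge>0. continuous (at_right t) (\<lambda>t. \<nu> t \<omega>)) \<and>
        (\<forall>t\<ge>0. \<forall>k. Suc k \<le> \<nu> t \<omega> \<longrightarrow> jump_time \<nu> k \<omega> < jump_time \<nu> (Suc k) \<omega>)) \<and>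
     (\<forall>\<tau> :: nat \<Rightarrow> real. 0 \<le> \<tau> 0 \<and> mono \<tau> \<longrightarrow>
        prob_space.indep_vars M (\<lambda>_. count_space UNIV)
          (\<lambda>i \<omega>. \<nu> (\<tau> (Suc i)) \<omega> - \<nu> (\<tau> i) \<omega>) UNIV) \<and>
     (\<forall>s t n. 0 \<le> s \<and> s \<le> t \<longrightarrow>
        measure M {\<omega> \<in> space M. \<nu> t \<omega> - \<nu> s \<omega> = n} =
          (mean_measure r t - mean_measure r s) ^ n / fact n
            * exp (- (mean_measure r t - mean_measure r s)))"


section \<open>Immigration\<close>

text \<open>The \<open>\<sigma>\<close>-algebra generated by a family of discrete random variables.\<close>

definition generated_algebra ::
  "'a measure \<Rightarrow> 'i set \<Rightarrow> ('i \<Rightarrow> 'a \<Rightarrow> nat) \<Rightarrow> 'a set set" where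
  "generated_algebra M J X = sigma_sets (space M) {X i -` A \<inter> space M | i A. i \<in> J}"

datatype source = Arrivals | Immigrants nat | Descendants nat nat

primrec source_algebra ::
  "'a measure \<Rightarrow> (real \<Rightarrow> 'a \<Rightarrow> nat) \<Rightarrow> (nat \<Rightarrow> 'a \<Rightarrow> nat) \<Rightarrow>
   (nat \<Rightarrow> nat \<Rightarrow> real \<Rightarrow> 'a \<Rightarrow> nat) \<Rightarrow> source \<Rightarrow> 'a set set" where
  "source_algebra M \<nu> I Z Arrivals = generated_algebra M {0..} \<nu>"
| "source_algebra M \<nu> I Z (Immigrants k) = generated_algebra M {k} I"
| "source_algebra M \<nu> I Z (Descendants k j) = generated_algebra M {0..} (Z k j)"

text \<open>
  The ingredients of the model: \<open>p\<close> is the offspring law, \<open>h\<close> the law of the number of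
  immigrants at a jump point. The processes \<open>Z k j\<close> are copies of the branching process.
\<close>

definition immigration_model ::
  "'a measure \<Rightarrow> real \<Rightarrow> nat pmf \<Rightarrow> nat pmf \<Rightarrow> (real \<Rightarrow> real) \<Rightarrow>
   (real \<Rightarrow> 'a \<Rightarrow> nat) \<Rightarrow> (nat \<Rightarrow> 'a \<Rightarrow> nat) \<Rightarrow> (nat \<Rightarrow> nat \<Rightarrow> real \<Rightarrow> 'a \<Rightarrow> nat) \<Rightarrow> bool" where
  "immigration_model M \<mu> p h r \<nu> I Z \<longleftrightarrow>
     poisson_process M r \<nu> \<and>
     (\<forall>k\<ge>1. distr M (count_space UNIV) (I k) = measure_pmf h) \<and>
     (\<forall>k\<ge>1. \<forall>j\<ge>1. markov_branching_process M \<mu> p (Z k j)) \<and>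
     prob_space.indep_sets M (source_algebra M \<nu> I Z)
       ({Arrivals} \<union> {Immigrants k | k. k \<ge> 1} \<union> {Descendants k j | k j. k \<ge> 1 \<and> j \<ge> 1})"

definition immigration_process ::
  "(real \<Rightarrow> 'a \<Rightarrow> nat) \<Rightarrow> (nat \<Rightarrow> 'a \<Rightarrow> nat) \<Rightarrow> (nat \<Rightarrow> nat \<Rightarrow> real \<Rightarrow> 'a \<Rightarrow> nat) \<Rightarrow>
   real \<Rightarrow> 'a \<Rightarrow> nat" where
  "immigration_process \<nu> I Z t \<omega> =
     (\<Sum>k=1..\<nu> t \<omega>. \<Sum>j=1..I k \<omega>. Z k j (t - jump_time \<nu> k \<omega>) \<omega>)"


section \<open>The functions \<open>F\<close>, \<open>q\<close> and \<open>Q\<close>\<close>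

text \<open>Here \<open>Z\<close> is a branching process with one initial particle on the space \<open>N\<close>.\<close>

definition branching_pgf :: "'b measure \<Rightarrow> (real \<Rightarrow> 'b \<Rightarrow> nat) \<Rightarrow> real \<Rightarrow> real \<Rightarrow> real" where
  "branching_pgf N Z t s = (\<integral>\<omega>. s ^ Z t \<omega> \<partial>N)"

definition q_pgf :: "'b measure \<Rightarrow> (real \<Rightarrow> 'b \<Rightarrow> nat) \<Rightarrow> nat pmf \<Rightarrow> real \<Rightarrow> real \<Rightarrow> real" where
  "q_pgf N Z h t s = 1 - pgf h (branching_pgf N Z t s)"

definition q :: "'b measure \<Rightarrow> (real \<Rightarrow> 'b \<Rightarrow> nat) \<Rightarrow> nat pmf \<Rightarrow> real \<Rightarrow> real" where
  "q N Z h t = q_pgf N Z h t 0"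

definition Q :: "'b measure \<Rightarrow> (real \<Rightarrow> 'b \<Rightarrow> nat) \<Rightarrow> nat pmf \<Rightarrow> real \<Rightarrow> real" where
  "Q N Z h t = (LINT u:{0..t}|lborel. q N Z h u)"

end

theory Submission
  imports Defs
begin

text \<open>
  The immigrants that arrive together at a time \<open>u\<close> have descendants at time \<open>t\<close> with probability
  \<open>q (t - u)\<close>, independently of all other arrivals. Thinning the Poisson process accordingly, the
  number of arrivals whose descendants are present at time \<open>t\<close> is Poisson distributed with mean
  \<open>J t = \<integral>\<^sub>0\<^sup>t r u * q (t - u) du\<close>. Hence the probability that the population is not empty is
  \<open>1 - exp (- J t)\<close> (lemma \<open>immigration_process_prob\<close>), and this is equivalent to \<open>J t\<close> as soon as
  \<open>J t\<close> tends to 0.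

  The integral \<open>J\<close> is a convolution of two regularly varying functions: \<open>r\<close> has index \<open>- \<theta>\<close> by
  assumption, and \<open>q\<close> has index \<open>- (\<alpha> / \<gamma>)\<close> (lemma \<open>survival_function_regularly_varying\<close>). In both
  parts of the theorem one of the two indices is at most \<open>- 1\<close> and the other one lies strictly
  between \<open>- 1\<close> and 0. Let \<open>A\<close> be the function with the smaller index and \<open>B\<close> the other one.
  On the scale of \<open>t\<close> the mass of \<open>A\<close> sits at the origin, because \<open>t * A t\<close> is negligible
  against \<open>\<integral>\<^sub>0\<^sup>t A\<close>, whereas \<open>\<integral>\<^sub>0\<^sup>t B\<close> is of the order of \<open>t * B t\<close> and so \<open>B\<close> does not concentrate there.
  Therefore the convolution is equivalent to \<open>(\<integral>\<^sub>0\<^sup>t A) * B t\<close>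
  (lemma \<open>regularly_varying_convolution\<close>), and this product tends to 0 because it decreases by a
  factor close to \<open>2 powr \<sigma> < 1\<close>, \<open>\<sigma>\<close> the index of \<open>B\<close>, whenever \<open>t\<close> is doubled
  (lemma \<open>regularly_varying_convolution_denominator\<close>).
  Part (i) is the case \<open>A = r\<close>, \<open>B = q\<close>, part (ii) the case \<open>A = q\<close>, \<open>B = r\<close>.

  The index of \<open>q\<close> comes from the backward equation \<open>F' = \<mu> * (f F - F)\<close> for the extinction
  probability \<open>F\<close>. For \<open>x = 1 / (1 - F)\<close> it reads \<open>x' = \<mu> * x powr (1 - \<gamma>) * L x\<close>, so that \<open>x\<close> is the inverse
  of a function of index \<open>\<gamma>\<close>. The backward equation itself is obtained from the tree of the labelled
  particles by splitting at the death of the root (lemmas \<open>branching_recursion\<close> and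
  \<open>extinction_ode\<close>). The same recursion shows that almost surely only finitely many particles are
  born in bounded time; this makes \<open>Z t = 0\<close> the same event as extinction.
\<close>

section \<open>Uniform convergence for regularly varying functions\<close>

text \<open>
  The uniform convergence theorem for slowly varying functions in additive form. For large \<open>x\<close> the
  set of those \<open>v\<close> in \<open>[0, 3K]\<close> for which \<open>h (x + v)\<close> is far from \<open>h x\<close> has small measure, by dominated
  convergence. The bad sets of \<open>x\<close> and of \<open>x + u\<close>, the latter shifted by \<open>u\<close>, therefore cannot cover
  \<open>[K, 2K]\<close>, and a point \<open>v\<close> outside of both links \<open>h (x + u)\<close> to \<open>h x\<close> through \<open>h (x + v)\<close>.
\<close>

lemma uniform_convergence_additive:
  fixes h :: "real \<Rightarrow> real"
  assumes meas: "h \<in> borel_measurable borel"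
    and lim: "\<And>u. ((\<lambda>x. h (x + u) - h x) \<longlongrightarrow> 0) at_top"
    and "0 < K" "0 < \<epsilon>"
  shows "\<exists>x0. \<forall>x\<ge>x0. \<forall>u\<in>{-K..K}. \<bar>h (x + u) - h x\<bar> < \<epsilon>"
proof -
  define E where "E x = {v. 0 \<le> v \<and> v \<le> 3 * K \<and> \<epsilon> / 2 \<le> \<bar>h (x + v) - h x\<bar>}" for x
  have E_sets [measurable]: "E x \<in> sets lborel" for x
  proof -
    have [measurable]: "h \<in> borel_measurable borel" by (rule meas)
    show ?thesis unfolding E_def by measurable
  qed
  have E_sub: "E x \<subseteq> {0..3*K}" for x by (auto simp: E_def)
  have E_fin: "emeasure lborel (E x) < \<infinity>" for x
    using emeasure_mono[OF E_sub, of lborel x] \<open>0 < K\<close> by (auto simp: top.not_eq_extremum intro: le_less_trans)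
  have "((\<lambda>x. \<integral>v. indicator (E x) v \<partial>lborel) \<longlongrightarrow> (\<integral>v. (0::real) \<partial>(lborel :: real measure))) at_top"
  proof (rule integral_dominated_convergence_at_top[where w="indicator {0..3*K}"])
    show "integrable lborel (indicator {0..3*K} :: real \<Rightarrow> real)"
      using \<open>0 < K\<close> by (intro integrable_real_indicator) auto
    show "AE v in lborel. ((\<lambda>x. indicator (E x) v :: real) \<longlongrightarrow> 0) at_top"
    proof (rule AE_I2)
      fix v
      have "eventually (\<lambda>x. \<bar>h (x + v) - h x\<bar> < \<epsilon> / 2) at_top"
        using tendstoD[OF lim[of v], of "\<epsilon>/2"] \<open>0 < \<epsilon>\<close> by (auto simp: dist_real_def)
      then show "((\<lambda>x. indicator (E x) v :: real) \<longlongrightarrow> 0) at_top"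
        by (intro tendsto_eventually) (auto elim!: eventually_mono simp: E_def indicator_def)
    qed
    show "\<forall>\<^sub>F x in at_top. AE v in lborel. norm (indicator (E x) v :: real) \<le> indicator {0..3*K} v"
      by (auto simp: indicator_def E_def intro!: always_eventually)
  qed auto
  then have "((\<lambda>x. measure lborel (E x)) \<longlongrightarrow> 0) at_top"
    by simp
  from tendstoD[OF this, of "K/2"] \<open>0 < K\<close>
  obtain x1 where x1: "\<And>x. x \<ge> x1 \<Longrightarrow> measure lborel (E x) < K/2"
    by (auto simp: eventually_at_top_linorder)
  have "\<bar>h (x + u) - h x\<bar> < \<epsilon>" if x: "x \<ge> x1 + K" and u: "u \<in> {-K..K}" for x u
  proof -
    define E' where "E' = (+) (- u) -` E (x + u)"
    have E'_sets [measurable]: "E' \<in> sets lborel"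
    proof -
      have "(+) (- u) -` E (x + u) \<inter> space borel \<in> sets borel"
        by (rule measurable_sets[where A=borel]) (use E_sets[of "x+u"] in auto)
      then show ?thesis by (simp add: E'_def)
    qed
    have E'_m: "emeasure lborel E' = emeasure lborel (E (x + u))"
    proof -
      have "emeasure lborel (E (x+u)) = emeasure (distr lborel borel ((+) (-u))) (E (x+u))"
        using lborel_distr_plus[of "-u"] by simp
      also have "\<dots> = emeasure lborel E'"
        using E_sets[of "x+u"] by (subst emeasure_distr) (auto simp: E'_def)
      finally show ?thesis by simp
    qed
    have "measure lborel (E x \<union> E') \<le> measure lborel (E x) + measure lborel E'"
      by (rule measure_Un_le[OF E_sets E'_sets])
    also have "\<dots> < K/2 + K/2"
      using x1[of x] x1[of "x+u"] x u \<open>0 < K\<close> E'_m by (intro add_strict_mono) (auto simp: measure_def)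
    finally have less: "measure lborel (E x \<union> E') < K" by simp
    \<comment> \<open>E x and the shifted set E' together have measure less than K.\<close>
    have "\<not> {K..2*K} \<subseteq> E x \<union> E'"
    proof
      assume sub: "{K..2*K} \<subseteq> E x \<union> E'"
      have "measure lborel {K..2*K} \<le> measure lborel (E x \<union> E')"
        by (rule measure_mono_fmeasurable[OF sub])
          (use E_fin[of x] E_fin[of "x+u"] E'_m in
            \<open>auto intro!: fmeasurable.Un fmeasurableI[OF E_sets] fmeasurableI[OF E'_sets]\<close>)
      then show False using less \<open>0 < K\<close> by simp
    qed
    then obtain v where v: "K \<le> v" "v \<le> 2*K" "v \<notin> E x" "v \<notin> E'"
      by (meson UnCI atLeastAtMost_iff subsetI)
    have "\<bar>h (x + v) - h x\<bar> < \<epsilon>/2"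
      using v \<open>0 < K\<close> by (auto simp: E_def)
    moreover
    have "\<bar>h (x + u + (- u + v)) - h (x + u)\<bar> < \<epsilon>/2"
      using v \<open>0 < K\<close> u by (auto simp: E_def E'_def)
    then have "\<bar>h (x + v) - h (x + u)\<bar> < \<epsilon>/2" by simp
    ultimately show ?thesis by linarith
  qed
  then show ?thesis by blast
qed

text \<open>
  Measurability and positivity are only asked for near infinity, to match the notion of slow
  variation; slow variation is regular variation with index 0.
\<close>

definition regularly_varying :: "(real \<Rightarrow> real) \<Rightarrow> real \<Rightarrow> bool" where
  "regularly_varying f \<rho> \<longleftrightarrow>
     (\<exists>X. f \<in> borel_measurable (restrict_space borel {X..}) \<and> (\<forall>x\<ge>X. f x > 0)) \<and>
     (\<forall>c>0. ((\<lambda>x. f (c * x) / f x) \<longlongrightarrow> c powr \<rho>) at_top)"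

lemma regularly_varying_pos:
  assumes "regularly_varying f \<rho>" shows "eventually (\<lambda>t. 0 < f t) at_top"
  using assms by (auto simp: regularly_varying_def eventually_at_top_linorder)

lemma regularly_varying_powr_mult:
  assumes L: "slowly_varying L" and r: "\<And>t. 0 < t \<Longrightarrow> r t = t powr \<rho> * L t"
  shows "regularly_varying r \<rho>"
proof -
  obtain X where X: "L \<in> borel_measurable (restrict_space borel {X..})" "\<And>x. x \<ge> X \<Longrightarrow> L x > 0"
    and lim: "\<And>c. c > 0 \<Longrightarrow> ((\<lambda>x. L (c * x) / L x) \<longlongrightarrow> 1) at_top"
    using L by (auto simp: slowly_varying_def)
  define Y where "Y = max X 1"
  have "L \<in> borel_measurable (restrict_space (restrict_space borel {X..}) {Y..})"
    by (rule measurable_restrict_space1[OF X(1)])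
  moreover have "restrict_space (restrict_space borel {X..}) {Y..} = restrict_space borel {Y..}"
    by (subst restrict_restrict_space) (auto simp: Y_def intro!: arg_cong[of _ _ "restrict_space borel"])
  ultimately have "L \<in> borel_measurable (restrict_space borel {Y..})"
    by simp
  then have "(\<lambda>t. t powr \<rho> * L t) \<in> borel_measurable (restrict_space borel {Y..})"
    by (intro borel_measurable_times[OF measurable_restrict_space1]) auto
  then have 1: "r \<in> borel_measurable (restrict_space borel {Y..})"
    by (subst measurable_cong[where g="\<lambda>t. t powr \<rho> * L t"]) (auto simp: space_restrict_space Y_def r)
  have 2: "r x > 0" if "x \<ge> Y" for x
    using X(2)[of x] that by (auto simp: Y_def r)
  have 3: "((\<lambda>x. r (c * x) / r x) \<longlongrightarrow> c powr \<rho>) at_top" if c: "c > 0" for c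
  proof -
    have "((\<lambda>x. c powr \<rho> * (L (c * x) / L x)) \<longlongrightarrow> c powr \<rho> * 1) at_top"
      by (intro tendsto_mult tendsto_const lim c)
    moreover have "eventually (\<lambda>x. c powr \<rho> * (L (c * x) / L x) = r (c * x) / r x) at_top"
      using eventually_gt_at_top[of 0]
      by eventually_elim (use c in \<open>auto simp: r powr_mult\<close>)
    ultimately show ?thesis by (auto intro: Lim_transform_eventually)
  qed
  show ?thesis unfolding regularly_varying_def using 1 2 3 by blast
qed

text \<open>
  The function \<open>h x = ln (f (exp x)) - \<rho> * x\<close> has vanishing increments at infinity, so additive
  uniform convergence applies to it.
\<close>

lemma regularly_varying_uniform:
  assumes f: "regularly_varying f \<rho>" and "0 < a" "a \<le> b" "0 < \<epsilon>"
  shows "eventually (\<lambda>t. \<forall>c\<in>{a..b}. (1 - \<epsilon>) * c powr \<rho> * f t \<le> f (c * t) \<and>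
                                  f (c * t) \<le> (1 + \<epsilon>) * c powr \<rho> * f t) at_top"
proof -
  obtain X where X: "f \<in> borel_measurable (restrict_space borel {X..})" "\<And>x. x \<ge> X \<Longrightarrow> f x > 0"
    and lim: "\<And>c. c > 0 \<Longrightarrow> ((\<lambda>x. f (c * x) / f x) \<longlongrightarrow> c powr \<rho>) at_top"
    using f by (auto simp: regularly_varying_def)
  define f' where "f' x = (if x \<ge> X then f x else 1)" for x
  have f'_meas [measurable]: "f' \<in> borel_measurable borel"
    unfolding f'_def using X(1)
    by (subst measurable_If_restrict_space_iff) (auto simp: atLeast_def)
  have f'_pos: "f' x > 0" for x using X(2) by (auto simp: f'_def)
  define h where "h x = ln (f' (exp x)) - \<rho> * x" for x
  have [measurable]: "h \<in> borel_measurable borel" unfolding h_def by measurable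
  have hlim: "((\<lambda>x. h (x + u) - h x) \<longlongrightarrow> 0) at_top" for u
  proof -
    have "((\<lambda>x. ln (f (exp u * exp x) / f (exp x)) - \<rho> * u) \<longlongrightarrow> ln (exp u powr \<rho>) - \<rho> * u) at_top"
      by (intro tendsto_intros filterlim_compose[OF lim exp_at_top]) auto
    moreover have "eventually (\<lambda>x. ln (f (exp u * exp x) / f (exp x)) - \<rho> * u = h (x + u) - h x) at_top"
    proof -
      have "eventually (\<lambda>x. exp x \<ge> X) at_top" "eventually (\<lambda>x. exp u * exp x \<ge> X) at_top"
        using exp_at_top filterlim_at_top filterlim_tendsto_pos_mult_at_top[OF tendsto_const _ exp_at_top, of "exp u"]
        by (auto simp: filterlim_at_top)
      then show ?thesis
      proof eventually_elim
        case (elim x)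
        then have "f (exp x) > 0" "f (exp u * exp x) > 0" using X(2) by auto
        then show ?case using elim by (simp add: h_def f'_def exp_add ln_div algebra_simps)
      qed
    qed
    ultimately show ?thesis by (auto simp: powr_def mult.commute elim: Lim_transform_eventually)
  qed
  define K where "K = 1 + \<bar>ln a\<bar> + \<bar>ln b\<bar>"
  have "0 < K" by (simp add: K_def)
  have "0 < ln (1 + \<epsilon>)" using assms by simp
  from uniform_convergence_additive[OF \<open>h \<in> borel_measurable borel\<close> hlim \<open>0 < K\<close> this]
  obtain x0 where x0: "\<And>x u. x \<ge> x0 \<Longrightarrow> u \<in> {-K..K} \<Longrightarrow> \<bar>h (x + u) - h x\<bar> < ln (1 + \<epsilon>)"
    by metis
  have "(1 - \<epsilon>) * c powr \<rho> * f t \<le> f (c * t) \<and> f (c * t) \<le> (1 + \<epsilon>) * c powr \<rho> * f t"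
    if t: "t \<ge> exp x0" "t \<ge> X" "t \<ge> X / a" "t > 0" and c: "c \<in> {a..b}" for t c
  proof -
    have cpos: "c > 0" using c assms by auto
    have lnc: "ln a \<le> ln c" "ln c \<le> ln b" using c assms by auto
    have cX: "c * t \<ge> X"
    proof -
      have "X \<le> a * t" using t(3) assms by (simp add: field_simps)
      also have "\<dots> \<le> c * t" using c t by (intro mult_right_mono) auto
      finally show ?thesis .
    qed
    have "ln t \<ge> x0" using t by (simp add: ln_ge_iff)
    moreover have "ln c \<in> {-K..K}" using lnc unfolding K_def by auto
    ultimately have *: "\<bar>h (ln t + ln c) - h (ln t)\<bar> < ln (1 + \<epsilon>)" using x0 by blast
    define z where "z = f (c * t) / (c powr \<rho> * f t)"
    have ft: "f t > 0" "f (c * t) > 0" using X(2) t cX by auto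
    have zpos: "z > 0" using ft cpos by (auto simp: z_def)
    have "h (ln t + ln c) - h (ln t) = ln z"
      using t cX ft cpos
      by (simp add: h_def f'_def exp_add mult.commute z_def ln_div ln_mult ln_powr algebra_simps)
    then have "\<bar>ln z\<bar> < ln (1 + \<epsilon>)" using * by simp
    then have "ln z < ln (1 + \<epsilon>)" "ln (1 / (1 + \<epsilon>)) < ln z"
      using assms by (auto simp: ln_div)
    then have z: "z < 1 + \<epsilon>" "1 / (1 + \<epsilon>) < z"
      using zpos assms by (subst (asm) ln_less_cancel_iff; simp)+
    have "1 - \<epsilon> \<le> 1 / (1 + \<epsilon>)" using assms by (simp add: field_simps)
    then have z2: "1 - \<epsilon> \<le> z" using z by simp
    have fz: "f (c * t) = z * (c powr \<rho> * f t)" using ft cpos by (simp add: z_def)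
    have pos: "0 \<le> c powr \<rho> * f t" using ft by simp
    show ?thesis
      using mult_right_mono[OF z2 pos] mult_right_mono[OF less_imp_le[OF z(1)] pos]
      by (simp add: fz mult.assoc)
  qed
  then have "\<forall>c\<in>{a..b}. (1 - \<epsilon>) * c powr \<rho> * f t \<le> f (c * t) \<and> f (c * t) \<le> (1 + \<epsilon>) * c powr \<rho> * f t"
    if "t \<ge> Max {exp x0, X, X / a, 1}" for t
    using that by auto
  then show ?thesis
    unfolding eventually_at_top_linorder by blast
qed

section \<open>Integrals and convolutions of regularly varying functions\<close>

lemma half_less_one: "1 / 2 < (1::real)"
  by simp

text \<open>
  Induction along \<open>t, 2 t, 4 t, \<dots>\<close>, for estimates that are only stable under doubling.
\<close>

lemma doubling_induct:
  fixes t :: real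
  assumes "0 < t0" "t0 \<le> t"
    and base: "\<And>t. t0 \<le> t \<Longrightarrow> t \<le> 2 * t0 \<Longrightarrow> P t"
    and step: "\<And>t. t0 \<le> t \<Longrightarrow> P t \<Longrightarrow> P (2 * t)"
  shows "P t"
proof -
  have "\<forall>t. t0 \<le> t \<and> t \<le> 2 ^ n * t0 \<longrightarrow> P t" for n
  proof (induction n)
    case (Suc n)
    show ?case
    proof (intro allI impI)
      fix t assume t: "t0 \<le> t \<and> t \<le> 2 ^ Suc n * t0"
      show "P t"
      proof (cases "t \<le> 2 * t0")
        case False
        then have "P (t / 2)" using Suc t by auto
        then show ?thesis using step[of "t/2"] False by simp
      qed (use base t in auto)
    qed
  qed (use base assms(1) in auto)
  moreover obtain n where "t / t0 < 2 ^ n" using real_arch_pow[of 2] by force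
  moreover from this have "t \<le> 2 ^ n * t0" using assms(1) by (simp add: field_simps)
  ultimately show ?thesis using assms(2) by blast
qed

lemma set_integral_Icc_split:
  fixes f :: "real \<Rightarrow> real"
  assumes "set_integrable lborel {0..t} f" "0 \<le> s" "s \<le> t"
  shows "(LINT u:{0..t}|lborel. f u) = (LINT u:{0..s}|lborel. f u) + (LINT u:{s<..t}|lborel. f u)"
proof -
  have "{0..t} = {0..s} \<union> {s<..t}" "{0..s} \<inter> {s<..t} = {}" using assms by auto
  then show ?thesis
    using set_integral_Un[of "{0..s}" "{s<..t}" lborel f] assms
      set_integrable_subset[OF assms(1), of "{0..s}"] set_integrable_subset[OF assms(1), of "{s<..t}"]
    by simp
qed

lemma set_integral_nonneg':
  fixes f :: "real \<Rightarrow> real"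
  assumes "\<And>x. x \<in> A \<Longrightarrow> 0 \<le> f x" shows "0 \<le> (LINT u:A|M. f u)"
  unfolding set_lebesgue_integral_def using assms
  by (intro integral_nonneg_AE) (auto simp: indicator_def)

lemma set_integral_const_Ioc:
  fixes a b c :: real assumes "a \<le> b"
  shows "set_integrable lborel {a<..b} (\<lambda>_. c)" "(LINT u:{a<..b}|lborel. c) = c * (b - a)"
  using assms by (auto simp: set_integrable_def set_lebesgue_integral_def)

lemma set_integral_inverse_Ioc:
  fixes a b :: real assumes "0 < a" "a \<le> b"
  shows "set_integrable lborel {a<..b} (\<lambda>u. 1 / u)" "(LINT u:{a<..b}|lborel. 1 / u) = ln b - ln a"
proof -
  have "has_bochner_integral lborel (\<lambda>x. (1 / x) * indicator {a .. b} x) (ln b - ln a)"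
    using assms by (intro has_bochner_integral_FTC_Icc_real) (auto intro!: derivative_eq_intros continuous_intros)
  then have i: "set_integrable lborel {a..b} (\<lambda>u. 1 / u)" and e: "(LINT u:{a..b}|lborel. 1 / u) = ln b - ln a"
    by (auto simp: set_integrable_def set_lebesgue_integral_def has_bochner_integral_iff mult.commute)
  show "set_integrable lborel {a<..b} (\<lambda>u. 1 / u)"
    by (rule set_integrable_subset[OF i]) auto
  have "{a..b} = {a} \<union> {a<..b}" using assms by auto
  then have "(LINT u:{a..b}|lborel. 1 / u) = (LINT u:{a}|lborel. 1 / u) + (LINT u:{a<..b}|lborel. 1 / u)"
    using set_integral_Un[of "{a}" "{a<..b}" lborel "\<lambda>u. 1/u"] assms
      set_integrable_subset[OF i, of "{a}"] set_integrable_subset[OF i, of "{a<..b}"]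
    by auto
  then show "(LINT u:{a<..b}|lborel. 1 / u) = ln b - ln a"
    using e by (simp add: set_integral_at_point)
qed

lemma regularly_varying_window_pointwise:
  assumes f: "regularly_varying f \<rho>" and "\<rho> \<le> 0" and nonneg: "\<And>t. 0 \<le> f t"
    and d: "0 < \<delta>" "\<delta> < 1"
  shows "eventually (\<lambda>t. \<forall>u\<in>{\<delta> * t..t}. f u \<le> 2 * \<delta> powr \<rho> * f t) at_top"
  using regularly_varying_uniform[OF f d(1) less_imp_le[OF d(2)] zero_less_one] eventually_gt_at_top[of 0]
proof eventually_elim
  case (elim t)
  show ?case
  proof
    fix u assume u: "u \<in> {\<delta> * t..t}"
    then have c: "u / t \<in> {\<delta>..1}" using elim by (auto simp: field_simps)
    then have "f u \<le> 2 * (u / t) powr \<rho> * f t" using elim by force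
    also have "(u / t) powr \<rho> \<le> \<delta> powr \<rho>" using c d \<open>\<rho> \<le> 0\<close> by (intro powr_mono2') auto
    finally show "f u \<le> 2 * \<delta> powr \<rho> * f t" using nonneg[of t] by (auto simp: mult_right_mono)
  qed
qed

lemma regularly_varying_window_bound:
  assumes f: "regularly_varying f \<rho>" and "\<rho> \<le> 0" and nonneg: "\<And>t. 0 \<le> f t"
    and int: "\<And>t. set_integrable lborel {0..t} f"
    and d: "0 < \<delta>" "\<delta> < 1"
  shows "eventually (\<lambda>t. (LINT u:{\<delta> * t<..t}|lborel. f u) \<le> 2 * \<delta> powr \<rho> * (t * f t)) at_top"
  using regularly_varying_window_pointwise[OF f \<open>\<rho> \<le> 0\<close> nonneg d] eventually_gt_at_top[of 0]
proof eventually_elim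
  case (elim t)
  have dt: "0 < \<delta> * t" "\<delta> * t \<le> t" using d elim by auto
  have "(LINT u:{\<delta> * t<..t}|lborel. f u) \<le> (LINT u:{\<delta> * t<..t}|lborel. 2 * \<delta> powr \<rho> * f t)"
    using dt elim by (intro set_integral_mono set_integral_const_Ioc set_integrable_subset[OF int[of t]]) auto
  also have "\<dots> = 2 * \<delta> powr \<rho> * f t * (t - \<delta> * t)"
    using dt(2) by (rule set_integral_const_Ioc)
  also have "\<dots> \<le> 2 * \<delta> powr \<rho> * f t * t"
    using dt elim nonneg[of t] by (intro mult_left_mono) auto
  finally show ?case by (simp add: mult_ac)
qed

text \<open>
  For an index of at most \<open>- 1\<close>, \<open>f u\<close> is at least about \<open>f t * t / u\<close> on \<open>(\<delta> t, t]\<close>, so the integral is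
  at least a constant times \<open>t * f t * ln (1 / \<delta>)\<close>. Here \<open>\<delta>\<close> is arbitrarily small.
\<close>

lemma integral_dominates_regularly_varying:
  assumes f: "regularly_varying f \<rho>" and "\<rho> \<le> -1" and nonneg: "\<And>t. 0 \<le> f t"
    and int: "\<And>t. set_integrable lborel {0..t} f"
    and "0 < \<epsilon>"
  shows "eventually (\<lambda>t. t * f t \<le> \<epsilon> * (LINT u:{0..t}|lborel. f u)) at_top"
proof -
  \<comment> \<open>so that \<open>ln (1 / \<delta>) = 2 / \<epsilon>\<close>; the factor 2 pays for the error 1/2 in the uniform estimate\<close>
  define \<delta> :: real where "\<delta> = exp (- (2 / \<epsilon>))"
  have d: "0 < \<delta>" "\<delta> < 1" using \<open>0 < \<epsilon>\<close> by (auto simp: \<delta>_def)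
  show ?thesis
    using regularly_varying_uniform[OF f d(1) less_imp_le[OF d(2)] half_gt_zero[OF zero_less_one]] eventually_gt_at_top[of 0]
  proof eventually_elim
    case (elim t)
    have dt: "0 < \<delta> * t" "\<delta> * t \<le> t" using d elim by auto
    have "(t * f t / 2) * (1 / u) \<le> f u" if "u \<in> {\<delta> * t<..t}" for u
    proof -
      have u: "0 < u" using that dt by auto
      have c: "u / t \<in> {\<delta>..1}" using that elim by (auto simp: field_simps)
      have "(u / t) powr (-1) \<le> (u / t) powr \<rho>"
        using c d elim \<open>\<rho> \<le> -1\<close> u by (intro powr_mono') auto
      then have "t / u \<le> (u / t) powr \<rho>" using u elim by (simp add: powr_minus_divide)
      then have "(1 - 1 / 2) * (t / u) * f t \<le> (1 - 1 / 2) * (u / t) powr \<rho> * f t"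
        using nonneg[of t] by (intro mult_right_mono) auto
      also have "\<dots> \<le> f (u / t * t)" using elim c by blast
      finally show ?thesis using elim by (simp add: field_simps)
    qed
    then have "(LINT u:{\<delta> * t<..t}|lborel. (t * f t / 2) * (1 / u)) \<le> (LINT u:{\<delta> * t<..t}|lborel. f u)"
      using dt elim
      by (intro set_integral_mono set_integrable_mult_right set_integral_inverse_Ioc set_integrable_subset[OF int[of t]]) auto
    also have "\<dots> \<le> (LINT u:{0..t}|lborel. f u)"
      using set_integral_Icc_split[OF int[of t], of "\<delta> * t"] dt elim nonneg
      by (auto intro: set_integral_nonneg')
    also have "(LINT u:{\<delta> * t<..t}|lborel. (t * f t / 2) * (1 / u)) = (t * f t / 2) * (ln t - ln (\<delta> * t))"
      unfolding set_integral_mult_right using set_integral_inverse_Ioc[OF dt] by simp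
    finally have "(t * f t / 2) * (ln t - ln (\<delta> * t)) \<le> (LINT u:{0..t}|lborel. f u)" .
    moreover have "ln t - ln (\<delta> * t) = 2 / \<epsilon>"
      using d elim by (simp add: ln_mult \<delta>_def)
    ultimately show ?case using \<open>0 < \<epsilon>\<close> by (simp add: field_simps)
  qed
qed

text \<open>
  The upper half of Karamata's theorem. For an index above \<open>- 1\<close> the function \<open>W t = t * f t\<close> grows by a
  factor of at least \<open>1 / \<kappa> > 1\<close> when \<open>t\<close> is doubled, whereas the integral grows by at most \<open>K * W (2 t)\<close>.
  Hence \<open>I \<le> C * W\<close> is preserved by doubling if \<open>C \<kappa> + K \<le> C\<close>.
\<close>

lemma regularly_varying_integral_bound:
  assumes f: "regularly_varying f \<rho>" and "-1 < \<rho>" "\<rho> < 0" and nonneg: "\<And>t. 0 \<le> f t"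
    and int: "\<And>t. set_integrable lborel {0..t} f"
  shows "\<exists>C>0. eventually (\<lambda>t. (LINT u:{0..t}|lborel. f u) \<le> C * (t * f t)) at_top"
proof -
  define I where "I t = (LINT u:{0..t}|lborel. f u)" for t
  define W where "W t = t * f t" for t
  have I_mono: "I s \<le> I t" if "0 \<le> s" "s \<le> t" for s t
    using set_integral_Icc_split[OF int[of t], of s] that nonneg by (auto simp: I_def intro: set_integral_nonneg')
  define a where "a = (1/2) powr (\<rho> + 1)"
  have a: "0 < a" "a < 1" using \<open>-1 < \<rho>\<close> by (auto simp: a_def powr_def mult_pos_neg)
  have e0: "0 < (1 / a - 1) / 2" using a by (simp add: field_simps)
  \<comment> \<open>\<open>a\<close> is the limit of \<open>W (t / 2) / W t\<close> and \<open>\<kappa>\<close> lies between \<open>a\<close> and 1\<close>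
  define \<kappa> where "\<kappa> = (1 + a) / 2"
  define K where "K = 2 * (1/2) powr \<rho>"
  have K: "0 < K" by (simp add: K_def)
  have k: "0 < \<kappa>" "\<kappa> < 1" using a by (auto simp: \<kappa>_def)
  have "eventually (\<lambda>t. W (t / 2) \<le> \<kappa> * W t) at_top"
    using regularly_varying_uniform[OF f half_gt_zero[OF zero_less_one] order_refl e0] eventually_gt_at_top[of 0]
  proof eventually_elim
    case (elim t)
    then have "f (1/2 * t) \<le> (1 + (1/a - 1) / 2) * (1/2) powr \<rho> * f t"
      by auto
    then have "t / 2 * f (t / 2) \<le> t / 2 * ((1 + (1/a - 1) / 2) * (1/2) powr \<rho> * f t)"
      using elim by (intro mult_left_mono) auto
    also have "\<dots> = (1 + (1/a - 1) / 2) * ((1/2) powr \<rho> * (1/2)) * W t"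
      by (simp add: W_def)
    also have "(1/2) powr \<rho> * (1/2) = a" by (simp add: a_def powr_add)
    also have "(1 + (1/a - 1) / 2) * a = \<kappa>" using a by (simp add: \<kappa>_def field_simps)
    finally show ?case by (simp add: W_def)
  qed
  moreover have "eventually (\<lambda>t. I t - I (t / 2) \<le> K * W t) at_top"
    using regularly_varying_window_bound[OF f less_imp_le[OF \<open>\<rho> < 0\<close>] nonneg int half_gt_zero[OF zero_less_one] half_less_one] eventually_gt_at_top[of 0]
  proof eventually_elim
    case (elim t)
    then show ?case using set_integral_Icc_split[OF int[of t], of "t/2"] by (simp add: I_def W_def K_def)
  qed
  moreover note eventually_gt_at_top[of 0] regularly_varying_pos[OF f]
  ultimately have "eventually (\<lambda>t. W (t / 2) \<le> \<kappa> * W t \<and> I t - I (t / 2) \<le> K * W t \<and> 0 < t \<and> 0 < f t) at_top"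
    by eventually_elim auto
  moreover have "eventually (\<lambda>t. \<forall>c\<in>{1..2}. (1 - 1/2) * c powr \<rho> * f t \<le> f (c * t)) at_top"
    using regularly_varying_uniform[OF f, of 1 2 "1/2"] by (auto elim: eventually_mono)
  ultimately have "eventually (\<lambda>t. (W (t / 2) \<le> \<kappa> * W t \<and> I t - I (t / 2) \<le> K * W t \<and> 0 < t \<and> 0 < f t)
     \<and> (\<forall>c\<in>{1..2}. (1 - 1/2) * c powr \<rho> * f t \<le> f (c * t))) at_top"
    by (rule eventually_conj)
  then obtain t0 where T: "\<And>t. t \<ge> t0 \<Longrightarrow> (W (t / 2) \<le> \<kappa> * W t \<and> I t - I (t / 2) \<le> K * W t \<and> 0 < t \<and> 0 < f t)
     \<and> (\<forall>c\<in>{1..2}. (1 - 1/2) * c powr \<rho> * f t \<le> f (c * t))"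
    unfolding eventually_at_top_linorder by blast
  have t0: "\<And>t. t \<ge> t0 \<Longrightarrow> W (t / 2) \<le> \<kappa> * W t" "\<And>t. t \<ge> t0 \<Longrightarrow> I t - I (t / 2) \<le> K * W t"
    "0 < t0" "0 < f t0" "\<And>c. 1 \<le> c \<Longrightarrow> c \<le> 2 \<Longrightarrow> 1/2 * c powr \<rho> * f t0 \<le> f (c * t0)"
    using T T[of t0] by auto
  define m where "m = t0 * (1/2 * 2 powr \<rho> * f t0)"
  have m: "0 < m" using t0 by (simp add: m_def)
  have Wm: "m \<le> W t" if "t0 \<le> t" "t \<le> 2 * t0" for t
  proof -
    have c: "1 \<le> t / t0" "t / t0 \<le> 2" using that t0(3) by (auto simp: field_simps)
    have "2 powr \<rho> \<le> (t / t0) powr \<rho>" using c \<open>\<rho> < 0\<close> by (intro powr_mono2') auto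
    then have "1/2 * 2 powr \<rho> * f t0 \<le> 1/2 * (t / t0) powr \<rho> * f t0" using t0(4) by simp
    also have "\<dots> \<le> f t" using t0(5)[OF c] t0(3) by simp
    finally show ?thesis unfolding m_def W_def using that t0(3,4) by (intro mult_mono) auto
  qed
  define C where "C = max (I (2 * t0) / m) (K / (1 - \<kappa>))"
  have Cpos: "0 < C" using K k by (simp add: C_def less_max_iff_disj)
  have "I t \<le> C * W t" if "t0 \<le> t" for t
  proof (rule doubling_induct[OF t0(3) that])
    fix t assume t: "t0 \<le> t" "t \<le> 2 * t0"
    have "I t \<le> I (2 * t0)" using t t0(3) by (intro I_mono) auto
    also have "\<dots> = I (2 * t0) / m * m" using m by simp
    also have "\<dots> \<le> C * m" unfolding C_def using m by (intro mult_right_mono) auto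
    also have "\<dots> \<le> C * W t" using Wm[OF t] Cpos by simp
    finally show "I t \<le> C * W t" .
  next
    fix t assume t: "t0 \<le> t" "I t \<le> C * W t"
    have W2: "W t \<le> \<kappa> * W (2 * t)" and I2: "I (2 * t) - I t \<le> K * W (2 * t)"
      using t0(1)[of "2*t"] t0(2)[of "2*t"] t t0(3) by auto
    have W2p: "0 \<le> W (2 * t)" using t t0(3) nonneg by (auto simp: W_def)
    have CK: "C * \<kappa> + K \<le> C"
    proof -
      have "K / (1 - \<kappa>) \<le> C" by (simp add: C_def)
      then show ?thesis using k by (simp add: field_simps)
    qed
    have "I (2 * t) \<le> C * W t + K * W (2 * t)" using t I2 by simp
    also have "\<dots> \<le> C * (\<kappa> * W (2 * t)) + K * W (2 * t)" using W2 Cpos by simp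
    also have "\<dots> = (C * \<kappa> + K) * W (2 * t)" by (simp add: algebra_simps)
    also have "\<dots> \<le> C * W (2 * t)" using CK W2p by (intro mult_right_mono) auto
    finally show "I (2 * t) \<le> C * W (2 * t)" .
  qed
  then have "eventually (\<lambda>t. I t \<le> C * W t) at_top"
    by (auto simp: eventually_at_top_linorder)
  then show ?thesis using Cpos unfolding I_def W_def by blast
qed

lemma set_integral_reflect:
  fixes f :: "real \<Rightarrow> real"
  assumes "set_integrable lborel {0..t} f"
  shows "set_integrable lborel {0..t} (\<lambda>u. f (t - u))"
    and "(LINT u:{0..t}|lborel. f (t - u)) = (LINT u:{0..t}|lborel. f u)"
proof -
  have ind: "indicator {0..t} (t - u) = (indicator {0..t} u :: real)" for u
    by (auto simp: indicator_def)
  show "set_integrable lborel {0..t} (\<lambda>u. f (t - u))"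
    using lborel_integrable_real_affine[of "\<lambda>u. indicator {0..t} u * f u" "-1" t] assms
    by (simp add: set_integrable_def ind)
  show "(LINT u:{0..t}|lborel. f (t - u)) = (LINT u:{0..t}|lborel. f u)"
    using lborel_integral_real_affine[of "-1" "\<lambda>u. indicator {0..t} u * f u" t]
    by (simp add: set_lebesgue_integral_def ind)
qed

text \<open>
  The convolution is split at \<open>\<delta> t\<close>. On \<open>[0, \<delta> t]\<close> the factor \<open>B (t - u)\<close> is \<open>B t\<close> up to a factor
  close to 1, and the integral of \<open>A\<close> over this interval is almost all of the integral over \<open>[0, t]\<close>.
  On \<open>(\<delta> t, t]\<close> the factor \<open>A u\<close> is of the order of \<open>A t\<close> and the integral of \<open>B (t - u)\<close> is of the order of
  \<open>t * B t\<close>, which gives \<open>t * A t * B t\<close>, and \<open>t * A t\<close> is negligible against the integral of \<open>A\<close>.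
\<close>

lemma regularly_varying_convolution:
  assumes A: "regularly_varying A \<rho>" "\<rho> \<le> -1" "\<And>t. 0 \<le> A t"
      "\<And>t. set_integrable lborel {0..t} A"
    and B: "regularly_varying B \<sigma>" "-1 < \<sigma>" "\<sigma> < 0" "\<And>t. 0 \<le> B t"
      "\<And>t. set_integrable lborel {0..t} B"
    and AB: "\<And>t. set_integrable lborel {0..t} (\<lambda>u. A u * B (t - u))"
  shows "((\<lambda>t. (LINT u:{0..t}|lborel. A u * B (t - u)) / ((LINT u:{0..t}|lborel. A u) * B t)) \<longlongrightarrow> 1) at_top"
proof (rule tendstoI)
  fix e :: real assume "0 < e"
  define J where "J t = (LINT u:{0..t}|lborel. A u * B (t - u))" for t
  define IA where "IA t = (LINT u:{0..t}|lborel. A u)" for t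
  define \<eta> where "\<eta> = min e 1 / 8"
  have \<eta>: "0 < \<eta>" "\<eta> < 1" "4 * \<eta> < e" using \<open>0 < e\<close> by (auto simp: \<eta>_def)
  \<comment> \<open>chosen such that \<open>(1 - \<delta>) powr (- 1) = 1 + \<eta>\<close>, which bounds \<open>c powr \<sigma>\<close> for \<open>c \<ge> 1 - \<delta>\<close>\<close>
  define \<delta> where "\<delta> = \<eta> / (1 + \<eta>)"
  have d: "0 < \<delta>" "\<delta> < 1" and d1: "1 - \<delta> = 1 / (1 + \<eta>)" using \<eta> by (auto simp: \<delta>_def field_simps)
  define D where "D = 2 * \<delta> powr \<rho>"
  have D: "0 < D" using d by (simp add: D_def)
  obtain C where C: "0 < C" "eventually (\<lambda>t. (LINT u:{0..t}|lborel. B u) \<le> C * (t * B t)) at_top"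
    using regularly_varying_integral_bound[OF B] by blast
  \<comment> \<open>small enough for both places where \<open>t * A t\<close> is compared with the integral of \<open>A\<close>\<close>
  define \<epsilon>3 where "\<epsilon>3 = \<eta> / (D * (1 + C))"
  have e3: "0 < \<epsilon>3" using \<eta> D C by (simp add: \<epsilon>3_def)
  have e3D: "D * \<epsilon>3 \<le> \<eta>" "D * C * \<epsilon>3 \<le> \<eta>" proof -
    have "D * \<epsilon>3 = \<eta> * (1 / (1 + C))" "D * C * \<epsilon>3 = \<eta> * (C / (1 + C))"
      using D C by (auto simp: \<epsilon>3_def)
    moreover have "1 / (1 + C) \<le> 1" "C / (1 + C) \<le> 1" using C by auto
    ultimately show "D * \<epsilon>3 \<le> \<eta>" "D * C * \<epsilon>3 \<le> \<eta>"
      using \<eta> by (auto simp only: intro!: mult_left_le)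
  qed
  have \<rho>0: "\<rho> \<le> 0" using A(2) by simp
  have d': "0 < 1 - \<delta>" "1 - \<delta> \<le> 1" using d by auto
  show "eventually (\<lambda>t. dist (J t / (IA t * B t)) 1 < e) at_top"
    using regularly_varying_uniform[OF B(1) d' \<eta>(1)] C(2)
      regularly_varying_window_bound[OF A(1) \<rho>0 A(3,4) d, folded D_def]
      regularly_varying_window_pointwise[OF A(1) \<rho>0 A(3) d, folded D_def]
      integral_dominates_regularly_varying[OF A e3]
      regularly_varying_pos[OF A(1)] regularly_varying_pos[OF B(1)] eventually_gt_at_top[of 0]
  proof eventually_elim
    case (elim t)
    note uni = elim(1) and IB = elim(2) and winA = elim(3) and ptA = elim(4) and domA = elim(5)
      and pos = elim(6-8)
    define G where "G = IA t * B t"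
    have dt: "0 < \<delta> * t" "\<delta> * t \<le> t" "0 \<le> t" using d pos by auto
    have domA': "t * A t \<le> \<epsilon>3 * IA t" using domA by (simp add: IA_def)
    have "0 < \<epsilon>3 * IA t" using domA' pos mult_pos_pos[of t "A t"] by linarith
    then have IApos: "0 < IA t" using e3 by (simp add: zero_less_mult_iff)
    have G: "0 < G" using IApos pos by (simp add: G_def)
    have intA: "set_integrable lborel {0..\<delta> * t} A" "set_integrable lborel {\<delta> * t<..t} A"
      using dt by (auto intro: set_integrable_subset[OF A(4)[of t]])
    have intJ: "set_integrable lborel {0..\<delta> * t} (\<lambda>u. A u * B (t - u))"
       "set_integrable lborel {\<delta> * t<..t} (\<lambda>u. A u * B (t - u))"
      using dt by (auto intro: set_integrable_subset[OF AB[of t]])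
    have intB: "set_integrable lborel {\<delta> * t<..t} (\<lambda>u. B (t - u))"
      by (rule set_integrable_subset[OF set_integral_reflect(1)[OF B(5)]]) (use dt in auto)
    have IA_split: "IA t = (LINT u:{0..\<delta> * t}|lborel. A u) + (LINT u:{\<delta> * t<..t}|lborel. A u)"
      unfolding IA_def using dt by (intro set_integral_Icc_split A) auto
    have J_split: "J t = (LINT u:{0..\<delta> * t}|lborel. A u * B (t - u)) + (LINT u:{\<delta> * t<..t}|lborel. A u * B (t - u))"
      unfolding J_def using dt by (intro set_integral_Icc_split AB) auto
    have Bnear: "(1 - \<eta>) * B t \<le> B (t - u) \<and> B (t - u) \<le> (1 + \<eta>) * (1 + \<eta>) * B t" if u: "u \<in> {0..\<delta> * t}" for u
    proof -
      define c where "c = (t - u) / t"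
      have c: "c \<in> {1 - \<delta>..1}" "c * t = t - u" using u pos dt by (auto simp: c_def field_simps)
      have lo: "1 \<le> c powr \<sigma>" using c d B powr_mono2'[of \<sigma> c 1] by auto
      have "c powr \<sigma> \<le> (1 - \<delta>) powr \<sigma>" using c d B by (intro powr_mono2') auto
      also have "\<dots> \<le> (1 - \<delta>) powr (-1)" using d B by (intro powr_mono') auto
      also have "\<dots> = 1 + \<eta>" using d d1 \<eta> by (simp add: powr_minus_divide)
      finally have hi: "c powr \<sigma> \<le> 1 + \<eta>" .
      have "(1 - \<eta>) * c powr \<sigma> * B t \<le> B (t - u)" "B (t - u) \<le> (1 + \<eta>) * c powr \<sigma> * B t"
        using uni c by (auto simp: c(2)[symmetric])
      moreover have "(1 - \<eta>) * 1 * B t \<le> (1 - \<eta>) * c powr \<sigma> * B t"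
        using lo \<eta> pos by (intro mult_right_mono mult_left_mono) auto
      moreover have "(1 + \<eta>) * c powr \<sigma> * B t \<le> (1 + \<eta>) * (1 + \<eta>) * B t"
        using hi \<eta> pos by (intro mult_right_mono mult_left_mono) auto
      ultimately show ?thesis by simp
    qed
    have IA1_nonneg: "0 \<le> (LINT u:{0..\<delta> * t}|lborel. A u)" by (rule set_integral_nonneg') (rule A)
    have IA2_nonneg: "0 \<le> (LINT u:{\<delta> * t<..t}|lborel. A u)" by (rule set_integral_nonneg') (rule A)
    have IA2: "(LINT u:{\<delta> * t<..t}|lborel. A u) \<le> \<eta> * IA t"
    proof -
      have "D * (t * A t) \<le> D * (\<epsilon>3 * IA t)" using domA' D by simp
      also have "\<dots> = (D * \<epsilon>3) * IA t" by simp
      also have "\<dots> \<le> \<eta> * IA t" using e3D IApos by (intro mult_right_mono) auto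
      finally show ?thesis using winA by simp
    qed
    have J1_upper: "(LINT u:{0..\<delta> * t}|lborel. A u * B (t - u)) \<le> (1 + \<eta>) * (1 + \<eta>) * G"
    proof -
      have "(LINT u:{0..\<delta> * t}|lborel. A u * B (t - u)) \<le> (LINT u:{0..\<delta> * t}|lborel. A u * ((1 + \<eta>) * (1 + \<eta>) * B t))"
        using Bnear by (intro set_integral_mono intJ set_integrable_mult_left intA mult_left_mono A) auto
      also have "\<dots> = (LINT u:{0..\<delta> * t}|lborel. A u) * ((1 + \<eta>) * (1 + \<eta>) * B t)" by simp
      also have "\<dots> \<le> IA t * ((1 + \<eta>) * (1 + \<eta>) * B t)"
        using IA_split IA2_nonneg \<eta> pos by (intro mult_right_mono) auto
      finally show ?thesis by (simp add: G_def mult_ac)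
    qed
    have J2_upper: "(LINT u:{\<delta> * t<..t}|lborel. A u * B (t - u)) \<le> \<eta> * G"
    proof -
      have "(LINT u:{\<delta> * t<..t}|lborel. A u * B (t - u)) \<le> (LINT u:{\<delta> * t<..t}|lborel. (D * A t) * B (t - u))"
        using ptA by (intro set_integral_mono intJ set_integrable_mult_right intB mult_right_mono B) auto
      also have "\<dots> = (D * A t) * (LINT u:{\<delta> * t<..t}|lborel. B (t - u))" by simp
      also have "(LINT u:{\<delta> * t<..t}|lborel. B (t - u)) \<le> (LINT u:{0..t}|lborel. B (t - u))"
        using set_integral_Icc_split[OF set_integral_reflect(1)[OF B(5)[of t]], of "\<delta> * t"] dt B(4)
        by (auto intro: set_integral_nonneg')
      also have "(LINT u:{0..t}|lborel. B (t - u)) \<le> C * (t * B t)"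
        using IB set_integral_reflect(2)[OF B(5)] dt by simp
      finally have "(LINT u:{\<delta> * t<..t}|lborel. A u * B (t - u)) \<le> D * A t * (C * (t * B t))"
        using D pos by (simp add: mult_left_mono)
      also have "\<dots> = D * C * (t * A t) * B t" by (simp add: mult_ac)
      also have "\<dots> \<le> D * C * (\<epsilon>3 * IA t) * B t"
        using domA' D C pos by (intro mult_right_mono mult_left_mono) auto
      also have "\<dots> = (D * C * \<epsilon>3) * G" by (simp add: G_def)
      also have "\<dots> \<le> \<eta> * G" using e3D G by (intro mult_right_mono) auto
      finally show ?thesis .
    qed
    have J1_lower: "(1 - \<eta>) * (1 - \<eta>) * G \<le> (LINT u:{0..\<delta> * t}|lborel. A u * B (t - u))"
    proof -
      have "(1 - \<eta>) * IA t \<le> (LINT u:{0..\<delta> * t}|lborel. A u)"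
        using IA_split IA2 by (simp add: algebra_simps)
      then have "(1 - \<eta>) * IA t * ((1 - \<eta>) * B t) \<le> (LINT u:{0..\<delta> * t}|lborel. A u) * ((1 - \<eta>) * B t)"
        using \<eta> pos by (intro mult_right_mono) auto
      also have "\<dots> = (LINT u:{0..\<delta> * t}|lborel. A u * ((1 - \<eta>) * B t))" by simp
      also have "\<dots> \<le> (LINT u:{0..\<delta> * t}|lborel. A u * B (t - u))"
        using Bnear by (intro set_integral_mono intJ set_integrable_mult_left intA mult_left_mono A) auto
      finally show ?thesis by (simp add: G_def mult_ac)
    qed
    have J2_lower: "0 \<le> (LINT u:{\<delta> * t<..t}|lborel. A u * B (t - u))"
      by (rule set_integral_nonneg') (intro mult_nonneg_nonneg A(3) B(4))
    have \<eta>2: "\<eta> * \<eta> \<le> \<eta>" "0 \<le> \<eta> * \<eta>" using \<eta> by (auto simp: mult_left_le)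
    have "J t \<le> ((1 + \<eta>) * (1 + \<eta>) + \<eta>) * G"
      using J_split J1_upper J2_upper by (simp add: algebra_simps)
    also have "\<dots> \<le> (1 + 4 * \<eta>) * G" using \<eta>2 G by (intro mult_right_mono) (auto simp: algebra_simps)
    finally have up: "J t / G \<le> 1 + 4 * \<eta>" using G by (simp add: field_simps)
    have "(1 - 4 * \<eta>) * G \<le> (1 - \<eta>) * (1 - \<eta>) * G" using \<eta> \<eta>2 G by (intro mult_right_mono) (auto simp: algebra_simps)
    then have "(1 - 4 * \<eta>) * G \<le> J t" using J_split J1_lower J2_lower by simp
    then have lo: "1 - 4 * \<eta> \<le> J t / G" using G by (simp add: field_simps)
    have "\<bar>J t / G - 1\<bar> < e" using up lo \<eta> by (simp add: abs_less_iff)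
    then show ?case by (simp add: G_def dist_real_def)
  qed
qed

text \<open>
  The integral is slowly varying, hence the product shrinks at least by a fixed factor \<open>\<Lambda> < 1\<close> when
  \<open>t\<close> is doubled.
\<close>

lemma regularly_varying_convolution_denominator:
  assumes A: "regularly_varying A \<rho>" "\<rho> \<le> -1" "\<And>t. 0 \<le> A t"
      "\<And>t. set_integrable lborel {0..t} A"
    and B: "regularly_varying B \<sigma>" "\<sigma> < 0" "\<And>t. 0 \<le> B t"
  shows "((\<lambda>t. (LINT u:{0..t}|lborel. A u) * B t) \<longlongrightarrow> 0) at_top"
proof -
  define IA where "IA t = (LINT u:{0..t}|lborel. A u)" for t
  define W where "W t = IA t * B t" for t
  have IA_nonneg: "0 \<le> IA t" for t unfolding IA_def by (rule set_integral_nonneg') (rule A)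
  have W_nonneg: "0 \<le> W t" for t using IA_nonneg B(3) by (simp add: W_def)
  have IA_mono: "IA s \<le> IA t" if "0 \<le> s" "s \<le> t" for s t
    using set_integral_Icc_split[OF A(4)[of t], of s] that A(3) by (auto simp: IA_def intro: set_integral_nonneg')
  define a :: real where "a = 2 powr \<sigma>"
  have a: "0 < a" "a < 1" using B(2) by (auto simp: a_def powr_def mult_neg_pos)
  \<comment> \<open>\<open>\<epsilon>\<close> and \<open>\<zeta>\<close> are the relative errors that leave \<open>\<kappa>\<close> and then \<open>\<Lambda>\<close> below 1: \<open>\<kappa> = (1 + a) / 2\<close> and \<open>\<Lambda> = (1 + \<kappa>) / 2\<close>\<close>
  define \<epsilon> where "\<epsilon> = (1 / a - 1) / 2"
  have e0: "0 < \<epsilon>" using a by (simp add: \<epsilon>_def field_simps)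
  define \<kappa> where "\<kappa> = (1 + \<epsilon>) * a"
  have "\<kappa> = (a + 1) / 2" using a by (simp add: \<kappa>_def \<epsilon>_def field_simps)
  then have k: "0 < \<kappa>" "\<kappa> < 1" using a by auto
  define \<zeta> where "\<zeta> = (1 / \<kappa> - 1) / 2"
  have z0: "0 < \<zeta>" using k by (simp add: \<zeta>_def field_simps)
  define \<Lambda> where "\<Lambda> = (1 + \<zeta>) * \<kappa>"
  have "\<Lambda> = (\<kappa> + 1) / 2" using k by (simp add: \<Lambda>_def \<zeta>_def field_simps)
  then have l: "0 < \<Lambda>" "\<Lambda> < 1" using k by auto
  define D where "D = 2 * (1/2::real) powr \<rho>"
  have D: "D > 0" by (simp add: D_def)
  \<comment> \<open>makes the growth of the integral over \<open>(t / 2, t]\<close> at most the fraction \<open>\<zeta> / (1 + \<zeta>)\<close> of the whole\<close>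
  define \<xi> where "\<xi> = \<zeta> / ((1 + \<zeta>) * D)"
  have x0: "0 < \<xi>" using z0 D by (simp add: \<xi>_def)
  have \<rho>0: "\<rho> \<le> 0" using A(2) by simp
  have grow: "eventually (\<lambda>t. IA t \<le> (1 + \<zeta>) * IA (t / 2)) at_top"
    using regularly_varying_window_bound[OF A(1) \<rho>0 A(3,4) half_gt_zero[OF zero_less_one] half_less_one, folded D_def]
      integral_dominates_regularly_varying[OF A x0] eventually_gt_at_top[of 0]
  proof (eventually_elim)
    case (elim t)
    then have w: "IA t - IA (t / 2) \<le> D * (t * A t)" and d: "t * A t \<le> \<xi> * IA t"
      using set_integral_Icc_split[OF A(4)[of t], of "t/2"] by (auto simp: IA_def)
    have "IA t - IA (t / 2) \<le> D * (\<xi> * IA t)" using w d D by (meson mult_left_mono less_imp_le order_trans)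
    also have "\<dots> = \<zeta> / (1 + \<zeta>) * IA t" using D by (simp add: \<xi>_def)
    finally have "IA t * (1 - \<zeta> / (1 + \<zeta>)) \<le> IA (t / 2)" by (simp add: algebra_simps)
    moreover have "1 - \<zeta> / (1 + \<zeta>) = 1 / (1 + \<zeta>)" using z0 by (simp add: field_simps)
    ultimately show ?case using z0 by (simp add: field_simps)
  qed
  have "eventually (\<lambda>t. B (2 * t) \<le> \<kappa> * B t) at_top"
    using regularly_varying_uniform[OF B(1) zero_less_numeral order_refl e0, of "num.Bit0 num.One"]
    by eventually_elim (auto simp: \<kappa>_def a_def)
  moreover have "eventually (\<lambda>t. \<forall>c\<in>{1..2}. B (c * t) \<le> 2 * B t) at_top"
    using regularly_varying_uniform[OF B(1) zero_less_one one_le_numeral zero_less_one, of "num.Bit0 num.One"]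
  proof eventually_elim
    case (elim t)
    show ?case
    proof
      fix c :: real assume c: "c \<in> {1..2}"
      then have "B (c * t) \<le> 2 * c powr \<sigma> * B t" using elim by auto
      also have "c powr \<sigma> \<le> 1" using c B(2) powr_mono2'[of \<sigma> 1 c] by auto
      finally show "B (c * t) \<le> 2 * B t" using B(3)[of t] by (auto simp: mult_right_mono)
    qed
  qed
  moreover have "eventually (\<lambda>t. IA (2 * t) \<le> (1 + \<zeta>) * IA t) at_top"
  proof -
    have "filterlim (\<lambda>t::real. 2 * t) at_top at_top"
      by (rule filterlim_tendsto_pos_mult_at_top[OF tendsto_const _ filterlim_ident]) simp
    from eventually_compose_filterlim[OF grow this] show ?thesis by simp
  qed
  ultimately have "eventually (\<lambda>t. B (2 * t) \<le> \<kappa> * B t \<and> (\<forall>c\<in>{1..2}. B (c * t) \<le> 2 * B t) \<and>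
      IA (2 * t) \<le> (1 + \<zeta>) * IA t \<and> 0 < t) at_top"
    using eventually_gt_at_top[of 0] by eventually_elim auto
  then obtain t0 where T: "\<And>t. t \<ge> t0 \<Longrightarrow> B (2 * t) \<le> \<kappa> * B t \<and> (\<forall>c\<in>{1..2}. B (c * t) \<le> 2 * B t) \<and>
      IA (2 * t) \<le> (1 + \<zeta>) * IA t \<and> 0 < t"
    unfolding eventually_at_top_linorder by blast
  have t0: "\<And>t. t \<ge> t0 \<Longrightarrow> B (2 * t) \<le> \<kappa> * B t" "\<And>c. c \<in> {1..2} \<Longrightarrow> B (c * t0) \<le> 2 * B t0"
      "\<And>t. t \<ge> t0 \<Longrightarrow> IA (2 * t) \<le> (1 + \<zeta>) * IA t" "0 < t0"
    using T T[of t0] by auto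
  have W2: "W (2 * t) \<le> \<Lambda> * W t" if "t0 \<le> t" for t
  proof -
    have "W (2 * t) \<le> ((1 + \<zeta>) * IA t) * (\<kappa> * B t)"
      unfolding W_def using t0 that IA_nonneg B(3) k z0 by (intro mult_mono) auto
    then show ?thesis by (simp add: W_def \<Lambda>_def mult_ac)
  qed
  define K where "K = IA (2 * t0) * (2 * B t0)"
  have K: "0 \<le> K" using IA_nonneg B(3) by (simp add: K_def)
  have WK: "W t \<le> K" if "t0 \<le> t" for t
  proof (rule doubling_induct[OF t0(4) that])
    fix t assume t: "t0 \<le> t" "t \<le> 2 * t0"
    have "B (t / t0 * t0) \<le> 2 * B t0" using t t0(4) by (intro t0(2)) (auto simp: field_simps)
    then have "B t \<le> 2 * B t0" using t0(4) by simp
    moreover have "IA t \<le> IA (2 * t0)" using t t0(4) by (intro IA_mono) auto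
    ultimately show "W t \<le> K" unfolding W_def K_def using IA_nonneg B(3) by (intro mult_mono) auto
  next
    fix t assume t: "t0 \<le> t" "W t \<le> K"
    have "W (2 * t) \<le> \<Lambda> * W t" by (rule W2[OF t(1)])
    also have "\<dots> \<le> 1 * W t" using l W_nonneg by (intro mult_right_mono) auto
    finally show "W (2 * t) \<le> K" using t by simp
  qed
  have Wn: "\<forall>t\<ge>2 ^ n * t0. W t \<le> \<Lambda> ^ n * K" for n
  proof (induction n)
    case (Suc n)
    show ?case
    proof (intro allI impI)
      fix t assume t: "2 ^ Suc n * t0 \<le> t"
      have "1 * t0 \<le> 2 ^ n * t0" using t0(4) by (intro mult_right_mono) auto
      then have "t0 \<le> t / 2" using t by simp
      then have "W t \<le> \<Lambda> * W (t / 2)" using W2[of "t/2"] by simp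
      also have "W (t / 2) \<le> \<Lambda> ^ n * K" using Suc t by simp
      finally show "W t \<le> \<Lambda> ^ Suc n * K" using l by simp
    qed
  qed (use WK in auto)
  have "(W \<longlongrightarrow> 0) at_top"
  proof (rule tendstoI)
    fix e :: real assume "0 < e"
    have "(\<lambda>n. \<Lambda> ^ n * K) \<longlonglongrightarrow> 0 * K" using l by (intro tendsto_intros LIMSEQ_realpow_zero) auto
    then have "eventually (\<lambda>n. \<Lambda> ^ n * K < e) sequentially" using \<open>0 < e\<close> by (auto dest: order_tendstoD(2))
    then obtain n where n: "\<Lambda> ^ n * K < e" by (auto simp: eventually_sequentially)
    show "eventually (\<lambda>t. dist (W t) 0 < e) at_top"
      using eventually_ge_at_top[of "2 ^ n * t0"]
      by eventually_elim (use Wn[of n] n W_nonneg in \<open>fastforce simp: dist_real_def\<close>)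
  qed
  then show ?thesis by (simp add: W_def[abs_def] IA_def)
qed

section \<open>Probability generating functions\<close>

lemma pgf_integrable: "0 \<le> s \<Longrightarrow> s \<le> 1 \<Longrightarrow> integrable (measure_pmf p) (\<lambda>n. s ^ n :: real)"
  by (rule measure_pmf.integrable_const_bound[where B=1]) (auto simp: power_le_one)

lemma pgf_1: "pgf p 1 = 1"
  by (simp add: pgf_def)

lemma pgf_mono: "0 \<le> s \<Longrightarrow> s \<le> t \<Longrightarrow> t \<le> 1 \<Longrightarrow> pgf p s \<le> pgf p t"
  unfolding pgf_def by (intro integral_mono pgf_integrable power_mono) auto

lemma pgf_nonneg: "0 \<le> s \<Longrightarrow> 0 \<le> pgf p s"
  unfolding pgf_def by (intro integral_nonneg_AE) auto

lemma pgf_le_1: "0 \<le> s \<Longrightarrow> s \<le> 1 \<Longrightarrow> pgf p s \<le> 1"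
  using pgf_mono[of s 1 p] by (simp add: pgf_1)

lemma continuous_on_pgf: "continuous_on {0..1} (pgf p)"
  unfolding continuous_on_sequentially
proof (intro allI ballI impI)
  fix x :: "nat \<Rightarrow> real" and a :: real
  assume a: "a \<in> {0..1}" and x: "(\<forall>n. x n \<in> {0..1}) \<and> x \<longlonglongrightarrow> a"
  show "(pgf p \<circ> x) \<longlonglongrightarrow> pgf p a"
    unfolding comp_def pgf_def
  proof (rule integral_dominated_convergence[where w="\<lambda>_. 1"])
    show "AE n in measure_pmf p. (\<lambda>i. x i ^ n) \<longlonglongrightarrow> a ^ n"
      using x by (auto intro!: tendsto_power)
    show "AE n in measure_pmf p. norm (x i ^ n) \<le> 1" for i
      using x by (auto simp: power_le_one)
  qed auto
qed

lemma critical_integrable: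
  assumes "critical p" shows "integrable (measure_pmf p) real"
  using assms not_integrable_integral_eq[of "measure_pmf p" real] by (auto simp: critical_def)

text \<open>
  The tangent to the generating function at 1 has slope 1. Concretely, this is Bernoulli's
  inequality \<open>s ^ n \<ge> 1 + n * (s - 1)\<close> integrated.
\<close>

lemma critical_pgf_ge:
  assumes "critical p" "0 \<le> s" "s \<le> 1"
  shows "s \<le> pgf p s"
proof -
  have "(\<integral>n. 1 + real n * (s - 1) \<partial>measure_pmf p) \<le> pgf p s"
    unfolding pgf_def
  proof (intro integral_mono Bochner_Integration.integrable_add integrable_const integrable_mult_left pgf_integrable)
    show "1 + real n * (s - 1) \<le> s ^ n" for n
      using Bernoulli_inequality[of "s - 1" n] assms by simp
  qed (use critical_integrable[OF assms(1)] assms in auto)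
  also have "(\<integral>n. 1 + real n * (s - 1) \<partial>measure_pmf p) = s"
    using critical_integrable[OF assms(1)] assms(1) by (simp add: critical_def)
  finally show ?thesis .
qed

text \<open>
  Convexity, in the form that the graph lies below the chord from \<open>s\<close> to 1.
\<close>

lemma pgf_chord:
  assumes "0 \<le> s" "s \<le> t" "t < 1"
  shows "(1 - s) * pgf p t \<le> (t - s) + (1 - t) * pgf p s"
proof -
  define w where "w = (t - s) / (1 - s)"
  have w: "0 \<le> w" "w \<le> 1" using assms by (auto simp: w_def)
  have "w * (1 - s) = t - s" using assms by (simp add: w_def)
  then have t: "t = (1 - w) * s + w * 1" by (simp add: algebra_simps)
  have "pgf p t \<le> (\<integral>n. (1 - w) * s ^ n + w \<partial>measure_pmf p)"
    unfolding pgf_def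
  proof (intro integral_mono Bochner_Integration.integrable_add integrable_const integrable_mult_right pgf_integrable)
    fix n
    have conv: "convex_on {0..} (\<lambda>x::real. x ^ n)"
      by (cases "even n") (auto intro: convex_power_odd convex_on_subset[OF convex_power_even])
    have "((1 - w) *\<^sub>R s + w *\<^sub>R 1) ^ n \<le> (1 - w) * s ^ n + w * 1 ^ n"
      by (rule convex_onD[OF conv]) (use assms w in auto)
    then show "t ^ n \<le> (1 - w) * s ^ n + w" using t by simp
  qed (use assms in auto)
  also have "\<dots> = (1 - w) * pgf p s + w"
    using assms by (simp add: pgf_def pgf_integrable)
  finally have "(1 - s) * pgf p t \<le> (1 - s) * ((1 - w) * pgf p s + w)"
    using assms by (intro mult_left_mono) auto
  moreover have "(1 - s) * w = t - s" "(1 - s) * (1 - w) = 1 - t"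
    using assms by (auto simp: w_def field_simps)
  ultimately show ?thesis by (simp add: distrib_left mult.assoc[symmetric])
qed

text \<open>
  If \<open>f s = s\<close>, then convexity and \<open>f t \<ge> t\<close> force \<open>f t = t\<close> on \<open>[s, 1]\<close>. This contradicts the
  positivity of \<open>L\<close> near infinity.
\<close>

lemma critical_pgf_gt:
  assumes p: "critical p" and L: "slowly_varying L"
    and f: "\<And>s. 0 \<le> s \<Longrightarrow> s < 1 \<Longrightarrow> pgf p s = s + (1 - s) powr (\<gamma> + 1) * L (1 / (1 - s))"
    and s: "0 \<le> s" "s < 1"
  shows "s < pgf p s"
proof (rule ccontr)
  assume "\<not> s < pgf p s"
  then have eq: "pgf p s = s" using critical_pgf_ge[OF p, of s] s by simp
  obtain X where X: "\<And>x. x \<ge> X \<Longrightarrow> L x > 0" using L by (auto simp: slowly_varying_def)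
  define y where "y = Max {X, 1 / (1 - s), 1}"
  define t where "t = 1 - 1 / y"
  have y: "y \<ge> X" "y \<ge> 1 / (1 - s)" "y \<ge> 1" by (auto simp: y_def)
  have t: "s \<le> t" "t < 1" "1 / (1 - t) = y" using y s by (auto simp: t_def field_simps)
  have "(1 - s) * pgf p t \<le> (1 - s) * t"
    using pgf_chord[of s t p] t s eq by (simp add: algebra_simps)
  then have "pgf p t \<le> t" using s by simp
  moreover have "pgf p t = t + (1 - t) powr (\<gamma> + 1) * L y" using f[of t] t s by simp
  moreover have "0 < (1 - t) powr (\<gamma> + 1) * L y" using X[of y] y t by simp
  ultimately show False by simp
qed

section \<open>Survival probabilities of critical processes\<close>

text \<open>
  With \<open>x = 1 / (1 - F)\<close> the differential equation becomes \<open>x' = V x\<close> for \<open>V y = \<mu> * y powr (1 - \<gamma>) * L y\<close>.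
  So \<open>x\<close> is the inverse of \<open>U y = \<integral>\<^sub>1\<^sup>y 1 / V\<close>. The rule of l'Hospital gives the ratio limits of \<open>U\<close> with
  index \<open>\<gamma>\<close> without an asymptotic formula for \<open>U\<close> itself, and they are inverted by monotonicity. Finally
  \<open>1 - g (F t) = w (x t)\<close> for \<open>w y = y powr (- \<alpha>) * l y\<close>, which is decreasing; this monotonicity
  replaces uniform convergence when \<open>x\<close> is inserted into \<open>l\<close>.
\<close>

lemma survival_function_regularly_varying:
  fixes F f g :: "real \<Rightarrow> real"
  assumes F0: "F 0 = 0" and F: "\<And>t. 0 \<le> t \<Longrightarrow> 0 \<le> F t" "\<And>t. 0 \<le> t \<Longrightarrow> F t < 1"
    and ode: "\<And>t. 0 \<le> t \<Longrightarrow> (F has_real_derivative \<mu> * (f (F t) - F t)) (at t within {0..})"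
    and "0 < \<mu>" "0 < \<gamma>"
    and f_cont: "continuous_on {0..<1} f" and f_gt: "\<And>s. 0 \<le> s \<Longrightarrow> s < 1 \<Longrightarrow> s < f s"
    and f: "\<And>s. 0 \<le> s \<Longrightarrow> s < 1 \<Longrightarrow> f s = s + (1 - s) powr (\<gamma> + 1) * L (1 / (1 - s))"
    and L: "slowly_varying L"
    and g_cont: "continuous_on {0..<1} g"
    and g_mono: "\<And>s t. 0 \<le> s \<Longrightarrow> s \<le> t \<Longrightarrow> t < 1 \<Longrightarrow> g s \<le> g t"
    and g: "\<And>s. 0 \<le> s \<Longrightarrow> s < 1 \<Longrightarrow> g s = 1 - (1 - s) powr \<alpha> * l (1 / (1 - s))"
    and l: "slowly_varying l"
  shows "regularly_varying (\<lambda>t. 1 - g (F t)) (- (\<alpha> / \<gamma>))"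
proof -
  define x where "x t = 1 / (1 - F t)" for t
  define V where "V y = \<mu> * (f (1 - 1 / y) - (1 - 1 / y)) * y\<^sup>2" for y
  define U where "U y = integral {1..y} (\<lambda>z. 1 / V z)" for y
  have x_ge: "1 \<le> x t" if "0 \<le> t" for t using F[OF that] by (simp add: x_def)
  have F_x: "F t = 1 - 1 / x t" if "0 \<le> t" for t using F[OF that] by (simp add: x_def)
  have V_pos: "0 < V y" if "1 \<le> y" for y
    using f_gt[of "1 - 1/y"] that \<open>0 < \<mu>\<close> by (simp add: V_def)
  have V_cont: "continuous_on {1..} V"
    unfolding V_def
    by (intro continuous_intros continuous_on_compose2[OF f_cont]) (auto simp: field_simps)
  then have V_inv_cont: "continuous_on {1..b} (\<lambda>z. 1 / V z)" for b
    using V_pos by (intro continuous_intros continuous_on_subset[OF V_cont]) force+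
  have U_deriv_within: "(U has_real_derivative 1 / V y) (at y within {1..b})" if "1 \<le> y" "y \<le> b" for y b
    unfolding U_def using that by (intro integral_has_real_derivative V_inv_cont) auto
  have U_deriv: "(U has_real_derivative 1 / V y) (at y)" if "1 < y" for y
    using U_deriv_within[of y "y+1"] that at_within_interior[of y "{1..y+1}"] by auto
  have U_mono: "U y \<le> U z" if "1 \<le> y" "y \<le> z" for y z
    unfolding U_def using that V_pos
    by (intro integral_subset_le integrable_continuous_real V_inv_cont) (auto simp: less_imp_le)
  have x_deriv: "(x has_real_derivative V (x t)) (at t within {0..})" if t: "0 \<le> t" for t
  proof -
    have "(x has_real_derivative (\<mu> * (f (F t) - F t)) / (1 - F t)\<^sup>2) (at t within {0..})"
      unfolding x_def using F[OF t]
      by (auto intro!: derivative_eq_intros ode[OF t] simp: power2_eq_square field_simps)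
    moreover have "(\<mu> * (f (F t) - F t)) / (1 - F t)\<^sup>2 = V (x t)"
      by (simp add: V_def x_def power_divide)
    ultimately show ?thesis by simp
  qed
  have U_x: "U (x T) = T" if T: "0 \<le> T" for T
  proof -
    have xd: "(x has_real_derivative V (x t)) (at t within {0..T})" if "t \<in> {0..T}" for t
      using x_deriv[of t] that by (auto intro: has_field_derivative_subset)
    have "continuous_on {0..T} x"
      using xd by (intro DERIV_continuous_on) auto
    then have "bdd_above (x ` {0..T})"
      by (intro bounded_imp_bdd_above compact_imp_bounded compact_continuous_image) auto
    then obtain b where "\<forall>t\<in>{0..T}. x t \<le> b" by (auto simp: bdd_above_def)
    then have b: "\<And>t. t \<in> {0..T} \<Longrightarrow> x t \<le> b" by blast
    have "((\<lambda>t. U (x t) - t) has_real_derivative 0) (at t within {0..T})" if t: "t \<in> {0..T}" for t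
    proof -
      have "(U has_real_derivative 1 / V (x t)) (at (x t) within x ` {0..T})"
        using U_deriv_within[of "x t" b] x_ge b t by (auto intro: has_field_derivative_subset)
      from DERIV_image_chain[OF this xd[OF t]]
      have "((\<lambda>t. U (x t)) has_real_derivative 1) (at t within {0..T})"
        using V_pos[of "x t"] x_ge[of t] t by (simp add: comp_def)
      then show ?thesis by (auto intro!: derivative_eq_intros)
    qed
    then obtain c where c: "\<And>t. t \<in> {0..T} \<Longrightarrow> U (x t) - t = c"
      using has_field_derivative_zero_constant[of "{0..T}" "\<lambda>t. U (x t) - t"] by auto
    have "c = 0" using c[of 0] T F0 by (simp add: U_def x_def)
    then show ?thesis using c[of T] T by simp
  qed
  \<comment> \<open>if \<open>x\<close> stayed below \<open>b\<close>, then \<open>t = U (x t) \<le> U b\<close> for all \<open>t\<close>\<close>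
  have x_lim: "filterlim x at_top at_top"
    unfolding filterlim_at_top
  proof
    fix b :: real
    show "eventually (\<lambda>t. b \<le> x t) at_top"
      using eventually_gt_at_top[of "U (max b 1)"] eventually_ge_at_top[of 0]
    proof eventually_elim
      case (elim t)
      show ?case
      proof (rule ccontr)
        assume "\<not> b \<le> x t"
        then have "U (x t) \<le> U (max b 1)" using x_ge[of t] elim by (intro U_mono) auto
        then show False using U_x[of t] elim by simp
      qed
    qed
  qed
  have U_lim: "filterlim U at_top at_top"
    unfolding filterlim_at_top
  proof
    fix b :: real
    show "eventually (\<lambda>y. b \<le> U y) at_top"
      using eventually_ge_at_top[of "x (max b 0)"]
    proof eventually_elim
      case (elim y)
      have "U (x (max b 0)) \<le> U y" using x_ge[of "max b 0"] elim by (intro U_mono) auto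
      then show ?case using U_x[of "max b 0"] by simp
    qed
  qed
  have V_eq: "V y = \<mu> * y powr (1 - \<gamma>) * L y" if y: "1 \<le> y" for y
  proof -
    have "V y = \<mu> * ((1 / y) powr (\<gamma> + 1) * y powr 2) * L y"
      using f[of "1 - 1/y"] y by (simp add: V_def)
    also have "(1 / y) powr (\<gamma> + 1) * y powr 2 = y powr (- (\<gamma> + 1)) * y powr 2"
      using y powr_minus_divide[of y "\<gamma> + 1"] by (simp add: powr_divide)
    also have "\<dots> = y powr (1 - \<gamma>)"
      by (simp flip: powr_add)
    finally show ?thesis .
  qed
  have L_lim: "((\<lambda>y. L (c * y) / L y) \<longlongrightarrow> 1) at_top" if "0 < c" for c
    using L that by (auto simp: slowly_varying_def)
  have l_lim: "((\<lambda>y. l (c * y) / l y) \<longlongrightarrow> 1) at_top" if "0 < c" for c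
    using l that by (auto simp: slowly_varying_def)
  have scale_lim: "filterlim (\<lambda>y::real. c * y) at_top at_top" if "0 < c" for c
    by (rule filterlim_tendsto_pos_mult_at_top[OF tendsto_const that filterlim_ident])
  have U_ratio: "((\<lambda>y. U (c * y) / U y) \<longlongrightarrow> c powr \<gamma>) at_top" if c: "0 < c" for c
  proof (rule lhospital_at_top_at_top)
    show "LIM y at_top. U y :> at_top" by (rule U_lim)
    show "eventually (\<lambda>y. 1 / V y \<noteq> 0) at_top"
      using eventually_gt_at_top[of 1]
    proof eventually_elim
      case (elim y) then show ?case using V_pos[of y] by simp
    qed
    show "eventually (\<lambda>y. (U has_real_derivative 1 / V y) (at y)) at_top"
      using eventually_gt_at_top[of 1] by eventually_elim (rule U_deriv)
    have ev: "eventually (\<lambda>y. 1 < c * y) at_top"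
      using scale_lim[OF c] eventually_gt_at_top[of 1] by (auto simp: filterlim_iff)
    then show "eventually (\<lambda>y. ((\<lambda>y. U (c * y)) has_real_derivative c / V (c * y)) (at y)) at_top"
    proof eventually_elim
      case (elim y)
      have "((\<lambda>y. U (c * y)) has_real_derivative (1 / V (c * y)) * (c * 1)) (at y)"
        by (rule DERIV_chain2[where f=U and g="\<lambda>y. c * y", OF U_deriv[OF elim]]) (auto intro!: derivative_eq_intros)
      then show ?case by simp
    qed
    have "((\<lambda>y. c powr \<gamma> * inverse (L (c * y) / L y)) \<longlongrightarrow> c powr \<gamma> * inverse 1) at_top"
      by (intro tendsto_intros L_lim c) auto
    moreover have "eventually (\<lambda>y. c powr \<gamma> * inverse (L (c * y) / L y) = (c / V (c * y)) / (1 / V y)) at_top"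
      using ev eventually_gt_at_top[of 1]
    proof eventually_elim
      case (elim y)
      have "c / V (c * y) / (1 / V y) = c * V y / V (c * y)" by simp
      also have "\<dots> = c * (y powr (1 - \<gamma>) / (c * y) powr (1 - \<gamma>)) * (L y / L (c * y))"
        using elim V_eq[of y] V_eq[of "c * y"] \<open>0 < \<mu>\<close> by simp
      also have "y powr (1 - \<gamma>) / (c * y) powr (1 - \<gamma>) = c powr (\<gamma> - 1)"
        using elim c by (simp add: powr_mult powr_diff field_simps)
      also have "c * c powr (\<gamma> - 1) = c powr \<gamma>" using c by (simp add: powr_diff)
      finally show ?case by simp
    qed
    ultimately show "((\<lambda>y. (c / V (c * y)) / (1 / V y)) \<longlongrightarrow> c powr \<gamma>) at_top"
      by (auto elim: Lim_transform_eventually)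
  qed
  have U_ratio_x: "((\<lambda>t. U (\<Lambda> * x t) / t) \<longlongrightarrow> \<Lambda> powr \<gamma>) at_top" if "0 < \<Lambda>" for \<Lambda>
  proof -
    have "((\<lambda>t. U (\<Lambda> * x t) / U (x t)) \<longlongrightarrow> \<Lambda> powr \<gamma>) at_top"
      by (rule filterlim_compose[OF U_ratio[OF that] x_lim])
    moreover have "eventually (\<lambda>t. U (\<Lambda> * x t) / U (x t) = U (\<Lambda> * x t) / t) at_top"
      using eventually_ge_at_top[of 0] by eventually_elim (simp add: U_x)
    ultimately show ?thesis by (rule Lim_transform_eventually)
  qed
  have scale_ge1: "eventually (\<lambda>t. 1 \<le> \<Lambda> * x t) at_top" if "0 < \<Lambda>" for \<Lambda>
    using filterlim_compose[OF scale_lim[OF that] x_lim] by (simp add: filterlim_at_top)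
  \<comment> \<open>\<open>U (\<Lambda> * x t)\<close> is about \<open>\<Lambda> powr \<gamma> * t\<close>, less than \<open>c * t = U (x (c * t))\<close>\<close>
  have x_lower: "eventually (\<lambda>t. \<Lambda> * x t \<le> x (c * t)) at_top"
    if c: "0 < c" and lam: "0 < \<Lambda>" "\<Lambda> < c powr (1 / \<gamma>)" for c \<Lambda>
  proof -
    have "\<Lambda> powr \<gamma> < (c powr (1 / \<gamma>)) powr \<gamma>" using lam \<open>0 < \<gamma>\<close> by (intro powr_less_mono2) auto
    also have "\<dots> = c" using c \<open>0 < \<gamma>\<close> by (simp add: powr_powr)
    finally have "eventually (\<lambda>t. U (\<Lambda> * x t) / t < c) at_top"
      using order_tendstoD(2)[OF U_ratio_x[OF lam(1)]] by auto
    then show ?thesis using eventually_gt_at_top[of 0]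
    proof eventually_elim
      case (elim t)
      show ?case
      proof (rule ccontr)
        assume "\<not> ?thesis"
        then have "U (x (c * t)) \<le> U (\<Lambda> * x t)" using x_ge[of "c * t"] elim c by (intro U_mono) auto
        then show False using U_x[of "c * t"] elim c by (simp add: field_simps)
      qed
    qed
  qed
  have x_upper: "eventually (\<lambda>t. x (c * t) \<le> \<Lambda> * x t) at_top"
    if c: "0 < c" and lam: "c powr (1 / \<gamma>) < \<Lambda>" for c \<Lambda>
  proof -
    have lpos: "0 < \<Lambda>" using lam by (rule le_less_trans[rotated]) simp
    have "c = (c powr (1 / \<gamma>)) powr \<gamma>" using c \<open>0 < \<gamma>\<close> by (simp add: powr_powr)
    also have "\<dots> < \<Lambda> powr \<gamma>" using lam \<open>0 < \<gamma>\<close> by (intro powr_less_mono2) auto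
    finally have "eventually (\<lambda>t. c < U (\<Lambda> * x t) / t) at_top"
      using order_tendstoD(1)[OF U_ratio_x[OF lpos]] by auto
    then show ?thesis using eventually_gt_at_top[of 0] scale_ge1[OF lpos]
    proof eventually_elim
      case (elim t)
      show ?case
      proof (rule ccontr)
        assume "\<not> ?thesis"
        then have "U (\<Lambda> * x t) \<le> U (x (c * t))" using elim by (intro U_mono) auto
        then show False using U_x[of "c * t"] elim c by (simp add: field_simps)
      qed
    qed
  qed
  define w where "w y = 1 - g (1 - 1 / y)" for y
  have q_w: "1 - g (F t) = w (x t)" if "0 \<le> t" for t using F_x[OF that] by (simp add: w_def)
  have w_anti: "w z \<le> w y" if "1 \<le> y" "y \<le> z" for y z
    unfolding w_def using that by (intro diff_left_mono g_mono) (auto simp: field_simps)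
  have w_eq: "w y = y powr (- \<alpha>) * l y" if "1 \<le> y" for y
    using g[of "1 - 1/y"] that by (simp add: w_def powr_minus_divide powr_divide)
  obtain X where X: "\<And>y. y \<ge> X \<Longrightarrow> l y > 0" using l by (auto simp: slowly_varying_def)
  have w_pos: "0 < w y" if "y \<ge> max X 1" for y using X[of y] w_eq[of y] that by simp
  have w_lim: "((\<lambda>y. w (c * y) / w y) \<longlongrightarrow> c powr (- \<alpha>)) at_top" if c: "0 < c" for c
  proof -
    have "((\<lambda>y. c powr (- \<alpha>) * (l (c * y) / l y)) \<longlongrightarrow> c powr (- \<alpha>) * 1) at_top"
      by (intro tendsto_intros l_lim c)
    moreover have "eventually (\<lambda>y. c powr (- \<alpha>) * (l (c * y) / l y) = w (c * y) / w y) at_top"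
      using eventually_ge_at_top[of 1] eventually_compose_filterlim[OF eventually_ge_at_top[of 1] scale_lim[OF c]]
      by eventually_elim (use c in \<open>simp add: w_eq powr_mult\<close>)
    ultimately show ?thesis by (auto elim: Lim_transform_eventually)
  qed
  have w_x_lim: "((\<lambda>t. w (c * x t) / w (x t)) \<longlongrightarrow> c powr (- \<alpha>)) at_top" if "0 < c" for c
    by (rule filterlim_compose[OF w_lim[OF that] x_lim])
  have wx_pos: "eventually (\<lambda>t. 0 < w (x t)) at_top"
    using eventually_compose_filterlim[OF eventually_ge_at_top[of "max X 1"] x_lim]
    by eventually_elim (rule w_pos)
  have ratio: "((\<lambda>t. w (x (c * t)) / w (x t)) \<longlongrightarrow> c powr (- (\<alpha> / \<gamma>))) at_top" if c: "0 < c" for c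
  proof -
    define c0 where "c0 = c powr (1 / \<gamma>)"
    have c0: "0 < c0" using c by (simp add: c0_def)
    have target: "c0 powr (- \<alpha>) = c powr (- (\<alpha> / \<gamma>))" using c by (simp add: c0_def powr_powr)
    have "isCont (\<lambda>z. z powr (- \<alpha>)) c0" using c0 by (intro continuous_intros) auto
    then have cont: "((\<lambda>z. z powr (- \<alpha>)) \<longlongrightarrow> c powr (- (\<alpha> / \<gamma>))) (at c0)"
      by (simp add: isCont_def target)
    show ?thesis
    proof (rule order_tendstoI)
      fix a assume a: "a < c powr (- (\<alpha> / \<gamma>))"
      have "eventually (\<lambda>z. a < z powr (- \<alpha>) \<and> c0 < z) (at_right c0)"
        using order_tendstoD(1)[OF tendsto_within_subset[OF cont, of "{c0<..}"] a] eventually_at_right_less[of c0]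
        by (auto intro: eventually_conj)
      then obtain z where z: "a < z powr (- \<alpha>)" "c0 < z"
        using eventually_happens[of _ "at_right c0"] by (auto simp: trivial_limit_at_right_real)
      have "eventually (\<lambda>t. a < w (z * x t) / w (x t)) at_top"
        using order_tendstoD(1)[OF w_x_lim z(1)] z c0 by auto
      moreover note x_upper[OF c z(2)[unfolded c0_def]] wx_pos eventually_ge_at_top[of 0]
      ultimately show "eventually (\<lambda>t. a < w (x (c * t)) / w (x t)) at_top"
      proof eventually_elim
        case (elim t)
        have "w (z * x t) \<le> w (x (c * t))" using elim x_ge[of "c * t"] c by (intro w_anti) auto
        then have "w (z * x t) / w (x t) \<le> w (x (c * t)) / w (x t)" using elim by (intro divide_right_mono) auto
        then show ?case using elim by simp
      qed
    next
      fix a assume a: "c powr (- (\<alpha> / \<gamma>)) < a"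
      have "eventually (\<lambda>z. z powr (- \<alpha>) < a \<and> z < c0 \<and> 0 < z) (at_left c0)"
        using order_tendstoD(2)[OF tendsto_within_subset[OF cont, of "{..<c0}"] a]
          eventually_at_left_real[OF c0]
        by (auto elim: eventually_elim2)
      then obtain z where z: "z powr (- \<alpha>) < a" "z < c0" "0 < z"
        using eventually_happens[of _ "at_left c0"] by (auto simp: trivial_limit_at_left_real)
      have "eventually (\<lambda>t. w (z * x t) / w (x t) < a) at_top"
        using order_tendstoD(2)[OF w_x_lim z(1)] z c0 by auto
      moreover note x_lower[OF c z(3) z(2)[unfolded c0_def]] wx_pos scale_ge1[OF z(3)]
      ultimately show "eventually (\<lambda>t. w (x (c * t)) / w (x t) < a) at_top"
      proof eventually_elim
        case (elim t)
        have "w (x (c * t)) \<le> w (z * x t)" using elim by (intro w_anti) auto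
        then have "w (x (c * t)) / w (x t) \<le> w (z * x t) / w (x t)" using elim by (intro divide_right_mono) auto
        then show ?case using elim by simp
      qed
    qed
  qed
  obtain T where T: "\<And>t. t \<ge> T \<Longrightarrow> 0 < w (x t)" using wx_pos by (auto simp: eventually_at_top_linorder)
  have F_cont: "continuous_on {0..} F" using ode by (intro DERIV_continuous_on) auto
  have "continuous_on {max T 0..} (\<lambda>t. 1 - g (F t))"
    by (intro continuous_intros continuous_on_compose2[OF g_cont] continuous_on_subset[OF F_cont])
      (use F in auto)
  then have "(\<lambda>t. 1 - g (F t)) \<in> borel_measurable (restrict_space borel {max T 0..})"
    by (rule borel_measurable_continuous_on_restrict)
  moreover have "\<forall>t\<ge>max T 0. 1 - g (F t) > 0" using T q_w by auto
  moreover have "((\<lambda>t. (1 - g (F (c * t))) / (1 - g (F t))) \<longlongrightarrow> c powr (- (\<alpha> / \<gamma>))) at_top" if c: "0 < c" for c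
  proof (rule Lim_transform_eventually[OF ratio[OF c]])
    show "eventually (\<lambda>t. w (x (c * t)) / w (x t) = (1 - g (F (c * t))) / (1 - g (F t))) at_top"
      using eventually_ge_at_top[of 0] by eventually_elim (use c in \<open>simp add: q_w\<close>)
  qed
  ultimately show ?thesis unfolding regularly_varying_def by blast
qed

section \<open>Family trees\<close>

text \<open>
  A realisation of all lifetimes and offspring numbers is a single function \<open>y\<close>: the lifetime
  of \<open>u\<close> is stored at \<open>Inl u\<close> and its offspring number at \<open>Inr u\<close>. On this space
  the whole process becomes a function of \<open>y\<close>, and its law depends on \<open>\<mu>\<close> and \<open>p\<close> only.
\<close>

type_synonym tree_data = "nat list + nat list \<Rightarrow> real"

abbreviation tree_space :: "tree_data measure" where
  "tree_space \<equiv> \<Pi>\<^sub>M i\<in>UNIV. borel"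

definition lifetimes :: "tree_data \<Rightarrow> nat list \<Rightarrow> real" where
  "lifetimes y u = y (Inl u)"

definition offspring :: "tree_data \<Rightarrow> nat list \<Rightarrow> nat" where
  "offspring y u = nat \<lfloor>y (Inr u)\<rfloor>"

definition subtree :: "nat \<Rightarrow> tree_data \<Rightarrow> nat list + nat list \<Rightarrow> real" where
  "subtree i y = (\<lambda>j. y (map_sum ((#) i) ((#) i) j))"

definition coordinate_law :: "real \<Rightarrow> nat pmf \<Rightarrow> nat list + nat list \<Rightarrow> real measure" where
  "coordinate_law \<mu> p = case_sum (\<lambda>_. density lborel (exponential_density \<mu>)) (\<lambda>_. distr (measure_pmf p) borel real)"

definition tree_law :: "real \<Rightarrow> nat pmf \<Rightarrow> tree_data measure" where
  "tree_law \<mu> p = Pi\<^sub>M UNIV (coordinate_law \<mu> p)"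

definition extinct_by :: "real \<Rightarrow> tree_data \<Rightarrow> bool" where
  "extinct_by t y \<longleftrightarrow> alive (lifetimes y) (offspring y) t = {}"

definition born_by :: "real \<Rightarrow> tree_data \<Rightarrow> nat list set" where
  "born_by t y = {u. is_born (offspring y) u \<and> birth_time (lifetimes y) u \<le> t}"

lemma is_born_Nil [simp]: "is_born X []"
  by (simp add: is_born_def)

lemma is_born_Cons: "is_born X (i # u) \<longleftrightarrow> i < X [] \<and> is_born (\<lambda>v. X (i # v)) u"
  unfolding is_born_def by (simp add: All_less_Suc2)

lemma birth_time_Nil [simp]: "birth_time T [] = 0"
  by (simp add: birth_time_def)

lemma birth_time_Cons: "birth_time T (i # u) = T [] + birth_time (\<lambda>v. T (i # v)) u"
  by (simp add: birth_time_def sum.lessThan_Suc_shift del: sum.lessThan_Suc)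

lemma lifetimes_subtree: "lifetimes (subtree i y) = (\<lambda>v. lifetimes y (i # v))"
  by (simp add: lifetimes_def subtree_def fun_eq_iff)

lemma offspring_subtree: "offspring (subtree i y) = (\<lambda>v. offspring y (i # v))"
  by (simp add: offspring_def subtree_def fun_eq_iff)

text \<open>
  At time \<open>t\<close> nobody is alive iff the root is dead and each of the subtrees of its children, whose
  clocks start at the death of the root, has become extinct.
\<close>

lemma extinct_by_rec:
  assumes "0 \<le> t"
  shows "extinct_by t y \<longleftrightarrow> lifetimes y [] \<le> t \<and>
    (\<forall>i<offspring y []. extinct_by (t - lifetimes y []) (subtree i y))"
proof -
  have Nil: "[] \<in> alive (lifetimes y) (offspring y) t \<longleftrightarrow> t < lifetimes y []"
    using assms by (simp add: alive_def)
  have Cons: "i # u \<in> alive (lifetimes y) (offspring y) t \<longleftrightarrow>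
      i < offspring y [] \<and> u \<in> alive (lifetimes (subtree i y)) (offspring (subtree i y)) (t - lifetimes y [])" for i u
    by (auto simp: alive_def is_born_Cons birth_time_Cons lifetimes_subtree offspring_subtree)
  have "extinct_by t y \<longleftrightarrow> (\<forall>u. u \<notin> alive (lifetimes y) (offspring y) t)"
    by (auto simp: extinct_by_def)
  also have "\<dots> \<longleftrightarrow> [] \<notin> alive (lifetimes y) (offspring y) t \<and> (\<forall>i u. i # u \<notin> alive (lifetimes y) (offspring y) t)"
    by (metis list.exhaust)
  finally show ?thesis by (auto simp: Nil Cons extinct_by_def)
qed

lemma finite_born_by_rec:
  assumes "\<And>i. i < offspring y [] \<Longrightarrow> finite (born_by (t - lifetimes y []) (subtree i y))"
  shows "finite (born_by t y)"
proof -
  have "born_by t y \<subseteq> {[]} \<union> (\<Union>i<offspring y []. (#) i ` born_by (t - lifetimes y []) (subtree i y))"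
  proof
    fix u assume u: "u \<in> born_by t y"
    show "u \<in> {[]} \<union> (\<Union>i<offspring y []. (#) i ` born_by (t - lifetimes y []) (subtree i y))"
    proof (cases u)
      case (Cons i v)
      then have "i < offspring y []" "v \<in> born_by (t - lifetimes y []) (subtree i y)"
        using u by (auto simp: born_by_def is_born_Cons birth_time_Cons lifetimes_subtree offspring_subtree algebra_simps)
      then show ?thesis using Cons by blast
    qed simp
  qed
  then show ?thesis by (rule finite_subset) (use assms in auto)
qed

lemma birth_time_nonneg: "(\<And>v. 0 \<le> T v) \<Longrightarrow> 0 \<le> birth_time T u"
  by (simp add: birth_time_def sum_nonneg)

lemma finite_born_by_root:
  assumes "\<And>v. 0 \<le> lifetimes y v" "t < lifetimes y []"
  shows "finite (born_by t y)"
proof -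
  have "u = []" if "u \<in> born_by t y" for u
    using that assms birth_time_nonneg[of "\<lambda>v. lifetimes y (hd u # v)" "tl u"]
    by (cases u) (auto simp: born_by_def birth_time_Cons)
  then have "born_by t y \<subseteq> {[]}" by blast
  then show ?thesis by (rule finite_subset) simp
qed

lemma alive_subset_born_by: "alive (lifetimes y) (offspring y) t \<subseteq> born_by t y"
  by (auto simp: alive_def born_by_def)

text \<open>
  Among the prefixes of \<open>u\<close>, the longest one that is born by time \<open>s\<close> is still alive at \<open>s\<close>, since its death
  is the birth of the next prefix.
\<close>

lemma alive_ancestor:
  assumes u: "u \<in> alive T X t" and s: "0 \<le> s" "s \<le> t"
  shows "\<exists>j\<le>length u. take j u \<in> alive T X s"
proof -
  have u': "is_born X u" "t < birth_time T u + T u" using u by (auto simp: alive_def)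
  have bt: "birth_time T (take (Suc j) u) = birth_time T (take j u) + T (take j u)" if "j < length u" for j
    using that by (simp add: birth_time_def min_absorb1 min_absorb2 Suc_leI)
  have born: "is_born X (take j u)" for j
    using u'(1) by (auto simp: is_born_def min_def)
  define P where "P j \<longleftrightarrow> j \<le> length u \<and> birth_time T (take j u) \<le> s" for j
  have "P 0" using s by (simp add: P_def)
  then have "P (Greatest P)" and max: "\<And>k. P k \<Longrightarrow> k \<le> Greatest P"
    by (rule GreatestI_nat[where b="length u"], simp add: P_def)
      (rule Greatest_le_nat[where b="length u"], simp_all add: P_def)
  then obtain j where j: "j \<le> length u" "birth_time T (take j u) \<le> s" and max: "\<And>k. P k \<Longrightarrow> k \<le> j"
    unfolding P_def by blast
  have "s < birth_time T (take j u) + T (take j u)"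
  proof (cases "j < length u")
    case True
    have "\<not> birth_time T (take (Suc j) u) \<le> s"
      using max[of "Suc j"] True by (auto simp: P_def)
    then show ?thesis using bt[OF True] by simp
  qed (use u' s j in auto)
  then show ?thesis using j born[of j] by (auto simp: alive_def)
qed

lemma measurable_lifetimes [measurable]: "(\<lambda>y. lifetimes y u) \<in> borel_measurable tree_space"
  unfolding lifetimes_def by measurable

lemma measurable_offspring [measurable]: "(\<lambda>y. offspring y u) \<in> measurable tree_space (count_space UNIV)"
  unfolding offspring_def by measurable

lemma measurable_subtree [measurable]: "subtree i \<in> measurable tree_space tree_space"
  unfolding subtree_def by (rule measurable_PiM_single') auto

lemma measurable_birth_time [measurable]: "(\<lambda>y. birth_time (lifetimes y) u) \<in> borel_measurable tree_space"
  unfolding birth_time_def by measurable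

lemma measurable_is_born [measurable]: "Measurable.pred tree_space (\<lambda>y. is_born (offspring y) u)"
  unfolding is_born_def by measurable

lemma pred_alive:
  assumes [measurable]: "\<tau> \<in> borel_measurable M" "Y \<in> measurable M tree_space"
  shows "Measurable.pred M (\<lambda>\<omega>. u \<in> alive (lifetimes (Y \<omega>)) (offspring (Y \<omega>)) (\<tau> \<omega>))"
proof -
  have [measurable]: "(\<lambda>\<omega>. lifetimes (Y \<omega>) u) \<in> borel_measurable M"
    by (rule measurable_compose[OF assms(2) measurable_lifetimes])
  have [measurable]: "(\<lambda>\<omega>. birth_time (lifetimes (Y \<omega>)) u) \<in> borel_measurable M"
    by (rule measurable_compose[OF assms(2) measurable_birth_time])
  have [measurable]: "Measurable.pred M (\<lambda>\<omega>. is_born (offspring (Y \<omega>)) u)"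
    by (rule measurable_compose[OF assms(2) measurable_is_born])
  show ?thesis
    unfolding alive_def mem_Collect_eq by measurable
qed

lemma pred_extinct_by:
  assumes "\<tau> \<in> borel_measurable M" "Y \<in> measurable M tree_space"
  shows "Measurable.pred M (\<lambda>\<omega>. extinct_by (\<tau> \<omega>) (Y \<omega>))"
proof -
  define P where "P u \<omega> \<longleftrightarrow> u \<in> alive (lifetimes (Y \<omega>)) (offspring (Y \<omega>)) (\<tau> \<omega>)" for u \<omega>
  have [measurable]: "Measurable.pred M (P u)" for u
    unfolding P_def by (rule pred_alive[OF assms])
  have "Measurable.pred M (\<lambda>\<omega>. \<forall>u. \<not> P u \<omega>)"
    by measurable
  moreover have "extinct_by (\<tau> \<omega>) (Y \<omega>) \<longleftrightarrow> (\<forall>u. \<not> P u \<omega>)" for \<omega>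
    by (auto simp: extinct_by_def P_def)
  ultimately show ?thesis by simp
qed

lemma finite_countable_iff: "finite (A :: 'a :: countable set) \<longleftrightarrow> (\<exists>n. \<forall>u. u \<in> A \<longrightarrow> to_nat u \<le> n)"
proof
  assume "finite A"
  then have "finite (to_nat ` A)" by simp
  then show "\<exists>n. \<forall>u. u \<in> A \<longrightarrow> to_nat u \<le> n"
    unfolding finite_nat_set_iff_bounded_le by blast
next
  assume "\<exists>n. \<forall>u. u \<in> A \<longrightarrow> to_nat u \<le> n"
  then have "finite (to_nat ` A)"
    unfolding finite_nat_set_iff_bounded_le by blast
  then show "finite A" by (rule finite_imageD) (rule inj_on_subset[OF inj_to_nat subset_UNIV])
qed

lemma pred_finite_countable:
  fixes A :: "'a \<Rightarrow> 'b :: countable set"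
  assumes "\<And>u. Measurable.pred M (\<lambda>\<omega>. u \<in> A \<omega>)"
  shows "Measurable.pred M (\<lambda>\<omega>. finite (A \<omega>))"
proof -
  define P where "P u \<omega> \<longleftrightarrow> u \<in> A \<omega>" for u \<omega>
  have [measurable]: "Measurable.pred M (P u)" for u
    unfolding P_def by (rule assms)
  have "Measurable.pred M (\<lambda>\<omega>. \<exists>n. \<forall>u. P u \<omega> \<longrightarrow> to_nat u \<le> n)"
    by measurable
  then show ?thesis by (simp add: finite_countable_iff P_def)
qed

lemma pred_finite_born_by:
  assumes [measurable]: "\<tau> \<in> borel_measurable M" "Y \<in> measurable M tree_space"
  shows "Measurable.pred M (\<lambda>\<omega>. finite (born_by (\<tau> \<omega>) (Y \<omega>)))"
proof (rule pred_finite_countable)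
  fix u
  have [measurable]: "(\<lambda>\<omega>. birth_time (lifetimes (Y \<omega>)) u) \<in> borel_measurable M"
    by (rule measurable_compose[OF assms(2) measurable_birth_time])
  have [measurable]: "Measurable.pred M (\<lambda>\<omega>. is_born (offspring (Y \<omega>)) u)"
    by (rule measurable_compose[OF assms(2) measurable_is_born])
  show "Measurable.pred M (\<lambda>\<omega>. u \<in> born_by (\<tau> \<omega>) (Y \<omega>))"
    unfolding born_by_def mem_Collect_eq by measurable
qed

lemma pred_finite_alive:
  assumes "\<tau> \<in> borel_measurable M" "Y \<in> measurable M tree_space"
  shows "Measurable.pred M (\<lambda>\<omega>. finite (alive (lifetimes (Y \<omega>)) (offspring (Y \<omega>)) (\<tau> \<omega>)))"
  by (intro pred_finite_countable pred_alive assms)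

lemma prob_space_coordinate_law: "0 < \<mu> \<Longrightarrow> prob_space (coordinate_law \<mu> p j)"
  unfolding coordinate_law_def
  by (cases j) (auto intro: prob_space_exponential_density measure_pmf.prob_space_distr)

lemma sets_coordinate_law [simp, measurable_cong]: "sets (coordinate_law \<mu> p j) = sets borel"
  by (cases j) (auto simp: coordinate_law_def)

lemma space_coordinate_law [simp]: "space (coordinate_law \<mu> p j) = UNIV"
  by (cases j) (auto simp: coordinate_law_def)

lemma sets_tree_law [measurable_cong]: "sets (tree_law \<mu> p) = sets tree_space"
  unfolding tree_law_def by (rule sets_PiM_cong) auto

lemma space_tree_law [simp]: "space (tree_law \<mu> p) = UNIV"
  by (simp add: tree_law_def space_PiM)

lemma space_tree_space [simp]: "space tree_space = UNIV"
  by (simp add: space_PiM)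

lemma prob_space_tree_law: "0 < \<mu> \<Longrightarrow> prob_space (tree_law \<mu> p)"
  unfolding tree_law_def by (intro prob_space_PiM prob_space_coordinate_law)

lemma tree_law_coordinate: "0 < \<mu> \<Longrightarrow> distr (tree_law \<mu> p) borel (\<lambda>y. y j) = coordinate_law \<mu> p j"
  using distr_PiM_component[of UNIV "coordinate_law \<mu> p" j]
  by (simp add: tree_law_def prob_space_coordinate_law cong: distr_cong)

text \<open>
  The addresses below a child are again all addresses, with the same laws attached to them.
\<close>

lemma tree_law_subtree: 
  assumes "0 < \<mu>"
  shows "distr (tree_law \<mu> p) tree_space (subtree i) = tree_law \<mu> p"
proof -
  define k where "k = (map_sum ((#) i) ((#) i) :: nat list + nat list \<Rightarrow> nat list + nat list)"
  have k: "inj k" unfolding k_def by (intro sum.inj_map) auto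
  have same: "coordinate_law \<mu> p (k j) = coordinate_law \<mu> p j" for j
    by (cases j) (auto simp: coordinate_law_def k_def)
  have "distr (tree_law \<mu> p) (tree_law \<mu> p) (subtree i) = tree_law \<mu> p"
    using distr_PiM_reindex[of UNIV "coordinate_law \<mu> p" k UNIV] k prob_space_coordinate_law[OF assms]
    unfolding tree_law_def same restrict_UNIV by (simp add: subtree_def[abs_def] k_def)
  moreover have "distr (tree_law \<mu> p) (tree_law \<mu> p) (subtree i) = distr (tree_law \<mu> p) tree_space (subtree i)"
    by (rule distr_cong) (auto simp: sets_tree_law)
  ultimately show ?thesis by simp
qed

lemma indep_coordinates:
  assumes "0 < \<mu>"
  shows "prob_space.indep_vars (tree_law \<mu> p) (\<lambda>_. borel) (\<lambda>j y. y j) UNIV"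
proof -
  interpret prob_space "tree_law \<mu> p" by (rule prob_space_tree_law[OF assms])
  have "distr (tree_law \<mu> p) tree_space (\<lambda>y. \<lambda>i\<in>UNIV. y i) = tree_law \<mu> p"
    unfolding restrict_UNIV by (rule distr_id2) (simp add: sets_tree_law)
  also have "\<dots> = (\<Pi>\<^sub>M j\<in>UNIV. distr (tree_law \<mu> p) borel (\<lambda>y. y j))"
    by (simp add: tree_law_coordinate[OF assms]) (simp add: tree_law_def)
  finally show ?thesis
    by (subst indep_vars_iff_distr_eq_PiM) auto
qed

section \<open>The branching property\<close>

text \<open>
  Used twice: for the children of the root and for the immigrants of one arrival.
\<close>

lemma (in prob_space) prob_random_intersection:
  assumes N: "random_variable (count_space UNIV) N" and E: "\<And>j. {\<omega> \<in> space M. E j \<omega>} \<in> events"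
    and ind: "\<And>n. prob {\<omega> \<in> space M. N \<omega> = n \<and> (\<forall>j<n. E j \<omega>)} = pmf h n * c ^ n"
    and c: "0 \<le> c" "c \<le> 1"
  shows "prob {\<omega> \<in> space M. \<forall>j<N \<omega>. E j \<omega>} = pgf h c"
proof -
  define A where "A n = {\<omega> \<in> space M. N \<omega> = n \<and> (\<forall>j<n. E j \<omega>)}" for n
  have [measurable]: "N \<in> measurable M (count_space UNIV)" "\<And>j. Measurable.pred M (E j)"
    using N E by (auto simp: pred_def)
  have "A n \<in> events" for n unfolding A_def by measurable
  then have "(\<lambda>n. prob (A n)) sums prob (\<Union>n. A n)"
    by (intro finite_measure_UNION) (auto simp: disjoint_family_on_def A_def)
  moreover have "(\<Union>n. A n) = {\<omega> \<in> space M. \<forall>j<N \<omega>. E j \<omega>}" by (auto simp: A_def)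
  moreover have "prob (A n) = pmf h n * c ^ n" for n using ind by (simp add: A_def)
  moreover have "(\<lambda>n. pmf h n * c ^ n) sums pgf h c"
  proof -
    have "integrable (count_space UNIV) (\<lambda>n. pmf h n * c ^ n)"
      using pgf_integrable[OF c, of h] by (subst (asm) measure_pmf_eq_density, subst (asm) integrable_density) auto
    then have "(\<lambda>n. pmf h n * c ^ n) sums (\<integral>n. pmf h n * c ^ n \<partial>count_space UNIV)"
      by (rule sums_integral_count_space_nat)
    also have "(\<integral>n. pmf h n * c ^ n \<partial>count_space UNIV) = pgf h c"
      unfolding pgf_def by (subst measure_pmf_eq_density, subst integral_density) auto
    finally show ?thesis .
  qed
  ultimately show ?thesis by (simp add: sums_unique2)
qed

text \<open>
  The coordinates split into the offspring number of the root and the disjoint blocks of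
  coordinates that belong to the subtrees of the possible children \<open>0, 1, 2, \<dots>\<close>.
\<close>

lemma prob_all_subtrees:
  assumes "0 < \<mu>" and E: "Measurable.pred tree_space E"
  shows "measure (tree_law \<mu> p) {y. \<forall>i<offspring y []. E (subtree i y)} = pgf p (measure (tree_law \<mu> p) {y. E y})"
proof -
  interpret prob_space "tree_law \<mu> p" by (rule prob_space_tree_law[OF assms(1)])
  note [measurable] = E
  define k where "k i = (map_sum ((#) i) ((#) i) :: nat list + nat list \<Rightarrow> nat list + nat list)" for i
  define K where "K = case_option {Inr []} (\<lambda>i. range (k i))"
  have K_simps: "K None = {Inr []}" "K (Some i) = range (k i)" for i by (auto simp: K_def)
  have kl: "k i (Inl u) = Inl (i # u)" "k i (Inr u) = Inr (i # u)" for i u by (auto simp: k_def)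
  have disj: "disjoint_family K"
    unfolding disjoint_family_on_def K_def
    by (auto simp: k_def map_sum_def split: option.splits sum.splits)
  have ind1: "indep_vars (\<lambda>j. PiM (K j) (\<lambda>_. borel)) (\<lambda>j y. restrict (\<lambda>i. y i) (K j)) UNIV"
    by (rule indep_vars_restrict[OF indep_coordinates[OF assms(1)]]) (use disj in auto)
  define H where "H = case_option (\<lambda>z. nat \<lfloor>z (Inr []) :: real\<rfloor>) (\<lambda>i z. of_bool (E (\<lambda>j. z (k i j))) :: nat)"
  have H_meas: "H j \<in> measurable (PiM (K j) (\<lambda>_. borel)) (count_space UNIV)" for j
  proof (cases j)
    case None
    have "(\<lambda>z. z (Inr [])) \<in> borel_measurable (PiM {Inr []} (\<lambda>_. borel))"
      by (rule measurable_component_singleton) simp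
    then show ?thesis by (simp add: H_def K_simps None)
  next
    case (Some i)
    have "(\<lambda>z j. z (k i j)) \<in> measurable (PiM (range (k i)) (\<lambda>_. borel)) tree_space"
      by (rule measurable_PiM_single') (auto intro!: measurable_component_singleton)
    from measurable_compose[OF this E] show ?thesis
      by (simp add: H_def K_simps Some)
  qed
  have ind: "indep_vars (\<lambda>_. count_space UNIV) (\<lambda>j y. H j (restrict (\<lambda>i. y i) (K j))) UNIV"
    by (rule indep_vars_compose2[OF ind1 H_meas])
  have H_None: "H None (restrict y (K None)) = offspring y []" for y
    by (simp add: H_def K_simps offspring_def)
  have H_Some: "H (Some i) (restrict y (K (Some i))) = of_bool (E (subtree i y))" for i y
    by (simp add: H_def K_simps subtree_def k_def)
  have E_sub: "Measurable.pred (tree_law \<mu> p) (\<lambda>y. E (subtree i y))" for i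
    using measurable_compose[OF measurable_subtree E] by (simp cong: measurable_cong_sets add: sets_tree_law)
  have N: "random_variable (count_space UNIV) (\<lambda>y. offspring y [])"
    using measurable_offspring by (simp cong: measurable_cong_sets add: sets_tree_law)
  have pN: "prob {y. offspring y [] = n} = pmf p n" for n
  proof -
    have "prob {y. offspring y [] = n} = measure (distr (tree_law \<mu> p) borel (\<lambda>y. y (Inr []))) {x. nat \<lfloor>x\<rfloor> = n}"
      by (subst measure_distr) (auto simp: offspring_def sets_tree_law cong: measurable_cong_sets intro!: measurable_component_singleton)
    also have "\<dots> = measure (distr (measure_pmf p) borel real) {x. nat \<lfloor>x\<rfloor> = n}"
      by (simp add: tree_law_coordinate[OF assms(1)] coordinate_law_def)
    also have "\<dots> = measure (measure_pmf p) {n}"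
      by (subst measure_distr) (auto simp: vimage_def)
    finally show ?thesis by (simp add: measure_pmf_single)
  qed
  have pE: "prob {y. E (subtree i y)} = prob {y. E y}" for i
  proof -
    have "prob {y. E (subtree i y)} = measure (distr (tree_law \<mu> p) tree_space (subtree i)) {y. E y}"
      using E by (subst measure_distr)
        (auto simp: sets_tree_law pred_def vimage_def cong: measurable_cong_sets intro!: measurable_subtree)
    then show ?thesis by (simp add: tree_law_subtree[OF assms(1)])
  qed
  have "prob {y \<in> space (tree_law \<mu> p). \<forall>i<offspring y []. E (subtree i y)} = pgf p (prob {y. E y})"
  proof (rule prob_random_intersection[OF N])
    show "{y \<in> space (tree_law \<mu> p). E (subtree i y)} \<in> events" for i
      using E_sub[of i] by (simp add: pred_def)
    fix n :: nat
    define J where "J = insert None (Some ` {..<n})"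
    define A where "A = case_option {n} (\<lambda>_ :: nat. {k :: nat. k \<noteq> 0})"
    have "prob (\<Inter>j\<in>J. (\<lambda>y. H j (restrict y (K j))) -` A j \<inter> space (tree_law \<mu> p))
      = (\<Prod>j\<in>J. prob ((\<lambda>y. H j (restrict y (K j))) -` A j \<inter> space (tree_law \<mu> p)))"
      by (rule indep_varsD[OF ind]) (auto simp: J_def)
    also have "(\<Inter>j\<in>J. (\<lambda>y. H j (restrict y (K j))) -` A j \<inter> space (tree_law \<mu> p)) =
        {y \<in> space (tree_law \<mu> p). offspring y [] = n \<and> (\<forall>j<n. E (subtree j y))}"
      by (auto simp: J_def A_def H_None H_Some)
    also have "(\<Prod>j\<in>J. prob ((\<lambda>y. H j (restrict y (K j))) -` A j \<inter> space (tree_law \<mu> p))) =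
        prob {y. offspring y [] = n} * (\<Prod>j<n. prob {y. E (subtree j y)})"
      unfolding J_def by (subst prod.insert) (auto simp: prod.reindex A_def H_None H_Some vimage_def)
    finally show "prob {y \<in> space (tree_law \<mu> p). offspring y [] = n \<and> (\<forall>j<n. E (subtree j y))} = pmf p n * prob {y. E y} ^ n"
      by (simp add: pN pE)
  qed auto
  then show ?thesis by simp
qed

lemma borel_measurable_pgf:
  assumes "e \<in> borel_measurable M" "\<And>x. 0 \<le> e x \<and> e x \<le> (1::real)"
  shows "(\<lambda>x. pgf p (e x)) \<in> borel_measurable M"
proof (rule measurable_compose[where f=e and g="pgf p"])
  show "e \<in> measurable M (restrict_space borel {0..1})"
    using assms by (intro measurable_restrict_space2) auto
  show "pgf p \<in> borel_measurable (restrict_space borel {0..1})"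
    by (rule borel_measurable_continuous_on_restrict[OF continuous_on_pgf])
qed

lemma set_integrable_bounded_Icc:
  fixes f :: "real \<Rightarrow> real"
  assumes "f \<in> borel_measurable borel" "\<And>x. x \<in> {a..b} \<Longrightarrow> \<bar>f x\<bar> \<le> B"
  shows "set_integrable lborel {a..b} f"
  unfolding set_integrable_def
  by (rule integrableI_bounded_set_indicator[where B=B]) (use assms in \<open>auto simp: emeasure_lborel_Icc_eq\<close>)

text \<open>
  Conditioning on the death time of the root, for an arbitrary property \<open>E\<close> of a tree and a time.
  The lifetime of the root is independent of the remaining coordinates, so Fubini's theorem turns
  the probability into an integral over that lifetime; for a fixed value of it, lemma
  \<open>prob_all_subtrees\<close> applies. A pair of independent variables has a common type of values, hence
  the lifetime is represented by the constant function \<open>first\<close>.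
\<close>

lemma branching_recursion:
  fixes p :: "nat pmf" and E :: "real \<Rightarrow> tree_data \<Rightarrow> bool"
  assumes "0 < \<mu>" and E: "Measurable.pred (borel \<Otimes>\<^sub>M tree_space) (\<lambda>x. E (fst x) (snd x))"
  defines "e \<equiv> \<lambda>s. measure (tree_law \<mu> p) {y. E s y}"
  shows "e \<in> borel_measurable borel"
    and "set_integrable lborel {0..t} (\<lambda>s. \<mu> * exp (- \<mu> * s) * pgf p (e (t - s)))"
    and "measure (tree_law \<mu> p) {y. lifetimes y [] \<le> t \<and> (\<forall>i<offspring y []. E (t - lifetimes y []) (subtree i y))}
      = (LINT s:{0..t}|lborel. \<mu> * exp (- \<mu> * s) * pgf p (e (t - s)))"
    and "{y. lifetimes y [] \<le> t \<and> (\<forall>i<offspring y []. E (t - lifetimes y []) (subtree i y))} \<in> sets (tree_law \<mu> p)"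
proof -
  interpret prob_space "tree_law \<mu> p" by (rule prob_space_tree_law[OF assms(1)])
  have e01: "0 \<le> e s \<and> e s \<le> 1" for s by (simp add: e_def)
  have E_s: "Measurable.pred tree_space (E s)" for s
    using measurable_compose[OF measurable_Pair1'[of s borel tree_space] E] by simp
  show e_meas: "e \<in> borel_measurable borel"
  proof -
    have "{x. E (fst x) (snd x)} \<in> sets (borel \<Otimes>\<^sub>M tree_law \<mu> p)"
      using E unfolding pred_def by (simp add: sets_pair_measure_cong[OF refl sets_tree_law] space_pair_measure)
    from measurable_emeasure_Pair[OF this]
    have "(\<lambda>s. enn2real (emeasure (tree_law \<mu> p) (Pair s -` {x. E (fst x) (snd x)}))) \<in> borel_measurable borel"
      by (rule borel_measurable_enn2real)
    then show ?thesis by (simp add: e_def measure_def vimage_def)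
  qed
  have pgf_meas: "(\<lambda>s. pgf p (e (t - s))) \<in> borel_measurable borel"
    by (rule borel_measurable_pgf) (use e01 in \<open>auto intro!: measurable_compose[OF _ e_meas]\<close>)
  define k where "k s = \<mu> * exp (- \<mu> * s) * pgf p (e (t - s))" for s
  have k_meas: "k \<in> borel_measurable borel"
    unfolding k_def using pgf_meas by measurable
  have k_nonneg: "0 \<le> k s" for s using assms(1) e01 by (auto simp: k_def intro!: mult_nonneg_nonneg pgf_nonneg)
  show k_int: "set_integrable lborel {0..t} (\<lambda>s. \<mu> * exp (- \<mu> * s) * pgf p (e (t - s)))"
    unfolding k_def[symmetric]
  proof (rule set_integrable_bounded_Icc[OF k_meas])
    fix s assume s: "s \<in> {0..t}"
    have "exp (- \<mu> * s) * pgf p (e (t - s)) \<le> 1 * 1"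
      using assms(1) s e01[of "t - s"] by (intro mult_mono pgf_le_1) (auto intro: pgf_nonneg)
    then have "\<mu> * (exp (- \<mu> * s) * pgf p (e (t - s))) \<le> \<mu> * 1" using assms(1) by (intro mult_left_mono) auto
    then show "\<bar>k s\<bar> \<le> \<mu>" using k_nonneg[of s] by (simp add: k_def mult.assoc)
  qed
  define rest where "rest y = y(Inl [] := 0)" for y :: tree_data
  have rest: "offspring (rest y) [] = offspring y []" "subtree i (rest y) = subtree i y" for y i
  proof -
    have "map_sum ((#) i) ((#) i) j \<noteq> Inl []" for j by (cases j) auto
    then show "offspring (rest y) [] = offspring y []" "subtree i (rest y) = subtree i y"
      by (auto simp: rest_def offspring_def subtree_def fun_eq_iff)
  qed
  define first where "first y = (\<lambda>j :: nat list + nat list. y (Inl []))" for y :: tree_data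
  have "indep_var tree_space ((\<lambda>z j. z (Inl [])) \<circ> (\<lambda>y. restrict (\<lambda>i. y i) {Inl []}))
     tree_space ((\<lambda>z j. if j = Inl [] then 0 else z j) \<circ> (\<lambda>y. restrict (\<lambda>i. y i) (- {Inl []})))"
  proof (rule indep_var_compose[OF indep_var_restrict[OF indep_coordinates[OF assms(1)]]])
    show "(\<lambda>z j. if j = Inl [] then 0 else z j) \<in> measurable (Pi\<^sub>M (- {Inl []}) (\<lambda>_. borel)) tree_space"
    proof (rule measurable_PiM_single')
      fix j :: "nat list + nat list"
      show "(\<lambda>z. if j = Inl [] then 0 else z j) \<in> borel_measurable (Pi\<^sub>M (- {Inl []}) (\<lambda>_. borel))"
        by (cases "j = Inl []") auto
    qed auto
    show "(\<lambda>z j. z (Inl [])) \<in> measurable (Pi\<^sub>M {Inl []} (\<lambda>_. borel)) tree_space"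
      by (rule measurable_PiM_single') (auto intro: measurable_component_singleton)
  qed auto
  moreover have "((\<lambda>z j. if j = Inl [] then 0 else z j) \<circ> (\<lambda>y. restrict (\<lambda>i. y i) (- {Inl []}))) = rest"
    by (simp add: rest_def fun_eq_iff restrict_def)
  moreover have "((\<lambda>z j. z (Inl [])) \<circ> (\<lambda>y. restrict (\<lambda>i. y i) {Inl []})) = first"
    by (simp add: first_def fun_eq_iff restrict_def)
  ultimately have ind: "indep_var tree_space first tree_space rest" by simp
  then have rv: "random_variable tree_space first" "random_variable tree_space rest"
    and joint: "distr (tree_law \<mu> p) tree_space first \<Otimes>\<^sub>M distr (tree_law \<mu> p) tree_space rest
      = distr (tree_law \<mu> p) (tree_space \<Otimes>\<^sub>M tree_space) (\<lambda>y. (first y, rest y))"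
    by (auto simp: indep_var_distribution_eq)
  have first: "lifetimes (first y) [] = lifetimes y []" for y
    by (simp add: first_def lifetimes_def)
  define S where "S = {x. lifetimes (fst x) [] \<le> t \<and>
    (\<forall>i<offspring (snd x) []. E (t - lifetimes (fst x) []) (subtree i (snd x)))}"
  have S: "S \<in> sets (tree_space \<Otimes>\<^sub>M tree_space)"
  proof -
    define P where "P i x \<longleftrightarrow> E (t - lifetimes (fst x) []) (subtree i (snd x))"
      for i and x :: "tree_data \<times> tree_data"
    have [measurable]: "(\<lambda>x. lifetimes (fst x) []) \<in> borel_measurable (tree_space \<Otimes>\<^sub>M tree_space)"
      by (rule measurable_compose[OF measurable_fst measurable_lifetimes])
    have [measurable]: "(\<lambda>x. subtree i (snd x)) \<in> measurable (tree_space \<Otimes>\<^sub>M tree_space) tree_space" for i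
      by (rule measurable_compose[OF measurable_snd measurable_subtree])
    have [measurable]: "Measurable.pred (tree_space \<Otimes>\<^sub>M tree_space) (P i)" for i
    proof -
      have "(\<lambda>x. (t - lifetimes (fst x) [], subtree i (snd x))) \<in> measurable (tree_space \<Otimes>\<^sub>M tree_space) (borel \<Otimes>\<^sub>M tree_space)"
        by measurable
      from measurable_compose[OF this E] show ?thesis by (simp add: P_def[abs_def])
    qed
    have [measurable]: "(\<lambda>x. offspring (snd x) []) \<in> measurable (tree_space \<Otimes>\<^sub>M tree_space) (count_space UNIV)"
      by (rule measurable_compose[OF measurable_snd measurable_offspring])
    have "Measurable.pred (tree_space \<Otimes>\<^sub>M tree_space) (\<lambda>x. lifetimes (fst x) [] \<le> t \<and> (\<forall>i. i < offspring (snd x) [] \<longrightarrow> P i x))"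
      by measurable
    then show ?thesis by (simp add: pred_def S_def P_def space_pair_measure)
  qed
  have event: "{y. lifetimes y [] \<le> t \<and> (\<forall>i<offspring y []. E (t - lifetimes y []) (subtree i y))}
    = (\<lambda>y. (first y, rest y)) -` S \<inter> space (tree_law \<mu> p)" (is "?ev = _")
    by (auto simp: S_def rest first)
  show ev_sets: "?ev \<in> sets (tree_law \<mu> p)"
    unfolding event using rv S by (intro measurable_sets[of _ _ "tree_space \<Otimes>\<^sub>M tree_space"] measurable_Pair) auto
  interpret R: prob_space "distr (tree_law \<mu> p) tree_space rest" by (rule prob_space_distr[OF rv(2)])
  have law_T: "distr (tree_law \<mu> p) borel (\<lambda>y. lifetimes y []) = density lborel (exponential_density \<mu>)"
    using tree_law_coordinate[OF assms(1), of p "Inl []"] by (simp add: lifetimes_def coordinate_law_def)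
  define b where "b s = ennreal (if s \<le> t then pgf p (e (t - s)) else 0)" for s
  have b_meas: "b \<in> borel_measurable borel"
    unfolding b_def using pgf_meas by measurable
  have rv_T: "random_variable borel (\<lambda>y. lifetimes y [])"
    using measurable_lifetimes[of "[]"] by (simp cong: measurable_cong_sets add: sets_tree_law)
  have section_law: "emeasure (distr (tree_law \<mu> p) tree_space rest) (Pair z -` S) = b (lifetimes z [])" for z
  proof -
    define s where "s = lifetimes z []"
    have "Pair z -` S \<in> sets tree_space" using S by (rule sets_Pair1)
    then have "emeasure (distr (tree_law \<mu> p) tree_space rest) (Pair z -` S) = emeasure (tree_law \<mu> p) (rest -` (Pair z -` S) \<inter> space (tree_law \<mu> p))"
      by (rule emeasure_distr[OF rv(2)])
    also have "rest -` (Pair z -` S) \<inter> space (tree_law \<mu> p) = (if s \<le> t then {y. \<forall>i<offspring y []. E (t - s) (subtree i y)} else {})"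
      by (auto simp: S_def rest s_def)
    also have "emeasure (tree_law \<mu> p) \<dots> = b s"
      using prob_all_subtrees[OF assms(1) E_s, of p "t - s"] by (auto simp: emeasure_eq_measure e_def b_def)
    finally show ?thesis by (simp add: s_def)
  qed
  have "emeasure (tree_law \<mu> p) ?ev = emeasure (distr (tree_law \<mu> p) (tree_space \<Otimes>\<^sub>M tree_space) (\<lambda>y. (first y, rest y))) S"
    unfolding event using rv S by (subst emeasure_distr) auto
  also have "\<dots> = (\<integral>\<^sup>+ z. emeasure (distr (tree_law \<mu> p) tree_space rest) (Pair z -` S) \<partial>distr (tree_law \<mu> p) tree_space first)"
    unfolding joint[symmetric] by (rule R.emeasure_pair_measure_alt) (use S in simp)
  also have "\<dots> = (\<integral>\<^sup>+ y. b (lifetimes y []) \<partial>tree_law \<mu> p)"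
    unfolding section_law using rv(1)
    by (subst nn_integral_distr) (auto simp: first intro!: measurable_compose[OF measurable_lifetimes b_meas])
  also have "\<dots> = (\<integral>\<^sup>+ s. b s \<partial>density lborel (exponential_density \<mu>))"
    unfolding law_T[symmetric] using b_meas by (subst nn_integral_distr[OF rv_T]) auto
  also have "\<dots> = (\<integral>\<^sup>+ s. ennreal (exponential_density \<mu> s) * ennreal (if s \<le> t then pgf p (e (t - s)) else 0) \<partial>lborel)"
    unfolding b_def[symmetric] using b_meas by (intro nn_integral_density) auto
  also have "\<dots> = (\<integral>\<^sup>+ s. ennreal (indicator {0..t} s * k s) \<partial>lborel)"
    using assms(1) e01
    by (intro nn_integral_cong)
      (auto simp: exponential_density_def k_def ennreal_mult[symmetric] pgf_nonneg indicator_def mult.commute)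
  also have "\<dots> = ennreal (LINT s|lborel. indicator {0..t} s * k s)"
    using k_int k_nonneg by (intro nn_integral_eq_integral) (auto simp: set_integrable_def k_def)
  also have "(LINT s|lborel. indicator {0..t} s * k s) = (LINT s:{0..t}|lborel. \<mu> * exp (- \<mu> * s) * pgf p (e (t - s)))"
    by (simp add: set_lebesgue_integral_def k_def)
  finally have "ennreal (measure (tree_law \<mu> p) ?ev) = ennreal (LINT s:{0..t}|lborel. \<mu> * exp (- \<mu> * s) * pgf p (e (t - s)))"
    by (simp add: emeasure_eq_measure)
  then show "measure (tree_law \<mu> p) ?ev = (LINT s:{0..t}|lborel. \<mu> * exp (- \<mu> * s) * pgf p (e (t - s)))"
    using set_integral_nonneg'[of "{0..t}" k lborel] k_nonneg
    by (simp add: ennreal_inj k_def)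
qed

section \<open>Extinction\<close>

definition extinction :: "real \<Rightarrow> nat pmf \<Rightarrow> real \<Rightarrow> real" where
  "extinction \<mu> p t = measure (tree_law \<mu> p) {y. extinct_by t y}"

lemma integral_exponential:
  fixes \<mu> t :: real
  assumes "0 < \<mu>" "0 \<le> t"
  shows "set_integrable lborel {0..t} (\<lambda>s. \<mu> * exp (- \<mu> * s))"
    and "(LINT s:{0..t}|lborel. \<mu> * exp (- \<mu> * s)) = 1 - exp (- \<mu> * t)"
proof -
  have "has_bochner_integral lborel (\<lambda>s. (\<mu> * exp (- \<mu> * s)) * indicator {0..t} s) (- exp (- \<mu> * t) - (- exp (- \<mu> * 0)))"
    using assms(2) by (intro has_bochner_integral_FTC_Icc_real[where F="\<lambda>s. - exp (- \<mu> * s)"]) (auto intro!: derivative_eq_intros continuous_intros)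
  moreover have "(\<lambda>s. (\<mu> * exp (- \<mu> * s)) * indicator {0..t} s) = (\<lambda>s. indicator {0..t} s *\<^sub>R (\<mu> * exp (- \<mu> * s)))"
    by (simp add: fun_eq_iff)
  ultimately have "has_bochner_integral lborel (\<lambda>s. indicator {0..t} s *\<^sub>R (\<mu> * exp (- \<mu> * s))) (1 - exp (- \<mu> * t))"
    by simp
  then show "set_integrable lborel {0..t} (\<lambda>s. \<mu> * exp (- \<mu> * s))"
    "(LINT s:{0..t}|lborel. \<mu> * exp (- \<mu> * s)) = 1 - exp (- \<mu> * t)"
    unfolding has_bochner_integral_iff set_integrable_def set_lebesgue_integral_def by blast+
qed

lemma AE_lifetimes_nonneg:
  assumes "0 < \<mu>" shows "AE y in tree_law \<mu> p. \<forall>v. 0 \<le> lifetimes y v"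
  unfolding AE_all_countable
proof
  fix v
  have "AE x in coordinate_law \<mu> p (Inl v). 0 \<le> x"
    unfolding coordinate_law_def sum.case by (subst AE_density) (auto simp: exponential_density_def)
  then show "AE y in tree_law \<mu> p. 0 \<le> lifetimes y v"
    unfolding tree_law_def lifetimes_def
    by (intro AE_PiM_component prob_space_coordinate_law assms) auto
qed

text \<open>
  Let \<open>e t\<close> be the probability that finitely many particles are born by time \<open>t\<close>. The recursion, \<open>f s \<ge> s\<close>
  and the monotonicity of \<open>e\<close> yield \<open>e t \<ge> exp (- \<mu> t) + (1 - exp (- \<mu> t)) * e t\<close>, that is \<open>e t \<ge> 1\<close>.
\<close>

lemma AE_finite_born_by:
  assumes "0 < \<mu>" and p: "critical p"
  shows "AE y in tree_law \<mu> p. \<forall>t. finite (born_by t y)"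
proof -
  interpret prob_space "tree_law \<mu> p" by (rule prob_space_tree_law[OF assms(1)])
  define E where "E t y \<longleftrightarrow> finite (born_by t y)" for t y
  define e where "e t = measure (tree_law \<mu> p) {y. E t y}" for t
  have E: "Measurable.pred (borel \<Otimes>\<^sub>M tree_space) (\<lambda>x. E (fst x) (snd x))"
    unfolding E_def by (intro pred_finite_born_by) auto
  note rec = branching_recursion[OF assms(1) E, where p=p, folded e_def]
  have E_sets: "{y. E t y} \<in> events" for t
  proof -
    have "Measurable.pred tree_space (\<lambda>y. finite (born_by t y))"
      by (rule pred_finite_born_by) simp_all
    from predE[OF this] show ?thesis unfolding E_def by (simp add: sets_tree_law)
  qed
  have E_antimono: "E s y" if "E t y" "s \<le> t" for s t y
  proof -
    have "born_by s y \<subseteq> born_by t y" using that(2) by (auto simp: born_by_def)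
    then show ?thesis using that(1) unfolding E_def by (rule finite_subset)
  qed
  have e_antimono: "e t \<le> e s" if "s \<le> t" for s t
    unfolding e_def by (intro finite_measure_mono E_sets) (auto intro: E_antimono[OF _ that])
  have e1: "e t = 1" if t: "0 \<le> t" for t
  proof -
    define B where "B = {y. lifetimes y [] \<le> t \<and> (\<forall>i<offspring y []. E (t - lifetimes y []) (subtree i y))}"
    \<comment> \<open>on \<open>C\<close> the root is the only particle born by time \<open>t\<close>, on \<open>B\<close> all subtrees are finite up to time \<open>t\<close>\<close>
    define C where "C = {y. t < lifetimes y []}"
    have C_sets: "C \<in> events"
    proof -
      have "Measurable.pred tree_space (\<lambda>y. t < lifetimes y [])" by measurable
      then show ?thesis by (simp add: C_def pred_def sets_tree_law)
    qed
    have pgf_ge: "e t \<le> pgf p (e (t - s))" if "s \<in> {0..t}" for s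
      using e_antimono[of "t - s" t] that critical_pgf_ge[OF p, of "e (t - s)"] by (simp add: e_def)
    have B_prob: "prob B = (LINT s:{0..t}|lborel. \<mu> * exp (- \<mu> * s) * pgf p (e (t - s)))"
      unfolding B_def by (rule rec(3))
    have "e t * (1 - exp (- \<mu> * t)) = (LINT s:{0..t}|lborel. \<mu> * exp (- \<mu> * s) * e t)"
      using integral_exponential[OF assms(1) t] by simp
    also have "\<dots> \<le> prob B"
      unfolding B_prob using assms(1) pgf_ge
      by (intro set_integral_mono rec(2) set_integrable_mult_left integral_exponential t mult_left_mono) auto
    finally have B_ge: "e t * (1 - exp (- \<mu> * t)) \<le> prob B" .
    have C_prob: "prob C = exp (- \<mu> * t)"
    proof -
      have "prob {y. lifetimes y [] \<le> t} = (LINT s:{0..t}|lborel. \<mu> * exp (- \<mu> * s))"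
        using branching_recursion(3)[OF assms(1), where E="\<lambda>_ _. True" and t=t and p=p] prob_space by (simp add: pgf_1)
      moreover have "prob C = 1 - prob {y. lifetimes y [] \<le> t}"
      proof -
        have "space (tree_law \<mu> p) - C = {y. lifetimes y [] \<le> t}" by (auto simp: C_def)
        then show ?thesis using prob_compl[OF C_sets] by simp
      qed
      ultimately show ?thesis using integral_exponential[OF assms(1) t] by simp
    qed
    have B_sets: "B \<in> events" unfolding B_def by (rule rec(4))
    have "prob (B \<union> C) = prob B + prob C"
      by (rule finite_measure_Union[OF B_sets C_sets]) (auto simp: B_def C_def)
    moreover have "prob (B \<union> C) \<le> e t"
      unfolding e_def
    proof (rule finite_measure_mono_AE[OF _ E_sets])
      show "AE y in tree_law \<mu> p. y \<in> B \<union> C \<longrightarrow> y \<in> {y. E t y}"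
        using AE_lifetimes_nonneg[OF assms(1), of p]
      proof eventually_elim
        case (elim y)
        show ?case
        proof
          assume "y \<in> B \<union> C"
          then show "y \<in> {y. E t y}"
            using finite_born_by_rec[of y t] finite_born_by_root[of y t] elim
            by (auto simp: B_def C_def E_def)
        qed
      qed
    qed
    ultimately have "e t * (1 - exp (- \<mu> * t)) + exp (- \<mu> * t) \<le> e t"
      using B_ge C_prob by simp
    then have "exp (- \<mu> * t) * 1 \<le> exp (- \<mu> * t) * e t" by (simp add: algebra_simps)
    then have "1 \<le> e t" by (simp only: mult_le_cancel_left_pos exp_gt_zero)
    then show ?thesis by (simp add: e_def order_antisym)
  qed
  have "AE y in tree_law \<mu> p. \<forall>n::nat. E (real n) y"
    unfolding AE_all_countable
  proof
    fix n :: nat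
    have "AE y in tree_law \<mu> p. y \<in> {y. E (real n) y}"
      using AE_in_set_eq_1[OF E_sets[of "real n"]] e1[of "real n"] by (simp add: e_def)
    then show "AE y in tree_law \<mu> p. E (real n) y" by simp
  qed
  then show ?thesis
  proof eventually_elim
    case (elim y)
    show ?case
    proof
      fix t
      obtain n :: nat where "t \<le> real n" using real_arch_simple by blast
      then show "finite (born_by t y)" using E_antimono[of "real n" y t] elim by (simp add: E_def)
    qed
  qed
qed

lemma pred_extinct_by_pair:
  "Measurable.pred (borel \<Otimes>\<^sub>M tree_space) (\<lambda>x. extinct_by (fst x) (snd x))"
  by (intro pred_extinct_by) auto

lemma extinct_by_sets: "{y. extinct_by t y} \<in> sets (tree_law \<mu> p)"
proof -
  have "Measurable.pred tree_space (\<lambda>y. extinct_by t y)"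
    by (rule pred_extinct_by) simp_all
  from predE[OF this] show ?thesis by (simp add: sets_tree_law)
qed

lemma extinct_by_mono:
  assumes "extinct_by s y" "0 \<le> s" "s \<le> t" shows "extinct_by t y"
  using alive_ancestor[of _ "lifetimes y" "offspring y" t s] assms by (auto simp: extinct_by_def)

context
  fixes \<mu> :: real and p :: "nat pmf"
  assumes \<mu>: "0 < \<mu>"
begin

interpretation prob_space "tree_law \<mu> p" by (rule prob_space_tree_law[OF \<mu>])

lemma extinction_measurable: "extinction \<mu> p \<in> borel_measurable borel"
  using branching_recursion(1)[OF \<mu> pred_extinct_by_pair, of p] by (simp add: extinction_def[abs_def])

lemma extinction_01: "0 \<le> extinction \<mu> p t" "extinction \<mu> p t \<le> 1"
  by (simp_all add: extinction_def)

lemma extinction_mono: "0 \<le> s \<Longrightarrow> s \<le> t \<Longrightarrow> extinction \<mu> p s \<le> extinction \<mu> p t"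
  unfolding extinction_def by (intro finite_measure_mono extinct_by_sets) (auto intro: extinct_by_mono)

lemma extinction_integral_equation:
  assumes "0 \<le> t"
  shows "extinction \<mu> p t = (LINT s:{0..t}|lborel. \<mu> * exp (- \<mu> * s) * pgf p (extinction \<mu> p (t - s)))"
  using branching_recursion(3)[OF \<mu> pred_extinct_by_pair, where p=p and t=t] extinct_by_rec[OF assms]
  by (simp add: extinction_def)

lemma extinction_0: "extinction \<mu> p 0 = 0"
  using extinction_integral_equation[of 0] by (simp add: set_integral_at_point)

lemma extinction_less_1:
  assumes "0 \<le> t" shows "extinction \<mu> p t < 1"
proof -
  have "extinction \<mu> p t \<le> (LINT s:{0..t}|lborel. \<mu> * exp (- \<mu> * s) * 1)"
    unfolding extinction_integral_equation[OF assms]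
    by (intro set_integral_mono branching_recursion(2)[OF \<mu> pred_extinct_by_pair, where p=p and t=t, folded extinction_def]
         mult_left_mono pgf_le_1 extinction_01) (use \<mu> integral_exponential[OF \<mu> assms] in auto)
  also have "\<dots> = 1 - exp (- \<mu> * t)" using integral_exponential[OF \<mu> assms] by simp
  finally show ?thesis by (rule le_less_trans) simp
qed

text \<open>
  The substitution \<open>v = t - s\<close> turns the integral equation into \<open>F t = exp (- \<mu> t) * \<integral>\<^sub>0\<^sup>t k\<close> with
  \<open>k v = \<mu> * exp (\<mu> v) * f (F v)\<close>. The right-hand side is continuous in \<open>t\<close>, hence so are \<open>F\<close> and
  \<open>k\<close>, and it can be differentiated.
\<close>

lemma extinction_ode:
  assumes t: "0 \<le> t"
  shows "(extinction \<mu> p has_real_derivative \<mu> * (pgf p (extinction \<mu> p t) - extinction \<mu> p t)) (at t within {0..})"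
proof -
  define F where "F = extinction \<mu> p"
  define b where "b = t + 1"
  define k where "k v = \<mu> * exp (\<mu> * v) * pgf p (F v)" for v
  have F01: "0 \<le> F v \<and> F v \<le> 1" for v using extinction_01 by (simp add: F_def)
  have k_meas: "k \<in> borel_measurable borel"
  proof -
    have "(\<lambda>v. pgf p (F v)) \<in> borel_measurable borel"
      by (rule borel_measurable_pgf) (use F01 extinction_measurable in \<open>auto simp: F_def\<close>)
    then show ?thesis unfolding k_def by measurable
  qed
  have k_int: "set_integrable lborel {0..s} k" for s
  proof (rule set_integrable_bounded_Icc[OF k_meas])
    fix v assume v: "v \<in> {0..s}"
    have "exp (\<mu> * v) * pgf p (F v) \<le> exp (\<mu> * s) * 1"
      using v \<mu> F01 by (intro mult_mono pgf_le_1) (auto intro: pgf_nonneg)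
    then have "\<mu> * (exp (\<mu> * v) * pgf p (F v)) \<le> \<mu> * (exp (\<mu> * s) * 1)" using \<mu> by (intro mult_left_mono) auto
    moreover have "0 \<le> k v" using \<mu> F01 by (auto simp: k_def intro!: mult_nonneg_nonneg pgf_nonneg)
    ultimately show "\<bar>k v\<bar> \<le> \<mu> * exp (\<mu> * s)" by (simp add: k_def mult.assoc)
  qed
  have k_hk: "k integrable_on {0..s}" "(LINT v:{0..s}|lborel. k v) = integral {0..s} k" for s
    using set_borel_integral_eq_integral[OF k_int[of s]] by auto
  have F_eq: "F s = exp (- \<mu> * s) * integral {0..s} k" if "0 \<le> s" for s
  proof -
    have "F s = (LINT u:{0..s}|lborel. exp (- \<mu> * s) * k (s - u))"
      unfolding F_def extinction_integral_equation[OF that]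
      by (intro set_lebesgue_integral_cong) (auto simp: k_def F_def exp_add[symmetric] algebra_simps)
    also have "\<dots> = exp (- \<mu> * s) * (LINT u:{0..s}|lborel. k (s - u))" by simp
    also have "(LINT u:{0..s}|lborel. k (s - u)) = integral {0..s} k"
      using set_integral_reflect(2)[OF k_int[of s]] k_hk by simp
    finally show ?thesis .
  qed
  have "continuous_on {0..b} (\<lambda>s. exp (- \<mu> * s) * integral {0..s} k)"
    by (intro continuous_intros indefinite_integral_continuous_1 k_hk)
  then have F_cont: "continuous_on {0..b} F"
    by (rule continuous_on_cong[THEN iffD1, rotated -1]) (auto simp: F_eq)
  have "continuous_on {0..b} k"
    unfolding k_def
    by (intro continuous_intros continuous_on_compose2[OF continuous_on_pgf F_cont]) (use F01 in auto)
  then have K: "((\<lambda>s. integral {0..s} k) has_real_derivative k t) (at t within {0..b})"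
    using t by (intro integral_has_real_derivative) (auto simp: b_def)
  have "((\<lambda>s. exp (- \<mu> * s) * integral {0..s} k) has_real_derivative
      exp (- \<mu> * t) * k t - \<mu> * (exp (- \<mu> * t) * integral {0..t} k)) (at t within {0..b})"
    by (auto intro!: derivative_eq_intros K simp: algebra_simps)
  also have "exp (- \<mu> * t) * k t = \<mu> * pgf p (F t)" by (simp add: k_def exp_minus field_simps)
  also have "exp (- \<mu> * t) * integral {0..t} k = F t" using F_eq[OF t] by simp
  finally have D: "((\<lambda>s. exp (- \<mu> * s) * integral {0..s} k) has_real_derivative \<mu> * (pgf p (F t) - F t)) (at t within {0..b})"
    by (simp add: right_diff_distrib)
  have "(F has_real_derivative \<mu> * (pgf p (F t) - F t)) (at t within {0..b})"
    by (rule has_field_derivative_transform_within[OF D zero_less_one]) (use t F_eq in \<open>auto simp: b_def\<close>)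
  moreover have "at t within {0..b} = at t within {0..}"
    by (rule at_within_nhd[of _ "{..<b}"]) (auto simp: b_def)
  ultimately show ?thesis by (simp add: F_def)
qed

lemma extinction_continuous: "continuous_on {0..} (extinction \<mu> p)"
  using extinction_ode by (intro DERIV_continuous_on) auto

end

text \<open>
  Independence of the family of all lifetimes and offspring numbers says precisely that their joint
  law is the product law of trees.
\<close>

lemma markov_branching_process_tree:
  assumes "markov_branching_process N \<mu> p Z"
  obtains Y where "Y \<in> measurable N tree_space" "distr N tree_space Y = tree_law \<mu> p"
    "\<forall>t\<ge>0. \<forall>\<omega>\<in>space N. Z t \<omega> = card (alive (lifetimes (Y \<omega>)) (offspring (Y \<omega>)) t)"
proof -
  from assms obtain T X where N: "prob_space N"
    and ind: "prob_space.indep_vars N (\<lambda>_. borel) (case_sum T (\<lambda>u \<omega>. real (X u \<omega>))) UNIV"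
    and T: "\<And>u. distributed N lborel (T u) (exponential_density \<mu>)"
    and X: "\<And>u. distr N (count_space UNIV) (X u) = measure_pmf p"
    and Z: "\<And>t \<omega>. 0 \<le> t \<Longrightarrow> \<omega> \<in> space N \<Longrightarrow> Z t \<omega> = card (alive (\<lambda>u. T u \<omega>) (\<lambda>u. X u \<omega>) t)"
    unfolding markov_branching_process_def by blast
  interpret prob_space N by (rule N)
  define V where "V = case_sum T (\<lambda>u \<omega>. real (X u \<omega>))"
  define Y where "Y \<omega> = (\<lambda>j. V j \<omega>)" for \<omega>
  have V_meas: "V j \<in> borel_measurable N" for j
    using ind by (auto simp: indep_vars_def V_def)
  have Y_meas: "Y \<in> measurable N tree_space"
    unfolding Y_def by (rule measurable_PiM_single') (use V_meas in auto)
  have X_meas: "X u \<in> measurable N (count_space UNIV)" for u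
  proof -
    have "(\<lambda>\<omega>. nat \<lfloor>V (Inr u) \<omega>\<rfloor>) \<in> measurable N (count_space UNIV)"
      using V_meas[of "Inr u"] by measurable
    then show ?thesis by (simp add: V_def)
  qed
  have V_law: "distr N borel (V j) = coordinate_law \<mu> p j" for j
  proof (cases j)
    case (Inl u)
    have "distr N borel (T u) = distr N lborel (T u)" by (rule distr_cong) auto
    then show ?thesis using T[of u] by (simp add: Inl V_def coordinate_law_def distributed_def)
  next
    case (Inr u)
    have "distr N borel (\<lambda>\<omega>. real (X u \<omega>)) = distr (distr N (count_space UNIV) (X u)) borel real"
      using X_meas[of u] by (subst distr_distr) (auto simp: comp_def)
    then show ?thesis by (simp add: Inr V_def coordinate_law_def X)
  qed
  have "distr N tree_space (\<lambda>\<omega>. \<lambda>j\<in>UNIV. V j \<omega>) = (\<Pi>\<^sub>M j\<in>UNIV. distr N borel (V j))"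
    using ind V_meas unfolding V_def[symmetric] by (subst (asm) indep_vars_iff_distr_eq_PiM) auto
  then have law: "distr N tree_space Y = tree_law \<mu> p"
    unfolding restrict_UNIV Y_def[abs_def] V_law tree_law_def by simp
  have "lifetimes (Y \<omega>) = (\<lambda>u. T u \<omega>)" "offspring (Y \<omega>) = (\<lambda>u. X u \<omega>)" for \<omega>
    by (auto simp: lifetimes_def offspring_def Y_def V_def)
  with Z show ?thesis by (intro that[OF Y_meas law]) auto
qed

lemma tree_law_AE_transfer:
  assumes "Y \<in> measurable N tree_space" "distr N tree_space Y = tree_law \<mu> p" "AE y in tree_law \<mu> p. P y"
  shows "AE \<omega> in N. P (Y \<omega>)"
proof -
  have "AE y in distr N tree_space Y. P y" unfolding assms(2) by (rule assms(3))
  then show ?thesis by (rule AE_distrD[OF assms(1)])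
qed

text \<open>
  The population size is the cardinality of the set of living particles, which is 0 also for an infinite
  set. Almost surely this does not occur at any time.
\<close>

lemma markov_branching_process_extinct_iff:
  assumes "0 < \<mu>" "critical p" and Y: "Y \<in> measurable N tree_space" "distr N tree_space Y = tree_law \<mu> p"
    and Z: "\<forall>t\<ge>0. \<forall>\<omega>\<in>space N. Z t \<omega> = card (alive (lifetimes (Y \<omega>)) (offspring (Y \<omega>)) t)"
  shows "AE \<omega> in N. \<forall>t\<ge>0. Z t \<omega> = 0 \<longleftrightarrow> extinct_by t (Y \<omega>)"
proof -
  have "AE \<omega> in N. \<forall>t. finite (born_by t (Y \<omega>))"
    by (rule tree_law_AE_transfer[OF Y AE_finite_born_by[OF assms(1,2)]])
  with AE_space show ?thesis
  proof eventually_elim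
    case (elim \<omega>)
    have "finite (alive (lifetimes (Y \<omega>)) (offspring (Y \<omega>)) t)" for t
      using finite_subset[OF alive_subset_born_by] elim(2) by blast
    then show ?case using Z elim(1) by (auto simp: extinct_by_def)
  qed
qed

lemma markov_branching_process_absorbed:
  assumes "0 < \<mu>" "critical p" "markov_branching_process N \<mu> p Z"
  shows "AE \<omega> in N. \<forall>s t. 0 \<le> s \<longrightarrow> s \<le> t \<longrightarrow> Z s \<omega> = 0 \<longrightarrow> Z t \<omega> = 0"
proof -
  obtain Y where Y: "Y \<in> measurable N tree_space" "distr N tree_space Y = tree_law \<mu> p"
    and Z: "\<forall>t\<ge>0. \<forall>\<omega>\<in>space N. Z t \<omega> = card (alive (lifetimes (Y \<omega>)) (offspring (Y \<omega>)) t)"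
    using markov_branching_process_tree[OF assms(3)] by blast
  from markov_branching_process_extinct_iff[OF assms(1,2) Y Z]
  show ?thesis
  proof eventually_elim
    case (elim \<omega>)
    then show ?case using extinct_by_mono by (meson order_trans)
  qed
qed

text \<open>
  A random time is allowed because the jump points of the Poisson process are inserted later. Infinite
  populations have cardinality 0, so the event is the union of extinction and infinite population.
\<close>

lemma markov_branching_process_extinct_measurable:
  assumes "markov_branching_process N \<mu> p Z"
    and \<tau>: "\<tau> \<in> borel_measurable N" "\<And>\<omega>. \<omega> \<in> space N \<Longrightarrow> 0 \<le> \<tau> \<omega>"
  shows "{\<omega> \<in> space N. Z (\<tau> \<omega>) \<omega> = 0} \<in> sets N"
proof -
  obtain Y where Y: "Y \<in> measurable N tree_space"
    and Z: "\<forall>t\<ge>0. \<forall>\<omega>\<in>space N. Z t \<omega> = card (alive (lifetimes (Y \<omega>)) (offspring (Y \<omega>)) t)"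
    using markov_branching_process_tree[OF assms(1)] by blast
  have "{\<omega> \<in> space N. Z (\<tau> \<omega>) \<omega> = 0} = {\<omega> \<in> space N. extinct_by (\<tau> \<omega>) (Y \<omega>)} \<union>
      (space N - {\<omega> \<in> space N. finite (alive (lifetimes (Y \<omega>)) (offspring (Y \<omega>)) (\<tau> \<omega>))})"
    using Z \<tau>(2) by (auto simp: extinct_by_def card_eq_0_iff card_gt_0_iff)
  also have "\<dots> \<in> sets N"
    by (intro sets.Un sets.Diff sets.top predE[OF pred_extinct_by[OF \<tau>(1) Y]] predE[OF pred_finite_alive[OF \<tau>(1) Y]])
  finally show ?thesis .
qed

lemma markov_branching_process_extinct_prob:
  assumes "0 < \<mu>" "critical p" "markov_branching_process N \<mu> p Z" "0 \<le> t"
  shows "measure N {\<omega> \<in> space N. Z t \<omega> = 0} = extinction \<mu> p t"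
proof -
  obtain Y where Y: "Y \<in> measurable N tree_space" "distr N tree_space Y = tree_law \<mu> p"
    and Z: "\<forall>t\<ge>0. \<forall>\<omega>\<in>space N. Z t \<omega> = card (alive (lifetimes (Y \<omega>)) (offspring (Y \<omega>)) t)"
    using markov_branching_process_tree[OF assms(3)] by blast
  interpret prob_space N using assms(3) by (simp add: markov_branching_process_def)
  have "AE \<omega> in N. Z t \<omega> = 0 \<longleftrightarrow> extinct_by t (Y \<omega>)"
    using markov_branching_process_extinct_iff[OF assms(1,2) Y Z] assms(4) by auto
  moreover have "{\<omega> \<in> space N. extinct_by t (Y \<omega>)} \<in> events"
    by (rule predE[OF pred_extinct_by[OF _ Y(1)]]) simp
  moreover have "{\<omega> \<in> space N. Z t \<omega> = 0} \<in> events"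
    using markov_branching_process_extinct_measurable[OF assms(3), of "\<lambda>_. t"] assms(4) by simp
  ultimately have "prob {\<omega> \<in> space N. Z t \<omega> = 0} = prob {\<omega> \<in> space N. extinct_by t (Y \<omega>)}"
    by (intro measure_eq_AE) auto
  also have "\<dots> = measure (distr N tree_space Y) {y. extinct_by t y}"
    using Y(1) extinct_by_sets[of t \<mu> p] by (subst measure_distr) (auto simp: sets_tree_law intro!: arg_cong[of _ _ prob])
  finally show ?thesis by (simp add: Y(2) extinction_def)
qed

section \<open>Poisson processes\<close>

lemma nn_integral_countable_valued:
  fixes V :: "'a \<Rightarrow> 'v :: countable"
  assumes V: "V \<in> measurable M (count_space UNIV)"
  shows "(\<integral>\<^sup>+ \<omega>. c (V \<omega>) \<partial>M) = (\<integral>\<^sup>+ v. emeasure M {\<omega> \<in> space M. V \<omega> = v} * c v \<partial>count_space UNIV)"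
proof -
  have pt: "emeasure (distr M (count_space UNIV) V) {v} = emeasure M {\<omega> \<in> space M. V \<omega> = v}" for v
    using V by (subst emeasure_distr) (auto intro!: arg_cong[where f="emeasure M"])
  have "distr M (count_space UNIV) V = density (count_space UNIV) (\<lambda>v. emeasure M {\<omega> \<in> space M. V \<omega> = v})"
  proof (rule measure_eqI_countable[where A=UNIV])
    fix v :: 'v
    show "emeasure (distr M (count_space UNIV) V) {v}
      = emeasure (density (count_space UNIV) (\<lambda>v. emeasure M {\<omega> \<in> space M. V \<omega> = v})) {v}"
      unfolding pt by (subst emeasure_density) (auto simp: nn_integral_count_space_indicator[symmetric])
  qed auto
  then have "(\<integral>\<^sup>+ v. c v \<partial>distr M (count_space UNIV) V) = (\<integral>\<^sup>+ v. emeasure M {\<omega> \<in> space M. V \<omega> = v} * c v \<partial>count_space UNIV)"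
    by (simp add: nn_integral_density)
  then show ?thesis using V by (simp add: nn_integral_distr)
qed

text \<open>
  A conditional probability given a discrete variable \<open>V\<close>, computed value by value: \<open>c v\<close> is the
  conditional probability of \<open>A\<close> given \<open>V = v\<close>.
\<close>

lemma (in prob_space) emeasure_disintegrate_countable:
  fixes V :: "'a \<Rightarrow> 'v :: countable"
  assumes V: "V \<in> measurable M (count_space UNIV)" and A: "A \<in> events"
    and c: "\<And>v. prob {\<omega> \<in> A. V \<omega> = v} = prob {\<omega> \<in> space M. V \<omega> = v} * c v" "\<And>v. 0 \<le> c v"
  shows "emeasure M A = (\<integral>\<^sup>+ \<omega>. ennreal (c (V \<omega>)) \<partial>M)"
proof -
  have [measurable]: "V \<in> measurable M (count_space UNIV)" by (rule V)
  have sub: "A \<subseteq> space M" using A by (rule sets.sets_into_space)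
  have sets: "{\<omega> \<in> A. V \<omega> = v} \<in> events" for v
  proof -
    have "{\<omega> \<in> space M. V \<omega> = v} \<in> events" by measurable
    then have "A \<inter> {\<omega> \<in> space M. V \<omega> = v} \<in> events" using A by auto
    moreover have "A \<inter> {\<omega> \<in> space M. V \<omega> = v} = {\<omega> \<in> A. V \<omega> = v}" using sub by auto
    ultimately show ?thesis by simp
  qed
  have "A = (\<Union>v\<in>UNIV. {\<omega> \<in> A. V \<omega> = v})" by auto
  also have "emeasure M \<dots> = (\<integral>\<^sup>+ v. emeasure M {\<omega> \<in> A. V \<omega> = v} \<partial>count_space UNIV)"
    using sets by (intro emeasure_UN_countable) (auto simp: disjoint_family_on_def)
  also have "\<dots> = (\<integral>\<^sup>+ v. emeasure M {\<omega> \<in> space M. V \<omega> = v} * ennreal (c v) \<partial>count_space UNIV)"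
    by (intro nn_integral_cong) (simp add: emeasure_eq_measure c ennreal_mult)
  also have "\<dots> = (\<integral>\<^sup>+ \<omega>. ennreal (c (V \<omega>)) \<partial>M)"
    by (rule nn_integral_countable_valued[OF V, symmetric])
  finally show ?thesis .
qed

lemma poisson_processD:
  assumes "poisson_process M r \<nu>"
  shows "prob_space M" "\<And>t. 0 < t \<Longrightarrow> 0 \<le> r t" "\<And>t. 0 \<le> t \<Longrightarrow> set_integrable lborel {0..t} r"
    "\<And>t. 0 \<le> t \<Longrightarrow> \<nu> t \<in> measurable M (count_space UNIV)"
    "\<And>\<omega>. \<omega> \<in> space M \<Longrightarrow> \<nu> 0 \<omega> = 0"
    "\<And>s t \<omega>. \<omega> \<in> space M \<Longrightarrow> 0 \<le> s \<Longrightarrow> s \<le> t \<Longrightarrow> \<nu> s \<omega> \<le> \<nu> t \<omega>"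
    "\<And>\<tau> :: nat \<Rightarrow> real. 0 \<le> \<tau> 0 \<Longrightarrow> mono \<tau> \<Longrightarrow>
        prob_space.indep_vars M (\<lambda>_. count_space UNIV) (\<lambda>i \<omega>. \<nu> (\<tau> (Suc i)) \<omega> - \<nu> (\<tau> i) \<omega>) UNIV"
    "\<And>s t n. 0 \<le> s \<Longrightarrow> s \<le> t \<Longrightarrow>
        measure M {\<omega> \<in> space M. \<nu> t \<omega> - \<nu> s \<omega> = n} =
          (mean_measure r t - mean_measure r s) ^ n / fact n * exp (- (mean_measure r t - mean_measure r s))"
  using assms unfolding poisson_process_def mono_on_def by auto

lemma mean_measure_diff:
  assumes P: "poisson_process M r \<nu>" and st: "0 \<le> s" "s \<le> t"
  shows "mean_measure r t - mean_measure r s = (LINT u:{s<..t}|lborel. r u)"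
    and "0 \<le> mean_measure r t - mean_measure r s"
proof -
  show "mean_measure r t - mean_measure r s = (LINT u:{s<..t}|lborel. r u)"
    using set_integral_Icc_split[OF poisson_processD(3)[OF P], of t s] st by (simp add: mean_measure_def)
  also have "0 \<le> \<dots>" using st by (intro set_integral_nonneg' poisson_processD(2)[OF P]) auto
  finally show "0 \<le> mean_measure r t - mean_measure r s" .
qed

lemma poisson_increment_pgf:
  assumes P: "poisson_process M r \<nu>" and st: "0 \<le> s" "s \<le> t" and a: "0 \<le> a"
  shows "(\<integral>\<^sup>+ \<omega>. ennreal (a ^ (\<nu> t \<omega> - \<nu> s \<omega>)) \<partial>M)
    = ennreal (exp (- ((mean_measure r t - mean_measure r s) * (1 - a))))"
proof -
  interpret prob_space M by (rule poisson_processD(1)[OF P])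
  define b where "b = mean_measure r t - mean_measure r s"
  have b: "0 \<le> b" unfolding b_def by (rule mean_measure_diff(2)[OF P st])
  have [measurable]: "\<nu> t \<in> measurable M (count_space UNIV)" "\<nu> s \<in> measurable M (count_space UNIV)"
    using poisson_processD(4)[OF P] st by auto
  have N: "(\<lambda>\<omega>. \<nu> t \<omega> - \<nu> s \<omega>) \<in> measurable M (count_space UNIV)" by measurable
  have "(\<integral>\<^sup>+ \<omega>. ennreal (a ^ (\<nu> t \<omega> - \<nu> s \<omega>)) \<partial>M)
    = (\<integral>\<^sup>+ n. emeasure M {\<omega> \<in> space M. \<nu> t \<omega> - \<nu> s \<omega> = n} * ennreal (a ^ n) \<partial>count_space UNIV)"
    by (rule nn_integral_countable_valued[OF N])
  also have "\<dots> = (\<Sum>n. emeasure M {\<omega> \<in> space M. \<nu> t \<omega> - \<nu> s \<omega> = n} * ennreal (a ^ n))"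
    by (rule nn_integral_count_space_nat)
  also have "\<dots> = (\<Sum>n. ennreal (exp (- b) * ((b * a) ^ n /\<^sub>R fact n)))"
    using poisson_processD(8)[OF P st] a b
    by (intro suminf_cong) (simp add: emeasure_eq_measure b_def[symmetric] ennreal_mult[symmetric] power_mult_distrib field_simps)
  also have "\<dots> = ennreal (\<Sum>n. exp (- b) * ((b * a) ^ n /\<^sub>R fact n))"
    using a b by (intro suminf_ennreal2 summable_mult summable_exp_generic) auto
  also have "(\<Sum>n. exp (- b) * ((b * a) ^ n /\<^sub>R fact n)) = exp (- b) * exp (b * a)"
    unfolding exp_def by (rule suminf_mult[OF summable_exp_generic])
  also have "\<dots> = exp (- (b * (1 - a)))" by (simp add: exp_add[symmetric] algebra_simps)
  finally show ?thesis by (simp add: b_def)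
qed

lemma poisson_increments_pgf:
  fixes \<tau> a :: "nat \<Rightarrow> real"
  assumes P: "poisson_process M r \<nu>" and \<tau>: "0 \<le> \<tau> 0" "mono \<tau>" and a: "\<And>i. 0 \<le> a i"
  shows "(\<integral>\<^sup>+ \<omega>. ennreal (\<Prod>i<n. a i ^ (\<nu> (\<tau> (Suc i)) \<omega> - \<nu> (\<tau> i) \<omega>)) \<partial>M)
    = ennreal (exp (- (\<Sum>i<n. (mean_measure r (\<tau> (Suc i)) - mean_measure r (\<tau> i)) * (1 - a i))))"
proof -
  interpret prob_space M by (rule poisson_processD(1)[OF P])
  have pos: "0 \<le> \<tau> i" for i using \<tau> by (meson monoD order_trans le0)
  have "indep_vars (\<lambda>_. count_space UNIV) (\<lambda>i \<omega>. \<nu> (\<tau> (Suc i)) \<omega> - \<nu> (\<tau> i) \<omega>) {..<n}"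
    by (rule indep_vars_subset[OF poisson_processD(7)[OF P \<tau>]]) simp
  then have ind: "indep_vars (\<lambda>_. borel) (\<lambda>i \<omega>. ennreal (a i ^ (\<nu> (\<tau> (Suc i)) \<omega> - \<nu> (\<tau> i) \<omega>))) {..<n}"
    by (rule indep_vars_compose2) simp
  have "(\<integral>\<^sup>+ \<omega>. ennreal (\<Prod>i<n. a i ^ (\<nu> (\<tau> (Suc i)) \<omega> - \<nu> (\<tau> i) \<omega>)) \<partial>M)
     = (\<integral>\<^sup>+ \<omega>. (\<Prod>i<n. ennreal (a i ^ (\<nu> (\<tau> (Suc i)) \<omega> - \<nu> (\<tau> i) \<omega>))) \<partial>M)"
    using a by (intro nn_integral_cong) (simp add: prod_ennreal)
  also have "\<dots> = (\<Prod>i<n. \<integral>\<^sup>+ \<omega>. ennreal (a i ^ (\<nu> (\<tau> (Suc i)) \<omega> - \<nu> (\<tau> i) \<omega>)) \<partial>M)"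
    by (rule indep_vars_nn_integral[OF _ ind]) auto
  also have "\<dots> = (\<Prod>i<n. ennreal (exp (- ((mean_measure r (\<tau> (Suc i)) - mean_measure r (\<tau> i)) * (1 - a i)))))"
    using \<tau> pos a by (intro prod.cong poisson_increment_pgf[OF P]) (auto simp: mono_def)
  also have "\<dots> = ennreal (exp (- (\<Sum>i<n. (mean_measure r (\<tau> (Suc i)) - mean_measure r (\<tau> i)) * (1 - a i))))"
    by (simp add: prod_ennreal exp_sum[symmetric] sum_negf)
  finally show ?thesis .
qed

lemma jump_time_between:
  assumes P: "poisson_process M r \<nu>" and \<omega>: "\<omega> \<in> space M" and st: "0 \<le> s" "s \<le> t"
    and k: "\<nu> s \<omega> < k" "k \<le> \<nu> t \<omega>"
  shows "s \<le> jump_time \<nu> k \<omega>" "jump_time \<nu> k \<omega> \<le> t"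
proof -
  have lower: "s \<le> u" if "u \<in> {t. 0 \<le> t \<and> k \<le> \<nu> t \<omega>}" for u
    using that k poisson_processD(6)[OF P \<omega>, of u s] by (cases "u \<le> s") auto
  have t: "t \<in> {t. 0 \<le> t \<and> k \<le> \<nu> t \<omega>}" using st k by auto
  show "s \<le> jump_time \<nu> k \<omega>" unfolding jump_time_def using t lower by (intro cInf_greatest) blast+
  show "jump_time \<nu> k \<omega> \<le> t" unfolding jump_time_def using t by (intro cInf_lower) (auto intro: bdd_belowI[of _ 0])
qed

text \<open>
  Where the path reaches the level \<open>k\<close>, \<open>S\<^sub>k < x\<close> means that the level is reached at some
  rational time before \<open>x\<close>. Elsewhere \<open>S\<^sub>k\<close> is the constant \<open>Inf {}\<close>.
\<close>

lemma jump_time_measurable: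
  assumes P: "poisson_process M r \<nu>"
  shows "jump_time \<nu> k \<in> borel_measurable M"
proof -
  interpret prob_space M by (rule poisson_processD(1)[OF P])
  define B where "B s = {\<omega> \<in> space M. k \<le> \<nu> s \<omega>}" for s
  have B: "B s \<in> events" if "0 \<le> s" for s
  proof -
    have [measurable]: "\<nu> s \<in> measurable M (count_space UNIV)" by (rule poisson_processD(4)[OF P that])
    show ?thesis unfolding B_def by measurable
  qed
  define U where "U = (\<Union>n :: nat. B (real n))"
  have U: "U \<in> events" unfolding U_def using B by auto
  have U_iff: "\<omega> \<in> U \<longleftrightarrow> \<omega> \<in> space M \<and> (\<exists>t\<ge>0. k \<le> \<nu> t \<omega>)" for \<omega>
  proof
    assume "\<omega> \<in> U"
    then obtain n :: nat where "\<omega> \<in> space M" "k \<le> \<nu> (real n) \<omega>" by (auto simp: U_def B_def)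
    then show "\<omega> \<in> space M \<and> (\<exists>t\<ge>0. k \<le> \<nu> t \<omega>)" by (intro conjI exI[of _ "real n"]) auto
  next
    assume "\<omega> \<in> space M \<and> (\<exists>t\<ge>0. k \<le> \<nu> t \<omega>)"
    then obtain t where t: "\<omega> \<in> space M" "0 \<le> t" "k \<le> \<nu> t \<omega>" by blast
    obtain n :: nat where n: "t \<le> real n" using real_arch_simple by blast
    have "k \<le> \<nu> (real n) \<omega>" using poisson_processD(6)[OF P t(1,2) n] t(3) by simp
    then show "\<omega> \<in> U" using t(1) by (auto simp: U_def B_def)
  qed
  show ?thesis
  proof (rule borel_measurableI_less)
    fix x :: real
    have less_iff: "jump_time \<nu> k \<omega> < x \<longleftrightarrow> (\<exists>u\<in>\<rat>. 0 \<le> u \<and> u < x \<and> k \<le> \<nu> u \<omega>)" if \<omega>: "\<omega> \<in> U" for \<omega>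
    proof -
      have \<omega>': "\<omega> \<in> space M" and ne: "{t. 0 \<le> t \<and> k \<le> \<nu> t \<omega>} \<noteq> {}" using \<omega> U_iff by auto
      have bdd: "bdd_below {t. 0 \<le> t \<and> k \<le> \<nu> t \<omega>}" by (rule bdd_belowI[of _ 0]) auto
      show ?thesis
      proof
        assume "jump_time \<nu> k \<omega> < x"
        then obtain t where t: "0 \<le> t" "k \<le> \<nu> t \<omega>" "t < x"
          unfolding jump_time_def using cInf_less_iff[OF ne bdd] by auto
        obtain u where u: "u \<in> \<rat>" "t < u" "u < x" using Rats_dense_in_real[OF t(3)] by blast
        then show "\<exists>u\<in>\<rat>. 0 \<le> u \<and> u < x \<and> k \<le> \<nu> u \<omega>"
          using t poisson_processD(6)[OF P \<omega>' t(1), of u] by (intro bexI[of _ u]) auto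
      next
        assume "\<exists>u\<in>\<rat>. 0 \<le> u \<and> u < x \<and> k \<le> \<nu> u \<omega>"
        then show "jump_time \<nu> k \<omega> < x"
          unfolding jump_time_def using cInf_less_iff[OF ne bdd] by auto
      qed
    qed
    have rest: "jump_time \<nu> k \<omega> = Inf {}" if "\<omega> \<in> space M - U" for \<omega>
    proof -
      have "{t. 0 \<le> t \<and> k \<le> \<nu> t \<omega>} = {}" using that U_iff by auto
      then show ?thesis unfolding jump_time_def by (rule arg_cong)
    qed
    have B_U: "B u \<subseteq> U" if "0 \<le> u" for u using that U_iff by (auto simp: B_def)
    have iff: "jump_time \<nu> k \<omega> < x \<longleftrightarrow>
        (\<exists>u\<in>{u \<in> \<rat>. 0 \<le> u \<and> u < x}. \<omega> \<in> B u) \<or> \<omega> \<notin> U \<and> Inf {} < x" if "\<omega> \<in> space M" for \<omega>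
    proof (cases "\<omega> \<in> U")
      case True
      then show ?thesis using less_iff[OF True] that by (auto simp: B_def)
    next
      case False
      moreover have "\<omega> \<notin> B u" if "0 \<le> u" for u using B_U[OF that] False by blast
      ultimately show ?thesis using rest[of \<omega>] that by auto
    qed
    have "B u \<subseteq> space M" for u by (auto simp: B_def)
    then have "{\<omega> \<in> space M. jump_time \<nu> k \<omega> < x} = (\<Union>u\<in>{u \<in> \<rat>. 0 \<le> u \<and> u < x}. B u) \<union>
        (if Inf {} < x then space M - U else {})"
      by (simp add: set_eq_iff) (use iff in blast)
    also have "\<dots> \<in> events"
    proof (rule sets.Un)
      have "countable {u \<in> \<rat>. 0 \<le> u \<and> u < x}" by (rule countable_subset[OF _ countable_rat]) auto
      then show "(\<Union>u\<in>{u \<in> \<rat>. 0 \<le> u \<and> u < x}. B u) \<in> events" using B by (intro sets.countable_UN'') auto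
    qed (use U in auto)
    finally show "{\<omega> \<in> space M. jump_time \<nu> k \<omega> < x} \<in> events" .
  qed
qed

section \<open>Survival of the immigration process\<close>

text \<open>
  The immigrants of one arrival are numbered from 1, hence \<open>Suc j\<close>. The time \<open>s\<close> is the age of the family.
\<close>

definition family_extinct :: "(nat \<Rightarrow> 'a \<Rightarrow> nat) \<Rightarrow> (nat \<Rightarrow> nat \<Rightarrow> real \<Rightarrow> 'a \<Rightarrow> nat) \<Rightarrow> nat \<Rightarrow> real \<Rightarrow> 'a \<Rightarrow> bool" where
  "family_extinct I Z k s \<omega> \<longleftrightarrow> (\<forall>j<I k \<omega>. Z k (Suc j) s \<omega> = 0)"

lemma generated_algebra_Pow: "{X i -` A \<inter> space M | i A. i \<in> J} \<subseteq> Pow (space M)"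
  by auto

lemma vimage_in_generated_algebra:
  "i \<in> J \<Longrightarrow> X i -` A \<inter> space M \<in> generated_algebra M J X"
  unfolding generated_algebra_def by (rule sigma_sets.Basic) blast

lemma sigma_algebra_generated: "sigma_algebra (space M) (generated_algebra M J X)"
  unfolding generated_algebra_def by (rule sigma_algebra_sigma_sets[OF generated_algebra_Pow])

lemma sigma_algebra_source: "sigma_algebra (space M) (source_algebra M \<nu> I Z x)"
  by (cases x) (simp_all add: sigma_algebra_generated)

lemma source_algebra_Pow: "source_algebra M \<nu> I Z x \<subseteq> Pow (space M)"
  using sigma_algebra_source[of M \<nu> I Z x] by (simp add: sigma_algebra_iff2)

lemma source_algebra_Int_stable: "Int_stable (source_algebra M \<nu> I Z x)"
proof -
  interpret sigma_algebra "space M" "source_algebra M \<nu> I Z x" by (rule sigma_algebra_source)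
  show ?thesis by (auto simp: Int_stable_def)
qed

lemma set_integrable_mult_bounded:
  fixes f g :: "real \<Rightarrow> real"
  assumes f: "set_integrable lborel {a..b} f" and g: "g \<in> borel_measurable borel" "\<And>x. \<bar>g x\<bar> \<le> 1"
  shows "set_integrable lborel {a..b} (\<lambda>x. f x * g x)"
  unfolding set_integrable_def
proof (rule Bochner_Integration.integrable_bound)
  show "integrable lborel (\<lambda>x. indicator {a..b} x *\<^sub>R f x)" using f by (simp add: set_integrable_def)
  then have "(\<lambda>x. (indicator {a..b} x *\<^sub>R f x) * g x) \<in> borel_measurable lborel"
    using g(1) by (intro borel_measurable_times) auto
  then show "(\<lambda>x. indicator {a..b} x *\<^sub>R (f x * g x)) \<in> borel_measurable lborel"
    by (simp add: mult.assoc)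
  show "AE x in lborel. norm (indicator {a..b} x *\<^sub>R (f x * g x)) \<le> norm (indicator {a..b} x *\<^sub>R f x)"
    using g(2) by (auto simp: indicator_def abs_mult mult_left_le)
qed

text \<open>
  The function \<open>q\<close> of the theorem at nonnegative times; it takes values in \<open>[0, 1]\<close> also at negative times.
\<close>

definition family_survival :: "real \<Rightarrow> nat pmf \<Rightarrow> nat pmf \<Rightarrow> real \<Rightarrow> real" where
  "family_survival \<mu> p h s = 1 - pgf h (extinction \<mu> p s)"

context
  fixes \<mu> :: real and p h :: "nat pmf"
  assumes \<mu>: "0 < \<mu>"
begin

lemma family_survival_01: "0 \<le> family_survival \<mu> p h s" "family_survival \<mu> p h s \<le> 1"
  using pgf_le_1[OF extinction_01[OF \<mu>]] pgf_nonneg[OF extinction_01(1)[OF \<mu>]] by (auto simp: family_survival_def)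

lemma family_survival_measurable: "family_survival \<mu> p h \<in> borel_measurable borel"
proof -
  have "(\<lambda>s. pgf h (extinction \<mu> p s)) \<in> borel_measurable borel"
    by (rule borel_measurable_pgf) (use extinction_01[OF \<mu>] extinction_measurable[OF \<mu>] in auto)
  then show ?thesis unfolding family_survival_def[abs_def] by measurable
qed

lemma family_survival_antimono:
  "0 \<le> s \<Longrightarrow> s \<le> t \<Longrightarrow> family_survival \<mu> p h t \<le> family_survival \<mu> p h s"
  unfolding family_survival_def by (intro diff_left_mono pgf_mono extinction_01[OF \<mu>] extinction_mono[OF \<mu>])

lemma family_survival_continuous: "continuous_on {0..} (family_survival \<mu> p h)"
  unfolding family_survival_def[abs_def]
  by (intro continuous_intros continuous_on_compose2[OF continuous_on_pgf extinction_continuous[OF \<mu>]])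
    (use extinction_01[OF \<mu>] in auto)

lemma family_survival_integrable: "set_integrable lborel {0..t} (family_survival \<mu> p h)"
  by (rule set_integrable_bounded_Icc[OF family_survival_measurable, where B=1]) (use family_survival_01 in auto)

end

context
  fixes M :: "'a measure" and \<mu> :: real and p h :: "nat pmf" and r :: "real \<Rightarrow> real"
    and \<nu> :: "real \<Rightarrow> 'a \<Rightarrow> nat" and I :: "nat \<Rightarrow> 'a \<Rightarrow> nat"
    and Z :: "nat \<Rightarrow> nat \<Rightarrow> real \<Rightarrow> 'a \<Rightarrow> nat"
  assumes \<mu>: "0 < \<mu>" and crit: "critical p" and model: "immigration_model M \<mu> p h r \<nu> I Z"
begin

lemma model_poisson: "poisson_process M r \<nu>"
  and model_immigrants: "1 \<le> k \<Longrightarrow> distr M (count_space UNIV) (I k) = measure_pmf h"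
  and model_descendants: "1 \<le> k \<Longrightarrow> 1 \<le> j \<Longrightarrow> markov_branching_process M \<mu> p (Z k j)"
  and model_indep: "prob_space.indep_sets M (source_algebra M \<nu> I Z)
       ({Arrivals} \<union> {Immigrants k | k. k \<ge> 1} \<union> {Descendants k j | k j. k \<ge> 1 \<and> j \<ge> 1})"
  using model unfolding immigration_model_def by blast+

interpretation prob_space M by (rule poisson_processD(1)[OF model_poisson])

lemma source_algebra_events:
  "x \<in> {Arrivals} \<union> {Immigrants k | k. k \<ge> 1} \<union> {Descendants k j | k j. k \<ge> 1 \<and> j \<ge> 1} \<Longrightarrow>
    source_algebra M \<nu> I Z x \<subseteq> events"
  using model_indep unfolding indep_sets_def by blast

lemma immigrants_measurable:
  assumes "1 \<le> k" shows "I k \<in> measurable M (count_space UNIV)"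
proof (rule measurableI)
  fix A
  have "I k -` A \<inter> space M \<in> source_algebra M \<nu> I Z (Immigrants k)"
    by (simp add: vimage_in_generated_algebra)
  then show "I k -` A \<inter> space M \<in> events" using source_algebra_events[of "Immigrants k"] assms by auto
qed auto

lemma descendants_measurable:
  assumes "1 \<le> k" "1 \<le> j" "0 \<le> s" shows "Z k j s \<in> measurable M (count_space UNIV)"
proof (rule measurableI)
  fix A
  have "Z k j s -` A \<inter> space M \<in> source_algebra M \<nu> I Z (Descendants k j)"
    using assms by (simp add: vimage_in_generated_algebra)
  then show "Z k j s -` A \<inter> space M \<in> events" using source_algebra_events[of "Descendants k j"] assms by auto
qed auto

lemma family_extinct_prob:
  assumes k: "1 \<le> k" and s: "0 \<le> s"
  shows "prob {\<omega> \<in> space M. family_extinct I Z k s \<omega>} = pgf h (extinction \<mu> p s)"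
  unfolding family_extinct_def
proof (rule prob_random_intersection)
  show "random_variable (count_space UNIV) (I k)" by (rule immigrants_measurable[OF k])
  show "{\<omega> \<in> space M. Z k (Suc j) s \<omega> = 0} \<in> events" for j
    using descendants_measurable[OF k _ s, of "Suc j"] by measurable
  show "0 \<le> extinction \<mu> p s" "extinction \<mu> p s \<le> 1" by (rule extinction_01[OF \<mu>])+
  fix n
  define J where "J = insert (Immigrants k) ((\<lambda>j. Descendants k (Suc j)) ` {..<n})"
  define A where "A x = (case x of Descendants k j \<Rightarrow> {\<omega> \<in> space M. Z k j s \<omega> = 0} | _ \<Rightarrow> {\<omega> \<in> space M. I k \<omega> = n})" for x
  have IA: "{\<omega> \<in> space M. I k \<omega> = n} = I k -` {n} \<inter> space M" by auto
  have ZA: "{\<omega> \<in> space M. Z k j s \<omega> = 0} = Z k j s -` {0} \<inter> space M" for j by auto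
  have "prob (\<Inter>x\<in>J. A x) = (\<Prod>x\<in>J. prob (A x))"
  proof (rule indep_setsD[OF model_indep])
    show "\<forall>x\<in>J. A x \<in> source_algebra M \<nu> I Z x"
      using s by (auto simp: J_def A_def IA ZA vimage_in_generated_algebra)
  qed (use k in \<open>auto simp: J_def\<close>)
  also have "(\<Inter>x\<in>J. A x) = {\<omega> \<in> space M. I k \<omega> = n \<and> (\<forall>j<n. Z k (Suc j) s \<omega> = 0)}"
    by (auto simp: J_def A_def)
  also have "(\<Prod>x\<in>J. prob (A x)) = prob {\<omega> \<in> space M. I k \<omega> = n} * (\<Prod>j<n. prob {\<omega> \<in> space M. Z k (Suc j) s \<omega> = 0})"
    unfolding J_def by (subst prod.insert) (auto simp: prod.reindex inj_on_def A_def)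
  also have "prob {\<omega> \<in> space M. I k \<omega> = n} = pmf h n"
  proof -
    have "prob {\<omega> \<in> space M. I k \<omega> = n} = measure (distr M (count_space UNIV) (I k)) {n}"
      unfolding IA using immigrants_measurable[OF k] by (subst measure_distr) auto
    then show ?thesis by (simp add: model_immigrants[OF k] measure_pmf_single)
  qed
  also have "(\<Prod>j<n. prob {\<omega> \<in> space M. Z k (Suc j) s \<omega> = 0}) = extinction \<mu> p s ^ n"
    using markov_branching_process_extinct_prob[OF \<mu> crit model_descendants[OF k] s] by simp
  finally show "prob {\<omega> \<in> space M. I k \<omega> = n \<and> (\<forall>j<n. Z k (Suc j) s \<omega> = 0)} = pmf h n * extinction \<mu> p s ^ n" .
qed

text \<open>
  All immigrants and descendants that belong to the \<open>k\<close>-th arrival form one block of sources, and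
  the arrival process is the block number 0; blocks of independent sources are independent.
\<close>

lemma family_extinct_indep:
  assumes B: "B \<in> source_algebra M \<nu> I Z Arrivals" and K: "finite K" "\<And>k. k \<in> K \<Longrightarrow> 1 \<le> k"
    and s: "\<And>k. k \<in> K \<Longrightarrow> 0 \<le> s k"
  shows "prob (B \<inter> {\<omega> \<in> space M. \<forall>k\<in>K. family_extinct I Z k (s k) \<omega>}) = prob B * (\<Prod>k\<in>K. pgf h (extinction \<mu> p (s k)))"
proof -
  define G where "G k = (if k = 0 then {Arrivals} else {Immigrants k} \<union> {Descendants k j | j. 1 \<le> j})" for k :: nat
  define S where "S k = sigma_sets (space M) (\<Union>x\<in>G k. source_algebra M \<nu> I Z x)" for k
  have union: "(\<Union>k. G k) = {Arrivals} \<union> {Immigrants k | k. k \<ge> 1} \<union> {Descendants k j | k j. k \<ge> 1 \<and> j \<ge> 1}"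
    unfolding G_def by (auto split: if_splits)
  have ind: "indep_sets S UNIV"
    unfolding S_def
  proof (rule indep_sets_collect_sigma)
    show "indep_sets (source_algebra M \<nu> I Z) (\<Union>k\<in>UNIV. G k)" unfolding union by (rule model_indep)
    show "Int_stable (source_algebra M \<nu> I Z x)" for x by (rule source_algebra_Int_stable)
    show "disjoint_family G" by (auto simp: disjoint_family_on_def G_def)
  qed
  have E: "{\<omega> \<in> space M. family_extinct I Z k (s k) \<omega>} \<in> S k" if k: "k \<in> K" for k
  proof -
    have "(\<Union>x\<in>G k. source_algebra M \<nu> I Z x) \<subseteq> Pow (space M)" by (intro UN_least source_algebra_Pow)
    then interpret S: sigma_algebra "space M" "S k"
      unfolding S_def by (rule sigma_algebra_sigma_sets)
    have k1: "1 \<le> k" using K k by simp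
    have I_S: "I k -` A \<inter> space M \<in> S k" for A
    proof -
      have "I k -` A \<inter> space M \<in> source_algebra M \<nu> I Z (Immigrants k)"
        by (simp add: vimage_in_generated_algebra)
      moreover have "Immigrants k \<in> G k" using k1 by (simp add: G_def)
      ultimately show ?thesis unfolding S_def by (meson UN_I sigma_sets.Basic)
    qed
    have Z_S: "Z k (Suc j) (s k) -` A \<inter> space M \<in> S k" for j A
    proof -
      have "Z k (Suc j) (s k) -` A \<inter> space M \<in> source_algebra M \<nu> I Z (Descendants k (Suc j))"
        using s[OF k] by (simp add: vimage_in_generated_algebra)
      moreover have "Descendants k (Suc j) \<in> G k" using k1 by (simp add: G_def)
      ultimately show ?thesis unfolding S_def by (meson UN_I sigma_sets.Basic)
    qed
    have "{\<omega> \<in> space M. family_extinct I Z k (s k) \<omega>}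
      = (\<Inter>j. (I k -` {..j} \<inter> space M) \<union> (Z k (Suc j) (s k) -` {0} \<inter> space M))"
      by (auto simp: family_extinct_def not_less[symmetric])
    also have "\<dots> \<in> S k" by (intro S.countable_INT) (use I_S Z_S in auto)
    finally show ?thesis .
  qed
  have "B \<in> (\<Union>x\<in>G 0. source_algebra M \<nu> I Z x)" using B by (simp add: G_def)
  then have BS: "B \<in> S 0" unfolding S_def by (rule sigma_sets.Basic)
  have K0: "0 \<notin> K" using K by force
  define A where "A k = (if k = 0 then B else {\<omega> \<in> space M. family_extinct I Z k (s k) \<omega>})" for k
  have Bsp: "B \<subseteq> space M" using B source_algebra_Pow by blast
  have "prob (\<Inter>k\<in>insert 0 K. A k) = (\<Prod>k\<in>insert 0 K. prob (A k))"
  proof (rule indep_setsD[OF ind])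
    show "\<forall>k\<in>insert 0 K. A k \<in> S k"
    proof
      fix k assume "k \<in> insert 0 K"
      then show "A k \<in> S k" using BS E[of k] K0 unfolding A_def by (cases "k = 0") simp_all
    qed
  qed (use K in auto)
  also have "(\<Inter>k\<in>insert 0 K. A k) = B \<inter> {\<omega> \<in> space M. \<forall>k\<in>K. family_extinct I Z k (s k) \<omega>}"
  proof -
    have "A 0 = B" by (simp add: A_def)
    moreover have "A k = {\<omega> \<in> space M. family_extinct I Z k (s k) \<omega>}" if "k \<in> K" for k
      using that K0 by (auto simp: A_def)
    ultimately show ?thesis using Bsp by blast
  qed
  also have "(\<Prod>k\<in>insert 0 K. prob (A k)) = prob B * (\<Prod>k\<in>K. prob (A k))"
    using K K0 by (simp add: A_def)
  also have "(\<Prod>k\<in>K. prob (A k)) = (\<Prod>k\<in>K. pgf h (extinction \<mu> p (s k)))"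
    using K K0 s by (intro prod.cong) (auto simp: A_def intro!: family_extinct_prob)
  finally show ?thesis .
qed

text \<open>
  The event asks that the families arriving in the \<open>i\<close>-th grid interval be extinct at the fixed age
  \<open>s i\<close>. As these ages do not depend on the jump points, only the numbers of arrivals up to the grid points matter.
  Given their values, the families are independent, and the expectation of
  \<open>\<Prod>i<n. b i ^ N i\<close> over the independent Poisson increments \<open>N i\<close> is an exponential.
\<close>

lemma grid_extinct_prob:
  fixes \<tau> s :: "nat \<Rightarrow> real"
  assumes \<tau>: "\<tau> 0 = 0" "mono \<tau>" and s: "\<And>i. i < n \<Longrightarrow> 0 \<le> s i"
  defines "A \<equiv> {\<omega> \<in> space M. \<forall>i<n. \<forall>k. \<nu> (\<tau> i) \<omega> < k \<and> k \<le> \<nu> (\<tau> (Suc i)) \<omega> \<longrightarrow> family_extinct I Z k (s i) \<omega>}"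
  shows "A \<in> events"
    and "prob A = exp (- (\<Sum>i<n. (mean_measure r (\<tau> (Suc i)) - mean_measure r (\<tau> i)) * (1 - pgf h (extinction \<mu> p (s i)))))"
proof -
  have \<tau>_nonneg: "0 \<le> \<tau> i" for i using \<tau> by (metis monoD le0)
  have \<tau>_le: "\<tau> i \<le> \<tau> j" if "i \<le> j" for i j using \<tau>(2) that by (rule monoD)
  have \<nu>_meas [measurable]: "\<nu> (\<tau> i) \<in> measurable M (count_space UNIV)" for i
    by (rule poisson_processD(4)[OF model_poisson \<tau>_nonneg])
  have \<nu>_mono: "\<nu> (\<tau> i) \<omega> \<le> \<nu> (\<tau> j) \<omega>" if "\<omega> \<in> space M" "i \<le> j" for i j \<omega>
    by (rule poisson_processD(6)[OF model_poisson that(1) \<tau>_nonneg \<tau>_le[OF that(2)]])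
  have \<nu>_0: "\<nu> (\<tau> 0) \<omega> = 0" if "\<omega> \<in> space M" for \<omega>
    using poisson_processD(5)[OF model_poisson that] \<tau>(1) by simp
  show A_events: "A \<in> events"
  proof -
    define Q where "Q i k \<omega> \<longleftrightarrow> (i < n \<and> \<nu> (\<tau> i) \<omega> < k \<and> k \<le> \<nu> (\<tau> (Suc i)) \<omega> \<longrightarrow> family_extinct I Z k (s i) \<omega>)" for i k \<omega>
    have [measurable]: "Measurable.pred M (Q i k)" for i k
    proof (cases "i < n \<and> 1 \<le> k")
      case True
      then have [measurable]: "I k \<in> measurable M (count_space UNIV)" by (intro immigrants_measurable) simp
      have [measurable]: "Z k (Suc j) (s i) \<in> measurable M (count_space UNIV)" for j
        using True s by (intro descendants_measurable) auto
      have "Measurable.pred M (\<lambda>\<omega>. \<nu> (\<tau> i) \<omega> < k \<and> k \<le> \<nu> (\<tau> (Suc i)) \<omega> \<longrightarrow> (\<forall>j. j < I k \<omega> \<longrightarrow> Z k (Suc j) (s i) \<omega> = 0))"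
        by measurable
      then show ?thesis using True by (simp add: Q_def[abs_def] family_extinct_def)
    next
      case False
      then have "Q i k = (\<lambda>_. True)" by (auto simp: Q_def fun_eq_iff)
      then show ?thesis by simp
    qed
    have "Measurable.pred M (\<lambda>\<omega>. \<forall>i k. Q i k \<omega>)"
      by measurable
    then have "{\<omega> \<in> space M. \<forall>i k. Q i k \<omega>} \<in> events" by (rule predE)
    moreover have "A = {\<omega> \<in> space M. \<forall>i k. Q i k \<omega>}"
      unfolding A_def Q_def by blast
    ultimately show ?thesis by simp
  qed
  define b where "b i = pgf h (extinction \<mu> p (s i))" for i
  have b: "0 \<le> b i" for i unfolding b_def by (intro pgf_nonneg extinction_01 \<mu>)
  \<comment> \<open>the numbers of arrivals up to the grid points, as a value in a countable type\<close>
  define V where "V \<omega> = map (\<lambda>i. \<nu> (\<tau> i) \<omega>) [0..<Suc n]" for \<omega>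
  have V_nth: "V \<omega> ! i = \<nu> (\<tau> i) \<omega>" if "i \<le> n" for i \<omega>
    using that by (auto simp: V_def simp del: upt_Suc)
  have V_eq: "V \<omega> = v \<longleftrightarrow> length v = Suc n \<and> (\<forall>i\<le>n. \<nu> (\<tau> i) \<omega> = v ! i)" for \<omega> v
    by (auto simp: V_def list_eq_iff_nth_eq less_Suc_eq_le simp del: upt_Suc)
  have V_set: "{\<omega> \<in> space M. V \<omega> = v} = (if length v = Suc n then space M \<inter> (\<Inter>i\<in>{..n}. \<nu> (\<tau> i) -` {v ! i} \<inter> space M) else {})" for v
    by (auto simp: V_eq)
  have V_arr: "{\<omega> \<in> space M. V \<omega> = v} \<in> source_algebra M \<nu> I Z Arrivals" for v
  proof -
    interpret S: sigma_algebra "space M" "generated_algebra M {0..} \<nu>"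
      by (rule sigma_algebra_generated)
    define W where "W = space M \<inter> (\<Inter>i\<in>{..n}. \<nu> (\<tau> i) -` {v ! i} \<inter> space M)"
    have W: "W \<in> generated_algebra M {0..} \<nu>"
      unfolding W_def
      by (intro S.Int S.top S.finite_INT vimage_in_generated_algebra) (use \<tau>_nonneg in auto)
    have "{\<omega> \<in> space M. V \<omega> = v} = (if length v = Suc n then W else {})"
      unfolding W_def by (rule V_set)
    then have "{\<omega> \<in> space M. V \<omega> = v} \<in> generated_algebra M {0..} \<nu>"
      using W S.empty_sets by (metis (full_types))
    then show ?thesis unfolding source_algebra.simps .
  qed
  have V_meas: "V \<in> measurable M (count_space UNIV)"
  proof (rule measurable_count_space_eq_countable[THEN iffD2, rotated], safe)
    fix v
    have "V -` {v} \<inter> space M = {\<omega> \<in> space M. V \<omega> = v}" by auto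
    then show "V -` {v} \<inter> space M \<in> events"
      using V_arr[of v] source_algebra_events[of Arrivals] by auto
  qed auto
  define c where "c v = (\<Prod>i<n. b i ^ (v ! Suc i - v ! i))" for v :: "nat list"
  have c_nonneg: "0 \<le> c v" for v by (auto simp: c_def b intro: prod_nonneg)
  have cond: "prob {\<omega> \<in> A. V \<omega> = v} = prob {\<omega> \<in> space M. V \<omega> = v} * c v" for v
  proof (cases "{\<omega> \<in> space M. V \<omega> = v} = {}")
    case True
    then have "{\<omega> \<in> A. V \<omega> = v} = {}" by (auto simp: A_def)
    then show ?thesis using True by (simp only: measure_empty mult_zero_left)
  next
    case False
    then obtain \<omega>0 where \<omega>0: "\<omega>0 \<in> space M" "V \<omega>0 = v" by auto
    have v_mono: "v ! i \<le> v ! j" if "i \<le> j" "j \<le> n" for i j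
      using \<nu>_mono[OF \<omega>0(1) that(1)] V_nth[of i \<omega>0] V_nth[of j \<omega>0] that \<omega>0(2) by simp
    define C where "C i = {v ! i<..v ! Suc i}" for i
    \<comment> \<open>the grid interval in which the \<open>k\<close>-th arrival takes place\<close>
    define idx where "idx k = (LEAST i. k \<le> v ! Suc i)" for k
    have idx: "idx k = i" if "i < n" "k \<in> C i" for i k
      unfolding idx_def
    proof (rule Least_equality)
      show "k \<le> v ! Suc i" using that by (simp add: C_def)
      fix j assume j: "k \<le> v ! Suc j"
      show "i \<le> j"
      proof (rule ccontr)
        assume "\<not> i \<le> j"
        then have "v ! Suc j \<le> v ! i" using that by (intro v_mono) auto
        then show False using j that by (simp add: C_def)
      qed
    qed
    define K where "K = (\<Union>i<n. C i)"
    have K1: "1 \<le> k" if "k \<in> K" for k using that by (auto simp: K_def C_def)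
    have "{\<omega> \<in> A. V \<omega> = v} = {\<omega> \<in> space M. V \<omega> = v} \<inter> {\<omega> \<in> space M. \<forall>k\<in>K. family_extinct I Z k (s (idx k)) \<omega>}"
    proof -
      have "(\<forall>i<n. \<forall>k. \<nu> (\<tau> i) \<omega> < k \<and> k \<le> \<nu> (\<tau> (Suc i)) \<omega> \<longrightarrow> family_extinct I Z k (s i) \<omega>) \<longleftrightarrow>
        (\<forall>k\<in>K. family_extinct I Z k (s (idx k)) \<omega>)" if "V \<omega> = v" for \<omega>
      proof -
        have "\<nu> (\<tau> i) \<omega> < k \<and> k \<le> \<nu> (\<tau> (Suc i)) \<omega> \<longleftrightarrow> k \<in> C i" if "i < n" for i k
          using V_nth[of i \<omega>] V_nth[of "Suc i" \<omega>] that \<open>V \<omega> = v\<close> by (simp add: C_def)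
        then have "(\<forall>i<n. \<forall>k. \<nu> (\<tau> i) \<omega> < k \<and> k \<le> \<nu> (\<tau> (Suc i)) \<omega> \<longrightarrow> family_extinct I Z k (s i) \<omega>) \<longleftrightarrow>
            (\<forall>i<n. \<forall>k\<in>C i. family_extinct I Z k (s i) \<omega>)"
          by blast
        also have "\<dots> \<longleftrightarrow> (\<forall>i<n. \<forall>k\<in>C i. family_extinct I Z k (s (idx k)) \<omega>)"
          by (intro all_cong ball_cong refl) (simp only: idx)
        also have "\<dots> \<longleftrightarrow> (\<forall>k\<in>K. family_extinct I Z k (s (idx k)) \<omega>)"
          unfolding K_def by blast
        finally show ?thesis .
      qed
      then show ?thesis by (auto simp: A_def)
    qed
    also have "prob \<dots> = prob {\<omega> \<in> space M. V \<omega> = v} * (\<Prod>k\<in>K. pgf h (extinction \<mu> p (s (idx k))))"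
    proof (rule family_extinct_indep[OF V_arr])
      show "finite K" by (auto simp: K_def C_def)
      show "0 \<le> s (idx k)" if k: "k \<in> K" for k
      proof -
        obtain i where "i < n" "k \<in> C i" using k unfolding K_def by blast
        then show ?thesis using s[of i] by (simp only: idx)
      qed
    qed (rule K1)
    also have "(\<Prod>k\<in>K. pgf h (extinction \<mu> p (s (idx k)))) = (\<Prod>i<n. \<Prod>k\<in>C i. b (idx k))"
      unfolding K_def b_def
    proof (rule prod.UNION_disjoint)
      show "\<forall>i\<in>{..<n}. \<forall>j\<in>{..<n}. i \<noteq> j \<longrightarrow> C i \<inter> C j = {}"
      proof (intro ballI impI)
        fix i j assume "i \<in> {..<n}" "j \<in> {..<n}" "i \<noteq> j"
        then show "C i \<inter> C j = {}" using idx[of i] idx[of j] by fastforce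
      qed
    qed (auto simp: C_def)
    also have "\<dots> = (\<Prod>i<n. \<Prod>k\<in>C i. b i)" by (intro prod.cong refl) (simp only: idx lessThan_iff)
    also have "\<dots> = c v" by (simp add: c_def C_def)
    finally show ?thesis .
  qed
  have "emeasure M A = (\<integral>\<^sup>+ \<omega>. ennreal (c (V \<omega>)) \<partial>M)"
    by (rule emeasure_disintegrate_countable[OF V_meas A_events cond c_nonneg])
  also have "\<dots> = (\<integral>\<^sup>+ \<omega>. ennreal (\<Prod>i<n. b i ^ (\<nu> (\<tau> (Suc i)) \<omega> - \<nu> (\<tau> i) \<omega>)) \<partial>M)"
    by (simp add: c_def V_nth Suc_leI)
  also have "\<dots> = ennreal (exp (- (\<Sum>i<n. (mean_measure r (\<tau> (Suc i)) - mean_measure r (\<tau> i)) * (1 - b i))))"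
    by (rule poisson_increments_pgf[OF model_poisson _ \<tau>(2) b]) (simp add: \<tau>)
  finally show "prob A = exp (- (\<Sum>i<n. (mean_measure r (\<tau> (Suc i)) - mean_measure r (\<tau> i)) * (1 - pgf h (extinction \<mu> p (s i)))))"
    by (simp add: emeasure_eq_measure b_def)
qed

lemma immigration_process_pos_iff:
  "immigration_process \<nu> I Z t \<omega> > 0 \<longleftrightarrow>
    (\<exists>k\<in>{1..\<nu> t \<omega>}. \<exists>j<I k \<omega>. Z k (Suc j) (t - jump_time \<nu> k \<omega>) \<omega> \<noteq> 0)"
proof -
  have "immigration_process \<nu> I Z t \<omega> > 0 \<longleftrightarrow>
      (\<exists>k\<in>{1..\<nu> t \<omega>}. \<exists>j\<in>{1..I k \<omega>}. Z k j (t - jump_time \<nu> k \<omega>) \<omega> \<noteq> 0)"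
    unfolding immigration_process_def by (auto simp: sum_eq_0_iff simp flip: neq0_conv)
  also have "\<dots> \<longleftrightarrow> (\<exists>k\<in>{1..\<nu> t \<omega>}. \<exists>j<I k \<omega>. Z k (Suc j) (t - jump_time \<nu> k \<omega>) \<omega> \<noteq> 0)"
    by (intro bex_cong refl) (metis Suc_le_eq Suc_pred atLeastAtMost_iff less_le_trans zero_less_one One_nat_def Suc_leI zero_less_Suc)
  finally show ?thesis .
qed

lemma immigration_process_pos_measurable:
  assumes t: "0 \<le> t"
  shows "{\<omega> \<in> space M. immigration_process \<nu> I Z t \<omega> > 0} \<in> events"
proof -
  \<comment> \<open>the maximum is attained by the second argument whenever there are at least \<open>k\<close> arrivals up to \<open>t\<close>\<close>
  define \<tau> where "\<tau> k \<omega> = max 0 (t - jump_time \<nu> k \<omega>)" for k \<omega>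
  define E where "E k j = {\<omega> \<in> space M. k \<le> \<nu> t \<omega>} \<inter> ({\<omega> \<in> space M. j < I k \<omega>} \<inter> (space M - {\<omega> \<in> space M. Z k (Suc j) (\<tau> k \<omega>) \<omega> = 0}))" for k j
  have E: "E k j \<in> events" if k: "1 \<le> k" for k j
  proof -
    have [measurable]: "\<nu> t \<in> measurable M (count_space UNIV)" by (rule poisson_processD(4)[OF model_poisson t])
    have [measurable]: "I k \<in> measurable M (count_space UNIV)" by (rule immigrants_measurable[OF k])
    have [measurable]: "jump_time \<nu> k \<in> borel_measurable M" by (rule jump_time_measurable[OF model_poisson])
    have "\<tau> k \<in> borel_measurable M" unfolding \<tau>_def by measurable
    then have "{\<omega> \<in> space M. Z k (Suc j) (\<tau> k \<omega>) \<omega> = 0} \<in> events"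
      by (intro markov_branching_process_extinct_measurable[OF model_descendants] k) (auto simp: \<tau>_def)
    moreover have "{\<omega> \<in> space M. k \<le> \<nu> t \<omega>} \<in> events" by measurable
    moreover have "{\<omega> \<in> space M. j < I k \<omega>} \<in> events" by measurable
    ultimately show ?thesis unfolding E_def by auto
  qed
  have "{\<omega> \<in> space M. immigration_process \<nu> I Z t \<omega> > 0} = (\<Union>k\<in>{1..}. \<Union>j. E k j)"
  proof -
    have "\<tau> k \<omega> = t - jump_time \<nu> k \<omega>" if "\<omega> \<in> space M" "1 \<le> k" "k \<le> \<nu> t \<omega>" for k \<omega>
      using jump_time_between(2)[OF model_poisson that(1) order_refl t, of k] that poisson_processD(5)[OF model_poisson that(1)]
      by (simp add: \<tau>_def)
    then show ?thesis unfolding immigration_process_pos_iff E_def by fastforce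
  qed
  also have "\<dots> \<in> events" using E by (intro sets.countable_UN'') auto
  finally show ?thesis .
qed

lemma rate_survival_integrable: "0 \<le> t \<Longrightarrow> set_integrable lborel {0..t} (\<lambda>u. r u * family_survival \<mu> p h (s - u))"
  using family_survival_measurable[OF \<mu>] family_survival_01[OF \<mu>]
  by (intro set_integrable_mult_bounded poisson_processD(3)[OF model_poisson]) auto

text \<open>
  A jump point in the \<open>i\<close>-th grid interval lies between \<open>\<tau> i\<close> and \<open>\<tau> (Suc i)\<close>, and an extinct family stays extinct.
  Replacing the age \<open>t - S\<^sub>k\<close> by the smaller \<open>t - \<tau> (Suc i)\<close> or the larger \<open>t - \<tau> i\<close> therefore
  shrinks or enlarges the event that all families are extinct. This avoids conditioning on the jump points.
\<close>

lemma grid_sandwich: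
  fixes t :: real and n :: nat
  assumes t: "0 < t" and n: "0 < n"
  defines "\<tau> \<equiv> \<lambda>i. t * real i / real n"
  defines "\<Delta> \<equiv> \<lambda>i. mean_measure r (\<tau> (Suc i)) - mean_measure r (\<tau> i)"
  shows "exp (- (\<Sum>i<n. \<Delta> i * family_survival \<mu> p h (t - \<tau> (Suc i)))) \<le> prob {\<omega> \<in> space M. immigration_process \<nu> I Z t \<omega> = 0}"
    and "prob {\<omega> \<in> space M. immigration_process \<nu> I Z t \<omega> = 0} \<le> exp (- (\<Sum>i<n. \<Delta> i * family_survival \<mu> p h (t - \<tau> i)))"
proof -
  have \<tau>0: "\<tau> 0 = 0" and \<tau>n: "\<tau> n = t" using n by (auto simp: \<tau>_def)
  have \<tau>_mono: "mono \<tau>" unfolding \<tau>_def using t by (intro monoI divide_right_mono mult_left_mono) auto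
  have \<tau>_nonneg: "0 \<le> \<tau> i" for i using t by (simp add: \<tau>_def)
  have \<tau>_le: "\<tau> i \<le> t" if "i \<le> n" for i using monoD[OF \<tau>_mono that] \<tau>n by simp
  define Y0 where "Y0 = {\<omega> \<in> space M. immigration_process \<nu> I Z t \<omega> = 0}"
  have Y0: "Y0 \<in> events"
  proof -
    have "Y0 = space M - {\<omega> \<in> space M. immigration_process \<nu> I Z t \<omega> > 0}" by (auto simp: Y0_def)
    then show ?thesis
      using sets.Diff[OF sets.top immigration_process_pos_measurable[of t]] t by simp
  qed
  define A where "A s = {\<omega> \<in> space M. \<forall>i<n. \<forall>k. \<nu> (\<tau> i) \<omega> < k \<and> k \<le> \<nu> (\<tau> (Suc i)) \<omega> \<longrightarrow> family_extinct I Z k (s i) \<omega>}" for s :: "nat \<Rightarrow> real"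
  have A: "A s \<in> events" "prob (A s) = exp (- (\<Sum>i<n. \<Delta> i * family_survival \<mu> p h (s i)))" if "\<And>i. i < n \<Longrightarrow> 0 \<le> s i" for s
  proof -
    note grid = grid_extinct_prob[where n=n and s=s, OF \<tau>0 \<tau>_mono]
    show "A s \<in> events" unfolding A_def by (rule grid(1)) (rule that)
    show "prob (A s) = exp (- (\<Sum>i<n. \<Delta> i * family_survival \<mu> p h (s i)))"
      unfolding A_def \<Delta>_def family_survival_def by (rule grid(2)) (rule that)
  qed
  have s1: "0 \<le> t - \<tau> (Suc i)" if "i < n" for i using \<tau>_le[of "Suc i"] that by simp
  have s2: "0 \<le> t - \<tau> i" if "i < n" for i using \<tau>_le[of i] that by simp
  have "AE \<omega> in M. \<forall>k j. 1 \<le> k \<longrightarrow> (\<forall>s t. 0 \<le> s \<longrightarrow> s \<le> t \<longrightarrow> Z k (Suc j) s \<omega> = 0 \<longrightarrow> Z k (Suc j) t \<omega> = 0)"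
    unfolding AE_all_countable
  proof (intro allI)
    fix k j
    show "AE \<omega> in M. 1 \<le> k \<longrightarrow> (\<forall>s t. 0 \<le> s \<longrightarrow> s \<le> t \<longrightarrow> Z k (Suc j) s \<omega> = 0 \<longrightarrow> Z k (Suc j) t \<omega> = 0)"
      using markov_branching_process_absorbed[OF \<mu> crit model_descendants, of k "Suc j"] by (cases "1 \<le> k") auto
  qed
  with AE_space have sandwich: "AE \<omega> in M. (\<omega> \<in> A (\<lambda>i. t - \<tau> (Suc i)) \<longrightarrow> \<omega> \<in> Y0) \<and> (\<omega> \<in> Y0 \<longrightarrow> \<omega> \<in> A (\<lambda>i. t - \<tau> i))"
  proof eventually_elim
    case (elim \<omega>)
    have absorbed: "Z k (Suc j) t' \<omega> = 0" if "1 \<le> k" "0 \<le> s" "s \<le> t'" "Z k (Suc j) s \<omega> = 0" for k j s t'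
      using elim(2) that by blast
    have Y0_iff: "\<omega> \<in> Y0 \<longleftrightarrow> (\<forall>k\<in>{1..\<nu> t \<omega>}. \<forall>j<I k \<omega>. Z k (Suc j) (t - jump_time \<nu> k \<omega>) \<omega> = 0)"
      using immigration_process_pos_iff[of t \<omega>] elim(1) by (auto simp: Y0_def)
    have between: "\<tau> i \<le> jump_time \<nu> k \<omega>" "jump_time \<nu> k \<omega> \<le> \<tau> (Suc i)"
      if "\<nu> (\<tau> i) \<omega> < k" "k \<le> \<nu> (\<tau> (Suc i)) \<omega>" for i k
      using jump_time_between[OF model_poisson elim(1) \<tau>_nonneg _ that] \<tau>_mono by (auto simp: mono_def)
    have \<nu>_mono: "\<nu> (\<tau> i) \<omega> \<le> \<nu> (\<tau> j) \<omega>" if "i \<le> j" for i j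
      using poisson_processD(6)[OF model_poisson elim(1) \<tau>_nonneg monoD[OF \<tau>_mono that]] .
    show ?case
    proof (intro conjI impI)
      assume a: "\<omega> \<in> A (\<lambda>i. t - \<tau> (Suc i))"
      show "\<omega> \<in> Y0"
        unfolding Y0_iff
      proof (intro ballI allI impI)
        fix k j assume k: "k \<in> {1..\<nu> t \<omega>}" and j: "j < I k \<omega>"
        obtain m where "k \<le> \<nu> (\<tau> m) \<omega>" and m_least: "\<And>i. i < m \<Longrightarrow> \<not> k \<le> \<nu> (\<tau> i) \<omega>"
          using exists_least_iff[of "\<lambda>m. k \<le> \<nu> (\<tau> m) \<omega>"] k \<tau>n by (metis atLeastAtMost_iff)
        have "\<not> k \<le> \<nu> (\<tau> 0) \<omega>"
          using k poisson_processD(5)[OF model_poisson elim(1)] unfolding \<tau>0 by simp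
        then have "m \<noteq> 0" using \<open>k \<le> \<nu> (\<tau> m) \<omega>\<close> by metis
        then obtain i where i: "m = Suc i" using not0_implies_Suc by blast
        have km: "k \<le> \<nu> (\<tau> (Suc i)) \<omega>" using \<open>k \<le> \<nu> (\<tau> m) \<omega>\<close> unfolding i .
        have ki: "\<nu> (\<tau> i) \<omega> < k" using m_least[of i] unfolding i by simp
        have "\<not> n < m" using m_least[of n] k unfolding \<tau>n by auto
        then have i_n: "i < n" unfolding i by simp
        have "\<forall>i<n. \<forall>k. \<nu> (\<tau> i) \<omega> < k \<and> k \<le> \<nu> (\<tau> (Suc i)) \<omega> \<longrightarrow> family_extinct I Z k (t - \<tau> (Suc i)) \<omega>"
          using a unfolding A_def by blast
        then have "family_extinct I Z k (t - \<tau> (Suc i)) \<omega>" using i_n ki km by blast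
        then have zero: "Z k (Suc j) (t - \<tau> (Suc i)) \<omega> = 0" using j unfolding family_extinct_def by blast
        have "t - \<tau> (Suc i) \<le> t - jump_time \<nu> k \<omega>" using between(2)[OF ki km] by simp
        moreover have "1 \<le> k" using k by simp
        ultimately show "Z k (Suc j) (t - jump_time \<nu> k \<omega>) \<omega> = 0"
          using absorbed[OF _ s1[OF i_n] _ zero] by blast
      qed
    next
      assume y: "\<omega> \<in> Y0"
      have "family_extinct I Z k (t - \<tau> i) \<omega>" if i: "i < n" and k: "\<nu> (\<tau> i) \<omega> < k" "k \<le> \<nu> (\<tau> (Suc i)) \<omega>" for i k
        unfolding family_extinct_def
      proof (intro allI impI)
        fix j assume j: "j < I k \<omega>"
        have kt: "k \<in> {1..\<nu> t \<omega>}" using k \<nu>_mono[of "Suc i" n] i \<tau>n by auto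
        then have "Z k (Suc j) (t - jump_time \<nu> k \<omega>) \<omega> = 0" using y j unfolding Y0_iff by blast
        moreover have "t - jump_time \<nu> k \<omega> \<le> t - \<tau> i" "0 \<le> t - jump_time \<nu> k \<omega>" "1 \<le> k"
          using between[OF k] s1[OF i] kt by auto
        ultimately show "Z k (Suc j) (t - \<tau> i) \<omega> = 0"
          using absorbed by blast
      qed
      then show "\<omega> \<in> A (\<lambda>i. t - \<tau> i)" using elim(1) by (simp add: A_def)
    qed
  qed
  have lower: "prob (A (\<lambda>i. t - \<tau> (Suc i))) = exp (- (\<Sum>i<n. \<Delta> i * family_survival \<mu> p h (t - \<tau> (Suc i))))"
    by (rule A(2)) (rule s1)
  have upper: "prob (A (\<lambda>i. t - \<tau> i)) = exp (- (\<Sum>i<n. \<Delta> i * family_survival \<mu> p h (t - \<tau> i)))"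
    by (rule A(2)) (rule s2)
  have upper_event: "A (\<lambda>i. t - \<tau> i) \<in> events"
    by (rule A(1)) (rule s2)
  show "exp (- (\<Sum>i<n. \<Delta> i * family_survival \<mu> p h (t - \<tau> (Suc i)))) \<le> prob {\<omega> \<in> space M. immigration_process \<nu> I Z t \<omega> = 0}"
    unfolding lower[symmetric] Y0_def[symmetric]
    by (rule finite_measure_mono_AE[OF _ Y0]) (use sandwich in auto)
  show "prob {\<omega> \<in> space M. immigration_process \<nu> I Z t \<omega> = 0} \<le> exp (- (\<Sum>i<n. \<Delta> i * family_survival \<mu> p h (t - \<tau> i)))"
    unfolding upper[symmetric] Y0_def[symmetric]
    by (rule finite_measure_mono_AE[OF _ upper_event]) (use sandwich in auto)
qed

text \<open>
  The exponents of the two bounds of the grid sandwich are sums that also enclose the integral. Since the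
  survival probability is uniformly continuous on \<open>[0, t]\<close>, they come arbitrarily close to each other for
  fine grids.
\<close>

lemma immigration_process_prob:
  assumes t: "0 < t"
  shows "prob {\<omega> \<in> space M. immigration_process \<nu> I Z t \<omega> > 0} = 1 - exp (- (LINT u:{0..t}|lborel. r u * family_survival \<mu> p h (t - u)))"
proof -
  define P where "P = prob {\<omega> \<in> space M. immigration_process \<nu> I Z t \<omega> = 0}"
  define J where "J s = (LINT u:{0..s}|lborel. r u * family_survival \<mu> p h (t - u))" for s
  define R where "R = mean_measure r"
  have R0: "R 0 = 0" by (simp add: R_def mean_measure_def set_integral_at_point)
  have R_nonneg: "0 \<le> R t" using mean_measure_diff(2)[OF model_poisson order_refl, of t] t R0 by (simp add: R_def)
  have r_int: "set_integrable lborel {a<..b} r" if "0 \<le> a" for a b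
    by (rule set_integrable_subset[OF poisson_processD(3)[OF model_poisson, of "max 0 b"]]) (use that in auto)
  have close: "\<bar>- ln P - J t\<bar> \<le> R t * \<epsilon>" if \<epsilon>: "0 < \<epsilon>" for \<epsilon>
  proof -
    have "uniformly_continuous_on {0..t} (family_survival \<mu> p h)"
      by (intro compact_uniformly_continuous continuous_on_subset[OF family_survival_continuous[OF \<mu>]]) auto
    then obtain d where d: "0 < d" "\<And>x y. x \<in> {0..t} \<Longrightarrow> y \<in> {0..t} \<Longrightarrow> \<bar>y - x\<bar> < d \<Longrightarrow> \<bar>family_survival \<mu> p h y - family_survival \<mu> p h x\<bar> < \<epsilon>"
      using \<epsilon> unfolding uniformly_continuous_on_def dist_real_def by metis
    obtain n :: nat where n': "t / d < real n" using reals_Archimedean2 by blast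
    have "0 < t / d" using t d by simp
    then have n0: "0 < real n" using n' by linarith
    then have n: "0 < n" by simp
    have mesh: "t / real n < d" using n' n0 d(1) by (simp add: field_simps)
    define \<tau> where "\<tau> i = t * real i / real n" for i
    define \<Delta> where "\<Delta> i = R (\<tau> (Suc i)) - R (\<tau> i)" for i
    have \<tau>0: "\<tau> 0 = 0" and \<tau>n: "\<tau> n = t" using n by (auto simp: \<tau>_def)
    define \<delta> where "\<delta> = t / real n"
    have \<delta>: "0 \<le> \<delta>" "\<delta> < d" using t mesh by (simp_all add: \<delta>_def)
    have \<tau>_Suc: "\<tau> (Suc i) = \<tau> i + \<delta>" for i by (simp add: \<tau>_def \<delta>_def field_simps add_divide_distrib)
    have \<tau>_nonneg: "0 \<le> \<tau> i" for i using t by (simp add: \<tau>_def)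
    have \<tau>_step: "\<tau> i \<le> \<tau> (Suc i)" for i using \<delta> by (simp add: \<tau>_Suc)
    have \<tau>_le: "\<tau> i \<le> t" if "i \<le> n" for i using that t n0 by (simp add: \<tau>_def field_simps)
    have \<Delta>_nonneg: "0 \<le> \<Delta> i" for i
      unfolding \<Delta>_def R_def by (rule mean_measure_diff(2)[OF model_poisson \<tau>_nonneg \<tau>_step])
    define lo where "lo = (\<Sum>i<n. \<Delta> i * family_survival \<mu> p h (t - \<tau> i))"
    define up where "up = (\<Sum>i<n. \<Delta> i * family_survival \<mu> p h (t - \<tau> (Suc i)))"
    have P_bounds: "exp (- up) \<le> P" "P \<le> exp (- lo)"
      using grid_sandwich[OF t n] by (simp_all add: P_def up_def lo_def \<Delta>_def \<tau>_def R_def)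
    have P_pos: "0 < P" using P_bounds(1) exp_gt_zero[of "- up"] by linarith
    have lnP: "lo \<le> - ln P" "- ln P \<le> up"
      using P_bounds P_pos by (simp_all add: ln_ge_iff[symmetric] ln_le_cancel_iff[symmetric] del: ln_le_cancel_iff)
    define piece where "piece i = (LINT u:{\<tau> i<..\<tau> (Suc i)}|lborel. r u * family_survival \<mu> p h (t - u))" for i
    have J_sum: "J (\<tau> m) = (\<Sum>i<m. piece i)" for m
    proof (induction m)
      case 0 show ?case by (simp add: \<tau>0 J_def set_integral_at_point)
    next
      case (Suc m)
      have "J (\<tau> (Suc m)) = J (\<tau> m) + piece m"
        unfolding J_def piece_def by (intro set_integral_Icc_split rate_survival_integrable \<tau>_nonneg \<tau>_step)
      then show ?case using Suc by simp
    qed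
    have piece_int: "set_integrable lborel {\<tau> i<..\<tau> (Suc i)} (\<lambda>u. r u * family_survival \<mu> p h (t - u))" for i
      by (rule set_integrable_subset[OF rate_survival_integrable[OF \<tau>_nonneg[of "Suc i"]]]) (use \<tau>_nonneg[of i] in auto)
    have \<Delta>_eq: "\<Delta> i = (LINT u:{\<tau> i<..\<tau> (Suc i)}|lborel. r u)" for i
      unfolding \<Delta>_def R_def by (rule mean_measure_diff(1)[OF model_poisson \<tau>_nonneg \<tau>_step])
    have r_nonneg: "0 \<le> r u" if "u \<in> {\<tau> i<..\<tau> (Suc i)}" for u i
      using that \<tau>_nonneg[of i] by (intro poisson_processD(2)[OF model_poisson]) auto
    have piece_lo: "\<Delta> i * family_survival \<mu> p h (t - \<tau> i) \<le> piece i" if i: "i < n" for i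
    proof -
      have "\<Delta> i * family_survival \<mu> p h (t - \<tau> i) = (LINT u:{\<tau> i<..\<tau> (Suc i)}|lborel. r u * family_survival \<mu> p h (t - \<tau> i))" by (simp add: \<Delta>_eq)
      also have "\<dots> \<le> piece i"
        unfolding piece_def using \<tau>_le[of "Suc i"] i
        by (intro set_integral_mono piece_int set_integrable_mult_left r_int \<tau>_nonneg mult_left_mono r_nonneg family_survival_antimono[OF \<mu>]) auto
      finally show ?thesis .
    qed
    have piece_up: "piece i \<le> \<Delta> i * family_survival \<mu> p h (t - \<tau> (Suc i))" if i: "i < n" for i
    proof -
      have "piece i \<le> (LINT u:{\<tau> i<..\<tau> (Suc i)}|lborel. r u * family_survival \<mu> p h (t - \<tau> (Suc i)))"
        unfolding piece_def using \<tau>_le[of "Suc i"] i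
        by (intro set_integral_mono piece_int set_integrable_mult_left r_int \<tau>_nonneg mult_left_mono r_nonneg family_survival_antimono[OF \<mu>]) auto
      also have "\<dots> = \<Delta> i * family_survival \<mu> p h (t - \<tau> (Suc i))" by (simp add: \<Delta>_eq)
      finally show ?thesis .
    qed
    have J_bounds: "lo \<le> J t" "J t \<le> up"
      unfolding \<tau>n[symmetric] J_sum lo_def up_def
      unfolding \<tau>n by (auto intro!: sum_mono piece_lo piece_up)
    have "up - lo = (\<Sum>i<n. \<Delta> i * (family_survival \<mu> p h (t - \<tau> (Suc i)) - family_survival \<mu> p h (t - \<tau> i)))"
      by (simp add: up_def lo_def sum_subtractf right_diff_distrib)
    also have "\<dots> \<le> (\<Sum>i<n. \<Delta> i * \<epsilon>)"
    proof (intro sum_mono mult_left_mono \<Delta>_nonneg)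
      fix i assume i: "i \<in> {..<n}"
      have "\<bar>family_survival \<mu> p h (t - \<tau> (Suc i)) - family_survival \<mu> p h (t - \<tau> i)\<bar> < \<epsilon>"
        using i \<tau>_le[of i] \<tau>_le[of "Suc i"] \<tau>_nonneg[of i] \<tau>_nonneg[of "Suc i"] \<delta>
        by (intro d(2)) (auto simp: \<tau>_Suc)
      then show "family_survival \<mu> p h (t - \<tau> (Suc i)) - family_survival \<mu> p h (t - \<tau> i) \<le> \<epsilon>" by simp
    qed
    also have "\<dots> = (\<Sum>i<n. \<Delta> i) * \<epsilon>" by (simp add: sum_distrib_right)
    also have "(\<Sum>i<n. \<Delta> i) = R t"
      unfolding \<Delta>_def by (subst sum_lessThan_telescope) (simp add: \<tau>0 \<tau>n R0)
    finally show ?thesis using lnP J_bounds by (simp add: abs_le_iff)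
  qed
  have "\<bar>- ln P - J t\<bar> \<le> 0"
  proof (rule field_le_epsilon)
    fix e :: real assume e: "0 < e"
    have "\<bar>- ln P - J t\<bar> \<le> R t * (e / (R t + 1))" using e R_nonneg by (intro close) simp
    also have "\<dots> \<le> e" using e R_nonneg by (simp add: field_simps)
    finally show "\<bar>- ln P - J t\<bar> \<le> 0 + e" by simp
  qed
  then have lnP: "ln P = - J t" by simp
  have P_pos: "0 < P"
    using less_le_trans[OF exp_gt_zero grid_sandwich(1)[OF t zero_less_one]] by (simp add: P_def)
  have "prob {\<omega> \<in> space M. immigration_process \<nu> I Z t \<omega> > 0} = 1 - P"
  proof -
    have "space M - {\<omega> \<in> space M. immigration_process \<nu> I Z t \<omega> > 0} = {\<omega> \<in> space M. immigration_process \<nu> I Z t \<omega> = 0}" by auto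
    then show ?thesis
      using prob_compl[OF immigration_process_pos_measurable[of t]] t by (simp add: P_def)
  qed
  also have "P = exp (- J t)" using lnP P_pos by (metis exp_ln)
  finally show ?thesis by (simp add: J_def)
qed

end

section \<open>Asymptotics\<close>

lemma one_minus_exp_asymptotic:
  fixes J D :: "real \<Rightarrow> real"
  assumes ratio: "((\<lambda>t. J t / D t) \<longlongrightarrow> 1) at_top" and D: "(D \<longlongrightarrow> 0) at_top"
  shows "((\<lambda>t. (1 - exp (- J t)) / D t) \<longlongrightarrow> 1) at_top"
proof -
  have ev: "eventually (\<lambda>t. 1/2 < J t / D t) at_top" by (rule order_tendstoD(1)[OF ratio]) simp
  have "((\<lambda>t. J t / D t * D t) \<longlongrightarrow> 1 * 0) at_top" by (intro tendsto_mult ratio D)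
  moreover have "eventually (\<lambda>t. J t / D t * D t = J t) at_top" using ev by eventually_elim auto
  ultimately have "(J \<longlongrightarrow> 0) at_top" by (auto elim: Lim_transform_eventually)
  then have J: "filterlim J (at 0) at_top"
    unfolding filterlim_at using ev by (auto elim!: eventually_mono)
  have "((\<lambda>x::real. exp (- x)) has_real_derivative - 1) (at 0)"
    by (auto intro!: derivative_eq_intros)
  then have "((\<lambda>x::real. (exp (- x) - 1) / x) \<longlongrightarrow> - 1) (at 0)"
    by (simp add: has_field_derivative_iff)
  then have "((\<lambda>x::real. - ((exp (- x) - 1) / x)) \<longlongrightarrow> - (- 1)) (at 0)"
    by (rule tendsto_minus)
  then have "((\<lambda>x::real. (1 - exp (- x)) / x) \<longlongrightarrow> 1) (at 0)"
    by (simp add: minus_divide_left)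
  from tendsto_mult[OF filterlim_compose[OF this J] ratio]
  have "((\<lambda>t. (1 - exp (- J t)) / J t * (J t / D t)) \<longlongrightarrow> 1) at_top" by simp
  moreover have "eventually (\<lambda>t. (1 - exp (- J t)) / J t * (J t / D t) = (1 - exp (- J t)) / D t) at_top"
    using ev by eventually_elim auto
  ultimately show ?thesis by (rule Lim_transform_eventually)
qed

text \<open>
  The value of the intensity at 0 is arbitrary, possibly negative, and is replaced by 0.
\<close>

lemma set_integral_change_at_0:
  fixes f :: "real \<Rightarrow> real"
  shows "set_integrable lborel {0..t} (\<lambda>u. (if 0 < u then r u else 0) * f u) \<longleftrightarrow> set_integrable lborel {0..t} (\<lambda>u. r u * f u)"
    and "(LINT u:{0..t}|lborel. (if 0 < u then r u else 0) * f u) = (LINT u:{0..t}|lborel. r u * f u)"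
proof -
  have eq: "(\<lambda>u. indicator {0..t} u *\<^sub>R ((if 0 < u then r u else 0) * f u)) = (\<lambda>u. indicator {0<..t} u *\<^sub>R (r u * f u))"
    by (auto simp: fun_eq_iff indicator_def)
  have diff: "{0<..t} = {0..t} - {0}" "{0..t} - {0<..t} \<subseteq> {0}" by auto
  show "set_integrable lborel {0..t} (\<lambda>u. (if 0 < u then r u else 0) * f u) \<longleftrightarrow> set_integrable lborel {0..t} (\<lambda>u. r u * f u)"
    unfolding set_integrable_def eq
    by (rule integrable_discrete_difference[where X="{0}"]) (auto simp: indicator_def)
  show "(LINT u:{0..t}|lborel. (if 0 < u then r u else 0) * f u) = (LINT u:{0..t}|lborel. r u * f u)"
    unfolding set_lebesgue_integral_def eq
    by (rule integral_discrete_difference[where X="{0}"]) (auto simp: indicator_def)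
qed

theorem theorem4p2:
  fixes M :: "'a measure" and N :: "'b measure"
    and p h :: "nat pmf"
    and r L l L_R :: "real \<Rightarrow> real"
    and \<mu> \<gamma> \<alpha> \<theta> :: real
    and \<nu> :: "real \<Rightarrow> 'a \<Rightarrow> nat" and I :: "nat \<Rightarrow> 'a \<Rightarrow> nat"
    and Z :: "nat \<Rightarrow> nat \<Rightarrow> real \<Rightarrow> 'a \<Rightarrow> nat"
    and Z0 :: "real \<Rightarrow> 'b \<Rightarrow> nat"
  assumes "\<mu> > 0"
    and "immigration_model M \<mu> p h r \<nu> I Z"
    and "markov_branching_process N \<mu> p Z0"
    and "critical p"
    and "0 < \<gamma>" "\<gamma> \<le> 1" "0 < \<alpha>" "\<alpha> \<le> 1" "0 < \<theta>"
    and "slowly_varying L" "slowly_varying l" "slowly_varying L_R"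
    and "\<And>s. 0 \<le> s \<Longrightarrow> s < 1 \<Longrightarrow> pgf p s = s + (1 - s) powr (\<gamma> + 1) * L (1 / (1 - s))"
    and "\<And>s. 0 \<le> s \<Longrightarrow> s < 1 \<Longrightarrow> pgf h s = 1 - (1 - s) powr \<alpha> * l (1 / (1 - s))"
    and "\<And>t. 0 < t \<Longrightarrow> r t = t powr (- \<theta>) * L_R t"
  shows "(\<theta> \<ge> 1 \<and> 0 < \<alpha> / \<gamma> \<and> \<alpha> / \<gamma> < 1 \<longrightarrow>
           ((\<lambda>t. measure M {\<omega> \<in> space M. immigration_process \<nu> I Z t \<omega> > 0}
                   / (mean_measure r t * q N Z0 h t)) \<longlongrightarrow> 1) at_top) \<and>
         (0 < \<theta> \<and> \<theta> < 1 \<and> \<alpha> / \<gamma> \<ge> 1 \<longrightarrow>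
           ((\<lambda>t. measure M {\<omega> \<in> space M. immigration_process \<nu> I Z t \<omega> > 0}
                   / (r t * Q N Z0 h t)) \<longlongrightarrow> 1) at_top)"
proof (intro conjI impI)
  note \<mu> = assms(1) and model = assms(2) and Z0 = assms(3) and crit = assms(4) and \<gamma> = assms(5,6)
    and \<alpha> = assms(7,8) and L = assms(10) and l = assms(11) and L_R = assms(12)
    and f = assms(13) and g = assms(14) and r_eq = assms(15)
  note P = model_poisson[OF \<mu> crit model]
  define B where "B = family_survival \<mu> p h"
  define r' where "r' = (\<lambda>t. if 0 < t then r t else 0)"
  define J where "J t = (LINT u:{0..t}|lborel. r u * B (t - u))" for t
  note B_bounds = family_survival_01[OF \<mu>, of p h, folded B_def]
    and B_int = family_survival_integrable[OF \<mu>, of _ p h, folded B_def]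
  have B_RV: "regularly_varying B (- (\<alpha> / \<gamma>))"
    unfolding B_def family_survival_def[abs_def]
    by (rule survival_function_regularly_varying[where f="pgf p" and g="pgf h" and \<mu>=\<mu> and L=L and l=l])
      (auto intro: \<mu> \<gamma> L l extinction_0[OF \<mu>] extinction_01[OF \<mu>] extinction_less_1[OF \<mu>] extinction_ode[OF \<mu>]
        continuous_on_subset[OF continuous_on_pgf] pgf_mono critical_pgf_gt[OF crit L f] f g)
  have r'_RV: "regularly_varying r' (- \<theta>)"
    by (rule regularly_varying_powr_mult[OF L_R]) (simp add: r'_def r_eq)
  have r'_nonneg: "0 \<le> r' t" for t using poisson_processD(2)[OF P, of t] by (simp add: r'_def)
  have r'_int: "set_integrable lborel {0..t} r'" for t
    using set_integral_change_at_0(1)[of t r "\<lambda>_. 1"] poisson_processD(3)[OF P, of t]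
    by (cases "0 \<le> t") (simp_all add: r'_def)
  have r'_mean: "(LINT u:{0..t}|lborel. r' u) = mean_measure r t" for t
    using set_integral_change_at_0(2)[of t r "\<lambda>_. 1"] by (simp add: r'_def mean_measure_def)
  have J_r': "J t = (LINT u:{0..t}|lborel. r' u * B (t - u))" for t
    by (simp add: J_def r'_def set_integral_change_at_0(2))
  have conv_int: "set_integrable lborel {0..t} (\<lambda>u. r' u * B (t - u))" for t
    using set_integral_change_at_0(1)[of t r "\<lambda>u. B (t - u)"] rate_survival_integrable[OF \<mu> crit model, of t t, folded B_def]
    by (cases "0 \<le> t") (simp_all add: r'_def)
  have q_B: "q N Z0 h t = B t" if "0 \<le> t" for t
  proof -
    interpret N: prob_space N using Z0 by (simp add: markov_branching_process_def)
    have ev: "{\<omega> \<in> space N. Z0 t \<omega> = 0} \<in> sets N"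
      using markov_branching_process_extinct_measurable[OF Z0, of "\<lambda>_. t"] that by simp
    have "branching_pgf N Z0 t 0 = (\<integral>\<omega>. indicator {\<omega> \<in> space N. Z0 t \<omega> = 0} \<omega> \<partial>N)"
      unfolding branching_pgf_def by (intro Bochner_Integration.integral_cong) (auto simp: indicator_def power_0_left)
    also have "\<dots> = measure N {\<omega> \<in> space N. Z0 t \<omega> = 0}" using ev by simp
    also have "\<dots> = extinction \<mu> p t" by (rule markov_branching_process_extinct_prob[OF \<mu> crit Z0 that])
    finally show ?thesis by (simp add: q_def q_pgf_def B_def family_survival_def)
  qed
  have Q_B: "Q N Z0 h t = (LINT u:{0..t}|lborel. B u)" for t
    unfolding Q_def by (intro set_lebesgue_integral_cong) (auto simp: q_B)
  have prob: "measure M {\<omega> \<in> space M. immigration_process \<nu> I Z t \<omega> > 0} = 1 - exp (- J t)" if "0 < t" for t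
    using immigration_process_prob[OF \<mu> crit model that, folded B_def] by (simp add: J_def)
  {
    assume a: "\<theta> \<ge> 1 \<and> 0 < \<alpha> / \<gamma> \<and> \<alpha> / \<gamma> < 1"
    have "((\<lambda>t. (1 - exp (- J t)) / (mean_measure r t * B t)) \<longlongrightarrow> 1) at_top"
    proof (rule one_minus_exp_asymptotic)
      show "((\<lambda>t. J t / (mean_measure r t * B t)) \<longlongrightarrow> 1) at_top"
        unfolding J_r' r'_mean[symmetric]
        by (rule regularly_varying_convolution[OF r'_RV _ r'_nonneg r'_int B_RV _ _ B_bounds(1) B_int conv_int]) (use a in auto)
      show "((\<lambda>t. mean_measure r t * B t) \<longlongrightarrow> 0) at_top"
        unfolding r'_mean[symmetric]
        by (rule regularly_varying_convolution_denominator[OF r'_RV _ r'_nonneg r'_int B_RV _ B_bounds(1)]) (use a in auto)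
    qed
    then show "((\<lambda>t. measure M {\<omega> \<in> space M. immigration_process \<nu> I Z t \<omega> > 0}
                   / (mean_measure r t * q N Z0 h t)) \<longlongrightarrow> 1) at_top"
      by (rule Lim_transform_eventually)
        (use eventually_gt_at_top[of 0] in \<open>eventually_elim, simp add: prob q_B\<close>)
  next
    assume a: "0 < \<theta> \<and> \<theta> < 1 \<and> \<alpha> / \<gamma> \<ge> 1"
    have J_swap: "J t = (LINT u:{0..t}|lborel. B u * r' (t - u))" for t
      using set_integral_reflect(2)[OF conv_int[of t]] by (simp add: J_r' mult.commute)
    have conv_int': "set_integrable lborel {0..t} (\<lambda>u. B u * r' (t - u))" for t
      using set_integral_reflect(1)[OF conv_int[of t]] by (simp add: mult.commute)
    have "((\<lambda>t. (1 - exp (- J t)) / (Q N Z0 h t * r' t)) \<longlongrightarrow> 1) at_top"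
    proof (rule one_minus_exp_asymptotic)
      show "((\<lambda>t. J t / (Q N Z0 h t * r' t)) \<longlongrightarrow> 1) at_top"
        unfolding J_swap Q_B
        by (rule regularly_varying_convolution[OF B_RV _ B_bounds(1) B_int r'_RV _ _ r'_nonneg r'_int conv_int']) (use a in auto)
      show "((\<lambda>t. Q N Z0 h t * r' t) \<longlongrightarrow> 0) at_top"
        unfolding Q_B
        by (rule regularly_varying_convolution_denominator[OF B_RV _ B_bounds(1) B_int r'_RV _ r'_nonneg]) (use a in auto)
    qed
    then show "((\<lambda>t. measure M {\<omega> \<in> space M. immigration_process \<nu> I Z t \<omega> > 0}
                   / (r t * Q N Z0 h t)) \<longlongrightarrow> 1) at_top"
      by (rule Lim_transform_eventually)
        (use eventually_gt_at_top[of 0] in \<open>eventually_elim, simp add: prob r'_def mult.commute\<close>)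
  }
qed

end
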